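(* Let $K=\mathbb C$. Let $G$ be a finite group, and let $\beta$ be a faithful $\mathbb C$-linear representation of $G$ of dimension $d$ with quotient scheme $\operatorname{Spec}\mathbb C[X_1,\ldots,X_d]^\beta$. Then for every faithful $\mathbb C$-linear representation $\rho$ of $G$, the fundamental group of the regular locus of the quotient scheme $Z_\rho$ is isomorphic to $G$.
   Context: For a representation $\rho$ of dimension $m$, $Z_\rho=(\mathbb A^d\times\mathbb A^m)/(\beta\times\rho)=\operatorname{Spec}\big(\mathbb C[X_1,\ldots,X_d,W_1,\ldots,W_m]^{\beta\times\rho}\big)$, where $\beta\times\rho$ is the product action of $G$ on both factors. Schemes of finite type over $\mathbb C$ are considered as complex analytic spaces, and the fundamental group is the topological one. *)

theory Defs
  imports
    "HOL-Analysis.Analysis"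
    "HOL-Algebra.QuotRing"
    "HOL-Algebra.Ring_Divisibility"
    "HOL-Computational_Algebra.Fraction_Field"
    "HOL-Library.Poly_Mapping"
    "HOL-Library.Extended_Nat"
    "Jordan_Normal_Form.Matrix"
begin

section \<open>The fundamental group\<close>

definition loop_class :: "'a::topological_space set \<Rightarrow> (real \<Rightarrow> 'a) \<Rightarrow> (real \<Rightarrow> 'a) set"
  where "loop_class S p = {q. homotopic_paths S p q}"

definition fundamental_group :: "'a::topological_space set \<Rightarrow> 'a \<Rightarrow> (real \<Rightarrow> 'a) set monoid"
  where "fundamental_group S x =
    \<lparr>carrier = loop_class S ` {p. path p \<and> path_image p \<subseteq> S \<and> pathstart p = x \<and> pathfinish p = x},
     mult = (\<lambda>A B. \<Union>p\<in>A. \<Union>q\<in>B. loop_class S (p +++ q)),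
     one = loop_class S (\<lambda>_. x)\<rparr>"


section \<open>Commutative algebra\<close>

text \<open>A subset of a type with ring operations, as a ring in the sense of HOL-Algebra.\<close>

definition ring_on :: "'a::comm_ring_1 set \<Rightarrow> 'a ring"
  where "ring_on A = \<lparr>carrier = A, mult = (*), one = 1, zero = 0, add = (+)\<rparr>"

definition Spec :: "('a, 'b) ring_scheme \<Rightarrow> 'a set set"
  where "Spec R = {P. primeideal P R}"

text \<open>The localization of a domain at a prime, inside a field containing the domain.\<close>

definition local_ring_at :: "'a::idom set \<Rightarrow> 'a set \<Rightarrow> 'a fract ring"
  where "local_ring_at A P = ring_on {Fract a s | a s. a \<in> A \<and> s \<in> A - P}"

definition krull_dim :: "('a, 'b) ring_scheme \<Rightarrow> enat"
  where "krull_dim R =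
    Sup {enat n | n. \<exists>P. (\<forall>i\<le>n. P i \<in> Spec R) \<and> (\<forall>i<n. P i \<subset> P (Suc i))}"

text \<open>A Noetherian local ring whose maximal ideal is generated by as many elements as the
  Krull dimension.  Fewer generators never suffice, so this is the equality of embedding
  dimension and Krull dimension.\<close>

definition regular_local_ring :: "('a, 'b) ring_scheme \<Rightarrow> bool"
  where "regular_local_ring R \<longleftrightarrow>
    cring R \<and> noetherian_ring R \<and> (\<exists>!M. maximalideal M R) \<and>
    (\<forall>M. maximalideal M R \<longrightarrow>
      (\<exists>S\<subseteq>carrier R. finite S \<and> Idl\<^bsub>R\<^esub> S = M \<and> enat (card S) = krull_dim R))"

definition regular_locus :: "'a::idom set \<Rightarrow> 'a set set"
  where "regular_locus A = {P \<in> Spec (ring_on A). regular_local_ring (local_ring_at A P)}"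


section \<open>Polynomials\<close>

text \<open>Monomials are finitely supported exponent functions; the variables are numbered from 0.\<close>

type_synonym cpoly = "(nat \<Rightarrow>\<^sub>0 nat) \<Rightarrow>\<^sub>0 complex"

definition Const :: "complex \<Rightarrow> cpoly"
  where "Const c = Poly_Mapping.single 0 c"

definition Var :: "nat \<Rightarrow> cpoly"
  where "Var i = Poly_Mapping.single (Poly_Mapping.single i 1) 1"

definition polys :: "nat \<Rightarrow> cpoly set"
  where "polys n = {f. \<forall>t\<in>Poly_Mapping.keys f. Poly_Mapping.keys t \<subseteq> {..<n}}"

definition poly_subst :: "(nat \<Rightarrow> cpoly) \<Rightarrow> cpoly \<Rightarrow> cpoly"
  where "poly_subst \<sigma> f =
    (\<Sum>t\<in>Poly_Mapping.keys f. Const (Poly_Mapping.lookup f t) *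
      (\<Prod>i\<in>Poly_Mapping.keys t. \<sigma> i ^ Poly_Mapping.lookup t i))"

text \<open>The pullback of a polynomial along the linear map given by a matrix:
  \<open>f(X)\<close> becomes \<open>f(A X)\<close>, with \<open>X\<close> the column of variables.\<close>

definition lin_subst :: "complex mat \<Rightarrow> cpoly \<Rightarrow> cpoly"
  where "lin_subst A = poly_subst (\<lambda>i. \<Sum>j<dim_col A. Const (A $$ (i, j)) * Var j)"


section \<open>Representations and their quotients\<close>

definition representation :: "('g, 'b) monoid_scheme \<Rightarrow> nat \<Rightarrow> ('g \<Rightarrow> complex mat) \<Rightarrow> bool"
  where "representation G n \<rho> \<longleftrightarrow> \<rho> \<in> hom G (units_of (ring_mat TYPE(complex) n ()))"

definition faithful_representation :: "('g, 'b) monoid_scheme \<Rightarrow> nat \<Rightarrow> ('g \<Rightarrow> complex mat) \<Rightarrow> bool"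
  where "faithful_representation G n \<rho> \<longleftrightarrow> representation G n \<rho> \<and> inj_on \<rho> (carrier G)"

definition product_rep ::
    "nat \<Rightarrow> nat \<Rightarrow> ('g \<Rightarrow> complex mat) \<Rightarrow> ('g \<Rightarrow> complex mat) \<Rightarrow> 'g \<Rightarrow> complex mat"
  where "product_rep d m \<beta> \<rho> g = four_block_mat (\<beta> g) (0\<^sub>m d m) (0\<^sub>m m d) (\<rho> g)"

definition invariants :: "('g, 'b) monoid_scheme \<Rightarrow> nat \<Rightarrow> ('g \<Rightarrow> complex mat) \<Rightarrow> cpoly set"
  where "invariants G n \<rho> = {f \<in> polys n. \<forall>g\<in>carrier G. lin_subst (\<rho> g) f = f}"

text \<open>The coordinate ring of \<open>Z\<^sub>\<rho>\<close>.  The variables \<open>X\<^sub>1, \<dots>, X\<^sub>d\<close> are numbered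
  \<open>0, \<dots>, d - 1\<close>, and \<open>W\<^sub>1, \<dots>, W\<^sub>m\<close> are numbered \<open>d, \<dots>, d + m - 1\<close>.\<close>

definition Z_ring ::
    "('g, 'b) monoid_scheme \<Rightarrow> nat \<Rightarrow> nat \<Rightarrow> ('g \<Rightarrow> complex mat) \<Rightarrow> ('g \<Rightarrow> complex mat) \<Rightarrow> cpoly set"
  where "Z_ring G d m \<beta> \<rho> = invariants G (d + m) (product_rep d m \<beta> \<rho>)"


section \<open>The associated analytic space\<close>

text \<open>The complex points of the spectrum of a \<open>\<complex>\<close>-algebra \<open>A\<close> of polynomials: the \<open>\<complex>\<close>-algebra
  homomorphisms to \<open>\<complex>\<close>, normalized to be \<open>undefined\<close> outside \<open>A\<close>.\<close>

definition complex_points :: "cpoly set \<Rightarrow> (cpoly \<Rightarrow> complex) set"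
  where "complex_points A =
    {\<phi> \<in> Ring.ring_hom (ring_on A) (ring_on UNIV). (\<forall>c. \<phi> (Const c) = c) \<and> \<phi> \<in> extensional A}"

text \<open>The analytic space of an open subscheme \<open>U\<close> of the spectrum of \<open>A\<close>: the complex points whose
  kernel lies in \<open>U\<close>.  Its analytic topology is the coarsest one making evaluation at every
  \<open>f \<in> A\<close> continuous, that is, the subspace topology from the product topology with which the
  library equips the function type \<open>cpoly \<Rightarrow> complex\<close>; the coordinates outside \<open>A\<close> are constant
  and do not matter.\<close>

definition analytic_points :: "cpoly set \<Rightarrow> cpoly set set \<Rightarrow> (cpoly \<Rightarrow> complex) set"
  where "analytic_points A U =
    {\<phi> \<in> complex_points A. a_kernel (ring_on A) (ring_on UNIV) \<phi> \<in> U}"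

definition Z_regular ::
    "('g, 'b) monoid_scheme \<Rightarrow> nat \<Rightarrow> nat \<Rightarrow> ('g \<Rightarrow> complex mat) \<Rightarrow> ('g \<Rightarrow> complex mat)
      \<Rightarrow> (cpoly \<Rightarrow> complex) set"
  where "Z_regular G d m \<beta> \<rho> =
    analytic_points (Z_ring G d m \<beta> \<rho>) (regular_locus (Z_ring G d m \<beta> \<rho>))"

end

theory Submission
  imports
    Defs
    "HOL-Complex_Analysis.Conformal_Mappings"
    "Jordan_Normal_Form.Char_Poly"
begin

text \<open>
  Put \<open>n = d + m\<close> and let \<open>G\<close> act on \<open>\<complex>\<^sup>n\<close> by \<open>\<beta> \<times> \<rho>\<close>.  Since both representations are faithful,
  an element \<open>g \<noteq> 1\<close> moves vectors of either factor, so the rank of \<open>g - 1\<close> is at least two: no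
  element is a pseudoreflection, and the fixed loci of the elements \<open>g \<noteq> 1\<close> have complex
  codimension at least two (\<open>small_product_action\<close>).  Everything else holds for every finite linear
  action with this property.  The complement \<open>V\<close> of the fixed loci is simply connected, because they
  have real codimension at least four (\<open>simply_connected_V\<close>).  The group acts freely on \<open>V\<close>, so
  \<open>V \<rightarrow> V / G\<close> is a universal covering and the fundamental group of \<open>V / G\<close> is \<open>G\<close>
  (\<open>fundamental_group_quotient\<close>).  What remains is to see that the regular locus of
  \<open>Spec \<complex>[X]\<^sup>G\<close> with its analytic topology is \<open>V / G\<close>.

  As a topological space, the set of complex points of \<open>\<complex>[X]\<^sup>G\<close> is \<open>\<complex>\<^sup>n / G\<close>.  Points are orbits,
  because the coordinates are integral over the invariants and averaging over \<open>G\<close> makes every proper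
  ideal of invariants extend to a proper ideal of polynomials (\<open>complex_points_are_orbits\<close>), and
  because invariants separate orbits (\<open>point_eq_iff\<close>).  The quotient map is open by a compactness
  argument that again rests on integrality (\<open>vpoint_nhd\<close>).

  The local rings of the quotient at complex points have dimension \<open>n\<close>
  (\<open>krull_dim_local_ring\<close>): a chain of primes cannot be longer than the number of algebraically
  independent polynomials, and a flag of affine subspaces gives a chain of length \<open>n\<close>.  So a point
  is regular if and only if the maximal ideal of its local ring is generated by \<open>n\<close> elements.

  At a point \<open>w\<close> with trivial stabilizer, averages of the coordinate functions, cut off at the other
  points of the orbit, generate the maximal ideal (\<open>local_coordinates\<close>).

  Conversely let \<open>v\<close> be the representative of a regular point, and let invariants \<open>f\<^sub>1, \<dots>, f\<^sub>n\<close>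
  generate the maximal ideal.  Their differentials span all differentials of invariants not only at
  \<open>v\<close> but at all points near \<open>v\<close> (\<open>generators_control_differentials\<close>).  At the points near \<open>v\<close> with
  trivial stabilizer, these are all covectors, so there the Jacobian determinant \<open>J\<close> of the \<open>f\<^sub>j\<close> does
  not vanish.  If the stabilizer of \<open>v\<close> were nontrivial, invariance of the \<open>f\<^sub>j\<close> would force
  \<open>J(v) = 0\<close>.  But the zero set of \<open>J\<close> is then a hypersurface through \<open>v\<close>, which is not contained in
  the fixed loci because of their codimension (\<open>free_zero_nearby\<close>), a contradiction.
\<close>

section \<open>Polynomials as functions\<close>

abbreviation coeff_of :: "cpoly \<Rightarrow> (nat \<Rightarrow>\<^sub>0 nat) \<Rightarrow> complex"
  where "coeff_of \<equiv> Poly_Mapping.lookup"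

definition monom_ev :: "(nat \<Rightarrow> complex) \<Rightarrow> (nat \<Rightarrow>\<^sub>0 nat) \<Rightarrow> complex"
  where "monom_ev x t = (\<Prod>i\<in>Poly_Mapping.keys t. x i ^ Poly_Mapping.lookup t i)"

definition ev :: "(nat \<Rightarrow> complex) \<Rightarrow> cpoly \<Rightarrow> complex"
  where "ev x f = (\<Sum>t\<in>Poly_Mapping.keys f. coeff_of f t * monom_ev x t)"

lemma monom_ev_superset:
  assumes "finite I" "Poly_Mapping.keys t \<subseteq> I"
  shows "monom_ev x t = (\<Prod>i\<in>I. x i ^ Poly_Mapping.lookup t i)"
  unfolding monom_ev_def using assms
  by (intro prod.mono_neutral_left) (auto simp: in_keys_iff)

lemma monom_ev_add: "monom_ev x (s + t) = monom_ev x s * monom_ev x t"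
proof -
  let ?I = "Poly_Mapping.keys s \<union> Poly_Mapping.keys t"
  have "monom_ev x (s + t) = (\<Prod>i\<in>?I. x i ^ Poly_Mapping.lookup (s + t) i)"
    by (intro monom_ev_superset) (auto simp: keys_add)
  also have "\<dots> = monom_ev x s * monom_ev x t"
    by (subst (1 2) monom_ev_superset[where I = ?I])
      (auto simp: lookup_add power_add prod.distrib)
  finally show ?thesis .
qed

lemma ev_superset:
  assumes "finite T" "Poly_Mapping.keys f \<subseteq> T"
  shows "ev x f = (\<Sum>t\<in>T. coeff_of f t * monom_ev x t)"
  unfolding ev_def using assms
  by (intro sum.mono_neutral_left) (auto simp: in_keys_iff)

lemma ev_single: "ev x (Poly_Mapping.single t c) = c * monom_ev x t"
  by (subst ev_superset[where T = "{t}"]) auto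

lemma ev_add [simp]: "ev x (f + g) = ev x f + ev x g"
proof -
  let ?T = "Poly_Mapping.keys f \<union> Poly_Mapping.keys g"
  have "ev x (f + g) = (\<Sum>t\<in>?T. coeff_of (f + g) t * monom_ev x t)"
    by (intro ev_superset) (auto simp: keys_add)
  also have "\<dots> = ev x f + ev x g"
    by (subst (1 2) ev_superset[where T = ?T])
      (auto simp: lookup_add algebra_simps sum.distrib)
  finally show ?thesis .
qed

lemma ev_zero [simp]: "ev x 0 = 0"
  by (simp add: ev_def)

lemma ev_sum [simp]: "ev x (sum f I) = (\<Sum>i\<in>I. ev x (f i))"
  by (induction I rule: infinite_finite_induct) auto

lemma sum_of_terms:
  "f = (\<Sum>t\<in>Poly_Mapping.keys f. Poly_Mapping.single t (Poly_Mapping.lookup f t))"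
  by (rule poly_mapping_eqI)
    (auto simp: lookup_sum lookup_single when_def in_keys_iff sum.delta)

lemma ev_mult [simp]: "ev x (f * g) = ev x f * ev x g"
proof -
  have "f * g = (\<Sum>s\<in>Poly_Mapping.keys f. \<Sum>t\<in>Poly_Mapping.keys g.
      Poly_Mapping.single (s + t) (coeff_of f s * coeff_of g t))"
  proof -
    have "f * g = (\<Sum>s\<in>Poly_Mapping.keys f. Poly_Mapping.single s (coeff_of f s)) *
        (\<Sum>t\<in>Poly_Mapping.keys g. Poly_Mapping.single t (coeff_of g t))"
      by (simp flip: sum_of_terms)
    then show ?thesis by (simp only: sum_product mult_single)
  qed
  then show ?thesis
    by (simp add: ev_single monom_ev_add)
      (simp add: ev_def sum_product algebra_simps)
qed

lemma ev_Const [simp]: "ev x (Const c) = c"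
  by (simp add: Const_def ev_single monom_ev_def)

lemma ev_Var [simp]: "ev x (Var i) = x i"
  by (simp add: Var_def ev_single monom_ev_def)

lemma Const_0 [simp]: "Const 0 = 0" and Const_1 [simp]: "Const 1 = 1"
  by (simp_all add: Const_def)

lemma Const_add: "Const (a + b) = Const a + Const b"
  and Const_mult: "Const (a * b) = Const a * Const b"
  and Const_minus: "Const (- a) = - Const a"
  by (simp_all add: Const_def single_add mult_single single_uminus)

lemma ev_one [simp]: "ev x 1 = 1"
  using ev_Const[of x 1] by simp

lemma ev_uminus [simp]: "ev x (- f) = - ev x f"
proof -
  have "- f = Const (-1) * f" by (simp add: Const_minus)
  then have "ev x (- f) = - 1 * ev x f" by (metis ev_mult ev_Const)
  then show ?thesis by simp
qed

lemma ev_diff [simp]: "ev x (f - g) = ev x f - ev x g"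
  using ev_add[of x f "- g"] by simp

lemma ev_power [simp]: "ev x (f ^ k) = ev x f ^ k"
  by (induction k) auto

lemma ev_prod [simp]: "ev x (prod f I) = (\<Prod>i\<in>I. ev x (f i))"
  by (induction I rule: infinite_finite_induct) auto

lemma ev_hom: "comm_ring_hom (ev x)"
  by unfold_locales auto

lemma continuous_ev: "continuous_on S (\<lambda>x. ev x f)"
proof -
  have "continuous_on S (\<lambda>x::nat \<Rightarrow> complex. x i)" for i
    by (rule continuous_on_subset[OF continuous_on_product_coordinates]) simp
  then show ?thesis
    unfolding ev_def monom_ev_def by (intro continuous_intros)
qed


subsection \<open>Polynomials in the first \<open>n\<close> variables\<close>

lemma polys_single: "Poly_Mapping.keys t \<subseteq> {..<n} \<Longrightarrow> Poly_Mapping.single t c \<in> polys n"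
  by (auto simp: polys_def)

lemma polys_Const [simp]: "Const c \<in> polys n"
  unfolding Const_def by (rule polys_single) simp

lemma polys_zero [simp]: "0 \<in> polys n" and polys_one [simp]: "1 \<in> polys n"
  using polys_Const[of 0 n] polys_Const[of 1 n] by simp_all

lemma polys_Var [simp]: "i < n \<Longrightarrow> Var i \<in> polys n"
  unfolding Var_def by (rule polys_single) auto

lemma polys_add [simp]: "f \<in> polys n \<Longrightarrow> g \<in> polys n \<Longrightarrow> f + g \<in> polys n"
  using keys_add[of f g] by (auto simp: polys_def)

lemma polys_mult [simp]:
  assumes "f \<in> polys n" "g \<in> polys n" shows "f * g \<in> polys n"
proof -
  have "Poly_Mapping.keys t \<subseteq> {..<n}" if "t \<in> Poly_Mapping.keys (f * g)" for t
  proof -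
    obtain a b where "t = a + b" "a \<in> Poly_Mapping.keys f" "b \<in> Poly_Mapping.keys g"
      using \<open>t \<in> _\<close> keys_mult[of f g] by auto
    then show ?thesis using assms keys_add[of a b] by (fastforce simp: polys_def)
  qed
  then show ?thesis by (auto simp: polys_def)
qed

lemma polys_uminus [simp]: "f \<in> polys n \<Longrightarrow> - f \<in> polys n"
  using polys_mult[OF polys_Const[of "-1"], of f n] by (simp add: Const_minus)

lemma polys_diff [simp]: "f \<in> polys n \<Longrightarrow> g \<in> polys n \<Longrightarrow> f - g \<in> polys n"
  using polys_add[of f n "- g"] by simp

lemma polys_sum [simp]: "(\<And>i. i \<in> I \<Longrightarrow> f i \<in> polys n) \<Longrightarrow> sum f I \<in> polys n"
  by (induction I rule: infinite_finite_induct) auto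

lemma polys_prod [simp]: "(\<And>i. i \<in> I \<Longrightarrow> f i \<in> polys n) \<Longrightarrow> prod f I \<in> polys n"
  by (induction I rule: infinite_finite_induct) auto

lemma polys_power [simp]: "f \<in> polys n \<Longrightarrow> f ^ k \<in> polys n"
  by (induction k) auto

lemma polys_mono: "m \<le> n \<Longrightarrow> polys m \<subseteq> polys n"
  by (fastforce simp: polys_def)

lemma single_eq_prod_Var:
  "Poly_Mapping.single t c =
    Const c * (\<Prod>i\<in>Poly_Mapping.keys t. Var i ^ Poly_Mapping.lookup t i)"
proof -
  have pow: "Var i ^ k = Poly_Mapping.single (Poly_Mapping.single i k) 1" for i k
  proof (induction k)
    case (Suc k)
    have "Poly_Mapping.single i (1::nat) + Poly_Mapping.single i k
        = Poly_Mapping.single i (Suc k)"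
      by (simp flip: single_add)
    with Suc show ?case by (simp add: Var_def mult_single)
  qed simp
  have "(\<Prod>i\<in>I. Poly_Mapping.single (f i) 1) = (Poly_Mapping.single (\<Sum>i\<in>I. f i) 1 :: cpoly)"
    for I and f :: "nat \<Rightarrow> nat \<Rightarrow>\<^sub>0 nat"
    by (induction I rule: infinite_finite_induct) (auto simp: mult_single)
  then show ?thesis
    by (simp add: pow Const_def mult_single flip: sum_of_terms)
qed

lemma polys_induct [consumes 1, case_names Const Var add mult]:
  assumes "f \<in> polys n"
    and Const: "\<And>c. P (Const c)" and Var: "\<And>i. i < n \<Longrightarrow> P (Var i)"
    and add: "\<And>f g. f \<in> polys n \<Longrightarrow> g \<in> polys n \<Longrightarrow> P f \<Longrightarrow> P g \<Longrightarrow> P (f + g)"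
    and mult: "\<And>f g. f \<in> polys n \<Longrightarrow> g \<in> polys n \<Longrightarrow> P f \<Longrightarrow> P g \<Longrightarrow> P (f * g)"
  shows "P f"
proof -
  have pow: "P (Var i ^ k)" if "i < n" for i k
    using Const[of 1] that by (induction k) (auto intro!: mult Var)
  have prod: "P (\<Prod>i\<in>I. Var i ^ e i)" if "I \<subseteq> {..<n}" for I e
    using that Const[of 1]
    by (induction I rule: infinite_finite_induct) (auto intro!: mult pow polys_prod polys_power polys_Var)
  have trm: "P (Poly_Mapping.single t c)" if "Poly_Mapping.keys t \<subseteq> {..<n}" for t c
    using that unfolding single_eq_prod_Var
    by (intro mult Const prod) (auto intro!: polys_prod polys_power polys_Var)
  have "P (\<Sum>t\<in>T. Poly_Mapping.single t (e t))"
    if "finite T" "\<And>t. t \<in> T \<Longrightarrow> Poly_Mapping.keys t \<subseteq> {..<n}" for T e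
    using that Const[of 0]
    by (induction T rule: finite_induct) (auto intro!: add trm polys_sum polys_single)
  from this[of "Poly_Mapping.keys f" "coeff_of f"] show ?thesis
    using \<open>f \<in> polys n\<close> by (auto simp: polys_def simp flip: sum_of_terms)
qed

lemma ev_cong:
  assumes "f \<in> polys n" "\<And>i. i < n \<Longrightarrow> x i = y i" shows "ev x f = ev y f"
  using assms by (induction f rule: polys_induct) auto

lemma ev_poly: "ev x (poly p y) = (\<Sum>i\<le>Polynomial.degree p. ev x (Polynomial.coeff p i) * ev x y ^ i)"
  by (simp add: poly_altdef)

text \<open>The subring \<open>B[y]\<close>.  The element \<open>y\<close> may be algebraic over \<open>B\<close>, so the polynomial \<open>p\<close> need not be
  unique.\<close>

definition poly_adjoin :: "'a::comm_ring_1 set \<Rightarrow> 'a \<Rightarrow> 'a set"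
  where "poly_adjoin B y = {poly p y | p. \<forall>i. Polynomial.coeff p i \<in> B}"

text \<open>Peeling off the last variable turns induction on the number of variables into a statement about
  polynomials in one variable.\<close>

lemma polys_Suc: "polys (Suc n) = poly_adjoin (polys n) (Var n)"
proof (intro subset_antisym subsetI)
  fix f assume "f \<in> polys (Suc n)"
  then have "\<exists>p. (\<forall>i. Polynomial.coeff p i \<in> polys n) \<and> f = poly p (Var n)"
  proof (induction f rule: polys_induct)
    case (Const c)
    show ?case by (rule exI[of _ "[:Const c:]"]) (auto simp: coeff_pCons split: nat.splits)
  next
    case (Var i)
    show ?case
    proof (cases "i = n")
      case True
      then show ?thesis
        by (intro exI[of _ "[:0, 1:]"]) (auto simp: coeff_pCons split: nat.splits)
    next
      case False
      with Var show ?thesis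
        by (intro exI[of _ "[:Var i:]"]) (auto simp: coeff_pCons split: nat.splits)
    qed
  next
    case (add f g)
    then obtain p q where "\<forall>i. Polynomial.coeff p i \<in> polys n" "f = poly p (Var n)"
      "\<forall>i. Polynomial.coeff q i \<in> polys n" "g = poly q (Var n)" by auto
    then show ?case by (intro exI[of _ "p + q"]) auto
  next
    case (mult f g)
    then obtain p q where "\<forall>i. Polynomial.coeff p i \<in> polys n" "f = poly p (Var n)"
      "\<forall>i. Polynomial.coeff q i \<in> polys n" "g = poly q (Var n)" by auto
    then show ?case by (intro exI[of _ "p * q"]) (auto simp: coeff_mult)
  qed
  then show "f \<in> poly_adjoin (polys n) (Var n)" by (auto simp: poly_adjoin_def)
next
  fix f assume "f \<in> poly_adjoin (polys n) (Var n)"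
  then show "f \<in> polys (Suc n)"
    using polys_mono[of n "Suc n"]
    by (auto simp: poly_adjoin_def poly_altdef intro!: polys_sum polys_mult)
qed

lemma polys_0: "f \<in> polys 0 \<Longrightarrow> \<exists>c. f = Const c"
  by (induction f rule: polys_induct) (auto simp flip: Const_add Const_mult)

text \<open>Polynomials with complex coefficients are determined by their values; the induction strips
  off the last variable, where the claim is the fact about polynomials in one variable.\<close>

lemma polys_eq_0I:
  assumes "f \<in> polys n" "\<And>x. ev x f = 0" shows "f = 0"
  using assms
proof (induction n arbitrary: f)
  case 0
  then obtain c where "f = Const c" using polys_0 by auto
  then show ?case using 0 by simp
next
  case (Suc n)
  then obtain p where p: "\<And>i. Polynomial.coeff p i \<in> polys n" "f = poly p (Var n)"
    by (auto simp: polys_Suc poly_adjoin_def)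
  have "Polynomial.coeff p i = 0" if "i \<le> Polynomial.degree p" for i
  proof (rule Suc.IH[OF p(1)])
    fix x
    have "(\<Sum>i\<le>Polynomial.degree p. ev x (Polynomial.coeff p i) * t ^ i) = 0" for t
    proof -
      have "ev (x(n := t)) f = 0" by (rule Suc.prems)
      moreover have "ev (x(n := t)) (Polynomial.coeff p i) = ev x (Polynomial.coeff p i)" for i
        by (rule ev_cong[OF p(1)]) auto
      ultimately show ?thesis by (simp add: p(2) ev_poly)
    qed
    then show "ev x (Polynomial.coeff p i) = 0"
      using polyfun_eq_0[of "\<lambda>i. ev x (Polynomial.coeff p i)" "Polynomial.degree p"] that by simp
  qed
  then show ?case by (simp add: p(2) poly_altdef)
qed

lemma polys_eqI:
  assumes "f \<in> polys n" "g \<in> polys n" "\<And>x. ev x f = ev x g" shows "f = g"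
  using polys_eq_0I[of "f - g" n] assms by simp

text \<open>Restriction to a line reduces questions about zeros to polynomials in one variable.\<close>

lemma ev_line:
  assumes "f \<in> polys n"
  shows "\<exists>p. \<forall>s. ev (\<lambda>i. x i + s * y i) f = poly p s"
  using assms
proof (induction f rule: polys_induct)
  case (Const c) show ?case by (rule exI[of _ "[:c:]"]) simp
next
  case (Var i) show ?case by (rule exI[of _ "[:x i, y i:]"]) simp
next
  case (add f g)
  then obtain p q where "\<forall>s. ev (\<lambda>i. x i + s * y i) f = poly p s"
    "\<forall>s. ev (\<lambda>i. x i + s * y i) g = poly q s" by blast
  then show ?case by (intro exI[of _ "p + q"]) simp
next
  case (mult f g)
  then obtain p q where "\<forall>s. ev (\<lambda>i. x i + s * y i) f = poly p s"
    "\<forall>s. ev (\<lambda>i. x i + s * y i) g = poly q s" by blast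
  then show ?case by (intro exI[of _ "p * q"]) simp
qed

lemma ev_lin_subst:
  assumes "dim_col A = n"
  shows "ev x (lin_subst A f) = ev (\<lambda>i. \<Sum>j<n. A $$ (i, j) * x j) f"
  using assms by (simp add: lin_subst_def poly_subst_def) (simp add: ev_def monom_ev_def)

lemma polys_lin_subst:
  assumes "dim_col A = n" shows "lin_subst A f \<in> polys n"
  unfolding lin_subst_def poly_subst_def using assms by (intro polys_sum polys_mult polys_prod polys_power) auto


subsection \<open>Differentials and Taylor expansion\<close>

lemma ex_partials:
  assumes "f \<in> polys n"
  shows "\<exists>D. (\<forall>i. D i \<in> polys n) \<and> (\<forall>x y. ((\<lambda>s. ev (\<lambda>i. x i + s * y i) f)
    has_field_derivative (\<Sum>i<n. ev x (D i) * y i)) (at 0))"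
  using assms
proof (induction f rule: polys_induct)
  case (Const c)
  show ?case by (rule exI[of _ "\<lambda>_. 0"]) auto
next
  case (Var j)
  have *: "(\<Sum>i<n. ev x (if i = j then 1 else 0) * y i) = y j" for x y
    using Var by (subst sum.cong[OF refl, of _ _ "\<lambda>i. if i = j then y i else 0"]) auto
  show ?case
    by (rule exI[of _ "\<lambda>i. if i = j then 1 else 0"])
       (auto simp: * intro!: derivative_eq_intros)
next
  case (add f g)
  from add.IH(1) obtain D where D: "\<And>i. D i \<in> polys n"
    "\<And>x y. ((\<lambda>s. ev (\<lambda>i. x i + s * y i) f) has_field_derivative (\<Sum>i<n. ev x (D i) * y i)) (at 0)"
    by blast
  from add.IH(2) obtain D' where D': "\<And>i. D' i \<in> polys n"
    "\<And>x y. ((\<lambda>s. ev (\<lambda>i. x i + s * y i) g) has_field_derivative (\<Sum>i<n. ev x (D' i) * y i)) (at 0)"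
    by blast
  show ?case using D(1) D'(1) DERIV_add[OF D(2) D'(2)]
    by (intro exI[of _ "\<lambda>i. D i + D' i"]) (simp add: distrib_right sum.distrib)
next
  case (mult f g)
  from mult.IH(1) obtain D where D: "\<And>i. D i \<in> polys n"
    "\<And>x y. ((\<lambda>s. ev (\<lambda>i. x i + s * y i) f) has_field_derivative (\<Sum>i<n. ev x (D i) * y i)) (at 0)"
    by blast
  from mult.IH(2) obtain D' where D': "\<And>i. D' i \<in> polys n"
    "\<And>x y. ((\<lambda>s. ev (\<lambda>i. x i + s * y i) g) has_field_derivative (\<Sum>i<n. ev x (D' i) * y i)) (at 0)"
    by blast
  have "(\<Sum>i<n. ev x (D i * g + f * D' i) * y i) =
      (\<Sum>i<n. ev x (D i) * y i) * ev x g + (\<Sum>i<n. ev x (D' i) * y i) * ev x f" for x y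
    by (simp only: sum_distrib_right flip: sum.distrib)
      (intro sum.cong refl, simp add: distrib_left mult_ac)
  moreover have "((\<lambda>s. ev (\<lambda>i. x i + s * y i) f * ev (\<lambda>i. x i + s * y i) g)
      has_field_derivative (\<Sum>i<n. ev x (D i) * y i) * ev x g
        + (\<Sum>i<n. ev x (D' i) * y i) * ev x f) (at 0)" for x y
    using DERIV_mult[OF D(2)[of x y] D'(2)[of x y]] by simp
  ultimately show ?case using mult.hyps D(1) D'(1)
    by (intro exI[of _ "\<lambda>i. D i * g + f * D' i"]) simp
qed

text \<open>The property determines the polynomials.  It serves as the definition because the rules for
  differentials then follow from the uniqueness of derivatives.\<close>

definition partial :: "nat \<Rightarrow> cpoly \<Rightarrow> nat \<Rightarrow> cpoly"
  where "partial n f = (SOME D. (\<forall>i. D i \<in> polys n) \<and> (\<forall>x y.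
    ((\<lambda>s. ev (\<lambda>i. x i + s * y i) f) has_field_derivative (\<Sum>i<n. ev x (D i) * y i)) (at 0)))"

definition differential :: "nat \<Rightarrow> cpoly \<Rightarrow> (nat \<Rightarrow> complex) \<Rightarrow> (nat \<Rightarrow> complex) \<Rightarrow> complex"
  where "differential n f x y = (\<Sum>i<n. ev x (partial n f i) * y i)"

lemma polys_partial [simp]: "f \<in> polys n \<Longrightarrow> partial n f i \<in> polys n"
  and differential:
    "f \<in> polys n \<Longrightarrow>
      ((\<lambda>s. ev (\<lambda>i. x i + s * y i) f) has_field_derivative differential n f x y) (at 0)"
  using someI_ex[OF ex_partials, of f n] unfolding differential_def partial_def by auto

lemma differential_unique:
  assumes "f \<in> polys n"
    "((\<lambda>s. ev (\<lambda>i. x i + s * y i) f) has_field_derivative c) (at 0)"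
  shows "differential n f x y = c"
  using DERIV_unique[OF differential[OF assms(1)] assms(2)] .

lemma differential_mult:
  "f \<in> polys n \<Longrightarrow> g \<in> polys n \<Longrightarrow>
    differential n (f * g) x y = differential n f x y * ev x g + ev x f * differential n g x y"
  using DERIV_mult[OF differential[of f n x y] differential[of g n x y]]
  by (intro differential_unique) (simp_all add: mult.commute)

lemma differential_sum:
  assumes "\<And>i. i \<in> I \<Longrightarrow> f i \<in> polys n"
  shows "differential n (sum f I) x y = (\<Sum>i\<in>I. differential n (f i) x y)"
  using assms
  by (intro differential_unique) (auto intro!: DERIV_sum differential)

lemma differential_Const [simp]: "differential n (Const c) x y = 0"
  by (intro differential_unique) auto

lemma differential_diff:
  "f \<in> polys n \<Longrightarrow> g \<in> polys n \<Longrightarrow>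
    differential n (f - g) x y = differential n f x y - differential n g x y"
  using DERIV_diff[OF differential[of f n x y] differential[of g n x y]]
  by (intro differential_unique) simp_all

lemma differential_Var [simp]: "i < n \<Longrightarrow> differential n (Var i) x y = y i"
  by (intro differential_unique) (auto intro!: derivative_eq_intros)

lemma differential_minus:
  "differential n f x (\<lambda>i. y i - z i) = differential n f x y - differential n f x z"
  by (simp add: differential_def algebra_simps sum_subtractf)

text \<open>The ideal of a point is generated by the coordinates centred at it.\<close>

lemma taylor_first_order:
  assumes "f \<in> polys n"
  shows "\<exists>p. (\<forall>j. p j \<in> polys n) \<and> f - Const (ev w f) = (\<Sum>j<n. p j * (Var j - Const (w j)))"
  using assms
proof (induction f rule: polys_induct)
  case (Const c)
  show ?case by (rule exI[of _ "\<lambda>_. 0"]) auto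
next
  case (Var i)
  have "(\<Sum>j<n. (if j = i then 1 else 0) * (Var j - Const (w j))) = Var i - Const (w i)"
    using Var
    by (subst sum.cong[OF refl, of _ _ "\<lambda>j. if j = i then Var j - Const (w j) else 0"]) auto
  then show ?case
    by (intro exI[of _ "\<lambda>j. if j = i then 1 else 0"]) auto
next
  case (add f g)
  then obtain p q where pq: "\<forall>j. p j \<in> polys n" "\<forall>j. q j \<in> polys n"
    "f - Const (ev w f) = (\<Sum>j<n. p j * (Var j - Const (w j)))"
    "g - Const (ev w g) = (\<Sum>j<n. q j * (Var j - Const (w j)))" by auto
  moreover have "f + g - Const (ev w (f + g)) = (f - Const (ev w f)) + (g - Const (ev w g))"
    by (simp add: Const_add)
  ultimately show ?case
    by (intro exI[of _ "\<lambda>j. p j + q j"]) (simp add: distrib_right sum.distrib)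
next
  case (mult f g)
  then obtain p q where pq: "\<forall>j. p j \<in> polys n" "\<forall>j. q j \<in> polys n"
    "f - Const (ev w f) = (\<Sum>j<n. p j * (Var j - Const (w j)))"
    "g - Const (ev w g) = (\<Sum>j<n. q j * (Var j - Const (w j)))" by auto
  have "f * g - Const (ev w (f * g))
      = (f - Const (ev w f)) * g + Const (ev w f) * (g - Const (ev w g))"
    by (simp add: Const_mult algebra_simps)
  also have "\<dots>
      = (\<Sum>j<n. (p j * g + Const (ev w f) * q j) * (Var j - Const (w j)))"
    unfolding pq(3,4)
    by (simp only: sum_distrib_left sum_distrib_right flip: sum.distrib)
      (intro sum.cong refl, simp only: distrib_left distrib_right mult_ac)
  finally have "f * g - Const (ev w (f * g))
      = (\<Sum>j<n. (p j * g + Const (ev w f) * q j) * (Var j - Const (w j)))" .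
  moreover have "\<forall>j. p j * g + Const (ev w f) * q j \<in> polys n"
    using pq(1,2) mult.hyps by auto
  ultimately show ?case
    by (intro exI[of _ "\<lambda>j. p j * g + Const (ev w f) * q j"] conjI)
qed

section \<open>Ideals and the Hilbert basis theorem\<close>

definition subring_set :: "'a::comm_ring_1 set \<Rightarrow> bool"
  where "subring_set B \<longleftrightarrow> 0 \<in> B \<and> 1 \<in> B \<and>
    (\<forall>a\<in>B. - a \<in> B) \<and> (\<forall>a\<in>B. \<forall>b\<in>B. a + b \<in> B \<and> a * b \<in> B)"

definition ideal_in :: "'a::comm_ring_1 set \<Rightarrow> 'a set \<Rightarrow> bool"
  where "ideal_in B I \<longleftrightarrow> I \<subseteq> B \<and> 0 \<in> I \<and>
    (\<forall>a\<in>I. \<forall>b\<in>I. a + b \<in> I) \<and> (\<forall>b\<in>B. \<forall>a\<in>I. b * a \<in> I)"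

text \<open>Meaningful for finite \<open>S\<close>, where it is the ideal that \<open>S\<close> generates; a sum over an infinite set
  is 0.\<close>

definition span_in :: "'a::comm_ring_1 set \<Rightarrow> 'a set \<Rightarrow> 'a set"
  where "span_in B S = {\<Sum>s\<in>S. c s * s | c. \<forall>s\<in>S. c s \<in> B}"

definition noeth :: "'a::comm_ring_1 set \<Rightarrow> bool"
  where "noeth B \<longleftrightarrow> (\<forall>I. ideal_in B I \<longrightarrow> (\<exists>S\<subseteq>I. finite S \<and> I \<subseteq> span_in B S))"

lemma subring_setD:
  assumes "subring_set B"
  shows "0 \<in> B" "1 \<in> B" "a \<in> B \<Longrightarrow> - a \<in> B" "a \<in> B \<Longrightarrow> b \<in> B \<Longrightarrow> a + b \<in> B"
    "a \<in> B \<Longrightarrow> b \<in> B \<Longrightarrow> a * b \<in> B" "a \<in> B \<Longrightarrow> b \<in> B \<Longrightarrow> a - b \<in> B" "a \<in> B \<Longrightarrow> a ^ k \<in> B"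
proof -
  show *: "0 \<in> B" "1 \<in> B" "a \<in> B \<Longrightarrow> - a \<in> B" "a \<in> B \<Longrightarrow> b \<in> B \<Longrightarrow> a + b \<in> B"
    "a \<in> B \<Longrightarrow> b \<in> B \<Longrightarrow> a * b \<in> B" for a b
    using assms by (auto simp: subring_set_def)
  show "a \<in> B \<Longrightarrow> b \<in> B \<Longrightarrow> a - b \<in> B" using *(4)[of a "- b"] *(3)[of b] by simp
  show "a \<in> B \<Longrightarrow> a ^ k \<in> B" by (induction k) (auto intro: *)
qed

lemma subring_set_sum:
  "subring_set B \<Longrightarrow> (\<And>i. i \<in> I \<Longrightarrow> f i \<in> B) \<Longrightarrow> sum f I \<in> B"
  by (induction I rule: infinite_finite_induct) (auto intro: subring_setD)

lemma subring_set_prod: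
  "subring_set B \<Longrightarrow> (\<And>i. i \<in> I \<Longrightarrow> f i \<in> B) \<Longrightarrow> prod f I \<in> B"
  by (induction I rule: infinite_finite_induct) (auto intro: subring_setD)

lemma subring_set_polys: "subring_set (polys n)"
  by (auto simp: subring_set_def)

lemma ideal_inD:
  assumes "ideal_in B I"
  shows "a \<in> I \<Longrightarrow> a \<in> B" "0 \<in> I" "a \<in> I \<Longrightarrow> b \<in> I \<Longrightarrow> a + b \<in> I" "b \<in> B \<Longrightarrow> a \<in> I \<Longrightarrow> b * a \<in> I"
  using assms by (auto simp: ideal_in_def)

lemma ideal_in_minus:
  "subring_set B \<Longrightarrow> ideal_in B I \<Longrightarrow> a \<in> I \<Longrightarrow> - a \<in> I"
  using ideal_inD(4)[of B I "- 1" a] subring_setD(3)[of B 1] subring_setD(2)[of B] by simp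

lemma ideal_in_diff:
  "subring_set B \<Longrightarrow> ideal_in B I \<Longrightarrow> a \<in> I \<Longrightarrow> b \<in> I \<Longrightarrow> a - b \<in> I"
  using ideal_inD(3)[of B I a "- b"] ideal_in_minus[of B I b] by simp

lemma ideal_in_sum:
  "ideal_in B I \<Longrightarrow> (\<And>i. i \<in> X \<Longrightarrow> f i \<in> I) \<Longrightarrow> sum f X \<in> I"
  by (induction X rule: infinite_finite_induct) (auto intro: ideal_inD)

lemma span_in_subset: "ideal_in B I \<Longrightarrow> S \<subseteq> I \<Longrightarrow> span_in B S \<subseteq> I"
  by (auto simp: span_in_def intro!: ideal_in_sum intro: ideal_inD)

lemma ideal_span_in:
  assumes B: "subring_set B" and S: "S \<subseteq> B"
  shows "ideal_in B (span_in B S)"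
  unfolding ideal_in_def
proof (intro conjI ballI)
  show "span_in B S \<subseteq> B"
    using S by (auto simp: span_in_def intro!: subring_set_sum[OF B] subring_setD[OF B])
  show "0 \<in> span_in B S"
    by (auto simp: span_in_def intro!: exI[of _ "\<lambda>_. 0"] subring_setD[OF B])
next
  fix a b assume "a \<in> span_in B S" "b \<in> span_in B S"
  then obtain c d where "a = (\<Sum>s\<in>S. c s * s)" "\<forall>s\<in>S. c s \<in> B"
    "b = (\<Sum>s\<in>S. d s * s)" "\<forall>s\<in>S. d s \<in> B" by (auto simp: span_in_def)
  then show "a + b \<in> span_in B S"
    by (auto simp: span_in_def distrib_right sum.distrib
        intro!: exI[of _ "\<lambda>s. c s + d s"] subring_setD[OF B])
next
  fix a b assume "a \<in> B" "b \<in> span_in B S"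
  then obtain c where "b = (\<Sum>s\<in>S. c s * s)" "\<forall>s\<in>S. c s \<in> B"
    by (auto simp: span_in_def)
  with \<open>a \<in> B\<close> show "a * b \<in> span_in B S"
    by (auto simp: span_in_def sum_distrib_left mult.assoc
        intro!: exI[of _ "\<lambda>s. a * c s"] subring_setD[OF B])
qed

lemma span_in_superset:
  assumes B: "subring_set B" and "finite S" shows "S \<subseteq> span_in B S"
proof
  fix x assume "x \<in> S"
  have "(\<Sum>s\<in>S. (if s = x then 1 else 0) * s) = (\<Sum>s\<in>S. if s = x then s else 0)"
    by (intro sum.cong) auto
  also have "\<dots> = x" using \<open>x \<in> S\<close> \<open>finite S\<close> by simp
  finally show "x \<in> span_in B S"
    by (auto simp: span_in_def intro!: exI[of _ "\<lambda>s. if s = x then 1 else 0"] subring_setD[OF B])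
qed

lemma ideal_in_adjoin:
  assumes B: "subring_set B" and J: "ideal_in B J" and x: "x \<in> B"
  shows "ideal_in B {j + b * x | j b. j \<in> J \<and> b \<in> B}" (is "ideal_in B ?K")
    and "J \<subseteq> {j + b * x | j b. j \<in> J \<and> b \<in> B}"
    and "x \<in> {j + b * x | j b. j \<in> J \<and> b \<in> B}"
proof -
  show JK: "J \<subseteq> ?K" using subring_setD(1)[OF B] by force
  show "x \<in> ?K" using subring_setD(2)[OF B] ideal_inD(2)[OF J] by force
  show "ideal_in B ?K"
    unfolding ideal_in_def
  proof (intro conjI ballI)
    have "j + b * x \<in> B" if "j \<in> J" "b \<in> B" for j b
      using that x ideal_inD(1)[OF J] subring_setD(4,5)[OF B] by blast
    then show "?K \<subseteq> B" by blast
    show "0 \<in> ?K" using JK ideal_inD(2)[OF J] by blast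
  next
    fix a b assume "a \<in> ?K" "b \<in> ?K"
    then obtain j c k d where *: "a = j + c * x" "b = k + d * x" "j \<in> J" "k \<in> J" "c \<in> B" "d \<in> B"
      by auto
    then have "a + b = (j + k) + (c + d) * x" by (simp add: algebra_simps)
    with * show "a + b \<in> ?K" using ideal_inD(3)[OF J] subring_setD(4)[OF B] by blast
  next
    fix a b assume "a \<in> B" "b \<in> ?K"
    then obtain j c where *: "b = j + c * x" "j \<in> J" "c \<in> B" by auto
    then have "a * b = a * j + (a * c) * x" by (simp add: algebra_simps)
    with * \<open>a \<in> B\<close> show "a * b \<in> ?K" using ideal_inD(4)[OF J] subring_setD(5)[OF B] by blast
  qed
qed

lemma subring_poly_adjoin:
  assumes B: "subring_set B" shows "subring_set (poly_adjoin B y)"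
proof -
  have "\<exists>p. (0 = poly p y) \<and> (\<forall>i. Polynomial.coeff p i \<in> B)"
    by (rule exI[of _ 0]) (auto intro: subring_setD[OF B])
  moreover have "\<exists>p. (1 = poly p y) \<and> (\<forall>i. Polynomial.coeff p i \<in> B)"
    by (rule exI[of _ 1]) (auto simp: Polynomial.coeff_1 intro: subring_setD[OF B])
  moreover have "\<exists>q. - poly p y = poly q y \<and> (\<forall>i. Polynomial.coeff q i \<in> B)"
    if "\<forall>i. Polynomial.coeff p i \<in> B" for p
    by (rule exI[of _ "- p"]) (use that in \<open>auto intro: subring_setD[OF B]\<close>)
  moreover have "\<exists>r. poly p y + poly q y = poly r y \<and> (\<forall>i. Polynomial.coeff r i \<in> B)"
    "\<exists>r. poly p y * poly q y = poly r y \<and> (\<forall>i. Polynomial.coeff r i \<in> B)"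
    if "\<forall>i. Polynomial.coeff p i \<in> B" "\<forall>i. Polynomial.coeff q i \<in> B" for p q
     apply (rule exI[of _ "p + q"], use that in \<open>auto intro: subring_setD[OF B]\<close>)
    apply (rule exI[of _ "p * q"], use that in
        \<open>auto simp: Polynomial.coeff_mult intro!: subring_set_sum[OF B] subring_setD[OF B]\<close>)
    done
  ultimately show ?thesis
    unfolding subring_set_def poly_adjoin_def by blast
qed

text \<open>Hilbert's argument.  The leading coefficients of the polynomials of formal degree \<open>k\<close> whose value at
  \<open>y\<close> lies in \<open>I\<close> form an ideal \<open>L k\<close> of \<open>B\<close>, increasing with \<open>k\<close> and constant from some \<open>K\<close> on.
  Polynomials that realize generators of \<open>L 0, \<dots>, L K\<close> give generators of \<open>I\<close>, as the leading term
  of any polynomial with value in \<open>I\<close> can be cancelled with them.  That an element of \<open>B[y]\<close> has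
  several representing polynomials does no harm, since the induction runs over the polynomials.\<close>

theorem noeth_poly_adjoin:
  assumes B: "subring_set B" and noeth: "noeth B"
  shows "noeth (poly_adjoin B y)"
  unfolding noeth_def
proof (intro allI impI)
  let ?C = "poly_adjoin B y"
  note C = subring_poly_adjoin[OF B, of y]
  fix I assume I: "ideal_in ?C I"
  define Q where "Q k = {p. (\<forall>i. Polynomial.coeff p i \<in> B) \<and> (\<forall>i>k. Polynomial.coeff p i = 0)
    \<and> poly p y \<in> I}" for k :: nat
  define L where "L k = (\<lambda>p. Polynomial.coeff p k) ` Q k" for k
  have B_C: "b \<in> ?C" if "b \<in> B" for b
    unfolding poly_adjoin_def using that subring_setD(1)[OF B]
    by (auto intro!: exI[of _ "[:b:]"] simp: coeff_pCons split: nat.splits)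
  have y_C: "y \<in> ?C"
    unfolding poly_adjoin_def using subring_setD(1,2)[OF B]
    by (auto intro!: exI[of _ "[:0, 1:]"] simp: coeff_pCons split: nat.splits)
  have Q_shift: "Polynomial.monom c j * p \<in> Q (j + k)" if "p \<in> Q k" "c \<in> B" for p c j k
  proof -
    have "c * y ^ j * poly p y \<in> I"
      using that by (intro ideal_inD(4)[OF I] subring_setD(5,7)[OF C] B_C y_C) (auto simp: Q_def)
    with that show ?thesis
      by (auto simp: Q_def Polynomial.coeff_monom_mult poly_monom intro: subring_setD[OF B])
  qed
  have Q_add: "p + q \<in> Q k" if "p \<in> Q k" "q \<in> Q k" for p q k
    using that by (auto simp: Q_def intro!: subring_setD[OF B] ideal_inD[OF I])
  have Q_0: "0 \<in> Q k" for k
    by (auto simp: Q_def intro: subring_setD[OF B] ideal_inD[OF I])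
  have Q_sum: "sum f X \<in> Q k" if "\<And>i. i \<in> X \<Longrightarrow> f i \<in> Q k" for f :: "'a \<Rightarrow> _" and X k
    using that by (induction X rule: infinite_finite_induct) (auto intro: Q_add Q_0)
  have L_ideal: "ideal_in B (L k)" for k
    unfolding ideal_in_def
  proof (intro conjI ballI)
    show "L k \<subseteq> B" by (auto simp: L_def Q_def)
    show "0 \<in> L k" unfolding L_def by (rule image_eqI[of _ _ 0]) (auto simp: Q_0)
  next
    fix a b assume "a \<in> L k" "b \<in> L k"
    then obtain p q where "a = Polynomial.coeff p k" "b = Polynomial.coeff q k" "p \<in> Q k" "q \<in> Q k"
      by (auto simp: L_def)
    then show "a + b \<in> L k" unfolding L_def by (intro image_eqI[of _ _ "p + q"]) (auto intro: Q_add)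
  next
    fix b a assume "b \<in> B" "a \<in> L k"
    then obtain p where "a = Polynomial.coeff p k" "p \<in> Q k" by (auto simp: L_def)
    then show "b * a \<in> L k" unfolding L_def using Q_shift[of p k b 0] \<open>b \<in> B\<close>
      by (intro image_eqI[of _ _ "Polynomial.monom b 0 * p"]) (auto simp: Polynomial.coeff_monom_mult)
  qed
  have L_mono: "L k \<subseteq> L (j + k)" for j k
  proof
    fix a assume "a \<in> L k"
    then obtain p where "a = Polynomial.coeff p k" "p \<in> Q k" by (auto simp: L_def)
    then show "a \<in> L (j + k)" unfolding L_def using Q_shift[of p k 1 j] subring_setD(2)[OF B]
      by (intro image_eqI[of _ _ "Polynomial.monom 1 j * p"]) (auto simp: Polynomial.coeff_monom_mult)
  qed
  have L_mono': "L k \<subseteq> L m" if "k \<le> m" for k m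
    using L_mono[of k "m - k"] that by simp
  have Lu_ideal: "ideal_in B (\<Union>k. L k)"
    unfolding ideal_in_def
  proof (intro conjI ballI)
    show "(\<Union>k. L k) \<subseteq> B" "0 \<in> (\<Union>k. L k)"
      using ideal_inD(1,2)[OF L_ideal] by blast+
  next
    fix a b assume "a \<in> (\<Union>k. L k)" "b \<in> (\<Union>k. L k)"
    then obtain k m where "a \<in> L k" "b \<in> L m" by auto
    then have "a \<in> L (max k m)" "b \<in> L (max k m)" using L_mono' by (meson max.cobounded1 max.cobounded2 subsetD)+
    then show "a + b \<in> (\<Union>k. L k)" using ideal_inD(3)[OF L_ideal] by blast
  next
    fix a b assume "a \<in> B" "b \<in> (\<Union>k. L k)"
    then show "a * b \<in> (\<Union>k. L k)" using ideal_inD(4)[OF L_ideal] by blast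
  qed
  obtain S' where S': "S' \<subseteq> (\<Union>k. L k)" "finite S'" "(\<Union>k. L k) \<subseteq> span_in B S'"
    using noeth Lu_ideal unfolding noeth_def by meson
  have "\<exists>K. S' \<subseteq> L K"
    using \<open>finite S'\<close> S'(1)
  proof (induction S' rule: finite_induct)
    case (insert x F)
    then obtain K m where "F \<subseteq> L K" "x \<in> L m" by auto
    then have "insert x F \<subseteq> L (max K m)"
      using L_mono'[of K "max K m"] L_mono'[of m "max K m"] by auto
    then show ?case by blast
  qed simp
  then obtain K where K: "S' \<subseteq> L K" by blast
  have "\<exists>S\<subseteq>L k. finite S \<and> L k \<subseteq> span_in B S" for k
    using noeth L_ideal unfolding noeth_def by blast
  then obtain S0 where S0: "\<And>k. S0 k \<subseteq> L k" "\<And>k. finite (S0 k)" "\<And>k. L k \<subseteq> span_in B (S0 k)"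
    by metis
  define S where "S k = (if k = K then S' else S0 k)" for k
  have S: "S k \<subseteq> L k" "finite (S k)" for k
    using K S'(2) S0 by (auto simp: S_def)
  have S_span: "L m \<subseteq> span_in B (S (min m K))" for m
    using S'(3) S0(3) by (auto simp: S_def min_def)
  have "\<exists>q. q \<in> Q k \<and> Polynomial.coeff q k = s" if "s \<in> S k" for k s
    using S(1)[of k] that by (auto simp: L_def)
  note ex_q = this
  define q where "q k s = (SOME q. q \<in> Q k \<and> Polynomial.coeff q k = s)" for k s
  have q: "q k s \<in> Q k \<and> Polynomial.coeff (q k s) k = s" if "s \<in> S k" for k s
    unfolding q_def by (rule someI_ex) (rule ex_q[OF that])
  define T where "T = (\<Union>k\<le>K. (\<lambda>s. poly (q k s) y) ` S k)"
  have "finite T" using S(2) by (auto simp: T_def)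
  have TI: "T \<subseteq> I" using q by (auto simp: T_def Q_def)
  have TC: "T \<subseteq> ?C" using TI I by (auto simp: ideal_in_def)
  note span_ideal = ideal_span_in[OF C TC]
  have main: "poly p y \<in> span_in ?C T" if "p \<in> Q m" for p m
    using that
  proof (induction m arbitrary: p rule: less_induct)
    case (less m)
    define k where "k = min m K"
    have "Polynomial.coeff p m \<in> L m" using less.prems by (auto simp: L_def)
    then obtain c where c: "Polynomial.coeff p m = (\<Sum>s\<in>S k. c s * s)" "\<And>s. s \<in> S k \<Longrightarrow> c s \<in> B"
      using S_span[of m] by (auto simp: span_in_def k_def)
    define r where "r = (\<Sum>s\<in>S k. Polynomial.monom (c s) (m - k) * q k s)"
    have km: "m - k + k = m" by (simp add: k_def)
    have "Polynomial.monom (c s) (m - k) * q k s \<in> Q m" if "s \<in> S k" for s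
      using Q_shift[of "q k s" k "c s" "m - k"] q[OF that] c(2)[OF that] km by simp
    then have r: "r \<in> Q m" unfolding r_def by (intro Q_sum)
    then have "p + Polynomial.monom (- 1) 0 * r \<in> Q m"
      using Q_add Q_shift[of r m "- 1" 0] less.prems subring_setD(3)[OF B subring_setD(2)[OF B]] by simp
    then have pr: "p - r \<in> Q m" by (simp add: Polynomial.monom_0)
    have "Polynomial.coeff r m = (\<Sum>s\<in>S k. c s * Polynomial.coeff (q k s) k)"
      using km by (auto simp: r_def Polynomial.coeff_sum Polynomial.coeff_monom_mult intro!: sum.cong)
    then have pr0: "Polynomial.coeff (p - r) m = 0"
      using c(1) q by simp
    have "poly r y \<in> span_in ?C T"
    proof -
      have "c s * y ^ (m - k) * poly (q k s) y \<in> span_in ?C T" if "s \<in> S k" for s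
      proof (rule ideal_inD(4)[OF span_ideal])
        show "c s * y ^ (m - k) \<in> ?C" by (intro subring_setD[OF C] B_C y_C c that)
        show "poly (q k s) y \<in> span_in ?C T"
        proof -
          have "poly (q k s) y \<in> T"
            unfolding T_def using that by (intro UN_I[of k] imageI) (auto simp: k_def)
          then show ?thesis using span_in_superset[OF C \<open>finite T\<close>] by blast
        qed
      qed
      then show ?thesis by (auto simp: r_def poly_sum poly_monom intro!: ideal_in_sum[OF span_ideal])
    qed
    moreover have "poly (p - r) y \<in> span_in ?C T"
    proof (cases m)
      case 0
      then have "p - r = 0" using pr pr0 by (intro poly_eqI) (metis (mono_tags, lifting) Q_def coeff_0 gr_zeroI mem_Collect_eq)
      then show ?thesis by (simp add: ideal_inD(2)[OF span_ideal])
    next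
      case (Suc m')
      then have "p - r \<in> Q m'" using pr pr0 by (auto simp: Q_def) (metis Suc_lessI coeff_diff)
      then show ?thesis by (intro less.IH[of m']) (simp_all add: Suc)
    qed
    ultimately have "poly (p - r) y + poly r y \<in> span_in ?C T"
      by (intro ideal_inD(3)[OF span_ideal])
    then show ?case by simp
  qed
  have "I \<subseteq> span_in ?C T"
  proof
    fix f assume "f \<in> I"
    then obtain p where "f = poly p y" "\<forall>i. Polynomial.coeff p i \<in> B"
      using ideal_inD(1)[OF I] by (force simp: poly_adjoin_def)
    with \<open>f \<in> I\<close> have "p \<in> Q (Polynomial.degree p)" by (auto simp: Q_def Polynomial.coeff_eq_0)
    then show "f \<in> span_in ?C T" using main \<open>f = poly p y\<close> by simp
  qed
  with TI \<open>finite T\<close> show "\<exists>S\<subseteq>I. finite S \<and> I \<subseteq> span_in ?C S" by blast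
qed

theorem noeth_polys: "noeth (polys n)"
proof (induction n)
  case 0
  show ?case
    unfolding noeth_def
  proof (intro allI impI)
    fix I assume I: "ideal_in (polys 0) I"
    show "\<exists>S\<subseteq>I. finite S \<and> I \<subseteq> span_in (polys 0) S"
    proof (cases "I = {0}")
      case True
      then show ?thesis by (intro exI[of _ "{0}"]) (auto intro: span_in_superset[THEN subsetD] subring_set_polys)
    next
      case False
      then obtain f where f: "f \<in> I" "f \<noteq> 0" using ideal_inD(2)[OF I] by auto
      then obtain c where c: "f = Const c" using polys_0 ideal_inD(1)[OF I] by blast
      have "g \<in> span_in (polys 0) {f}" if "g \<in> I" for g
      proof -
        have "g \<in> polys 0" using I that by (auto simp: ideal_in_def)
        then obtain d where "g = Const d" using polys_0 by blast
        then have "g = Const (d / c) * f" using f c by (auto simp flip: Const_mult)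
        then show ?thesis by (auto simp: span_in_def)
      qed
      with f show ?thesis by (intro exI[of _ "{f}"]) auto
    qed
  qed
next
  case (Suc n)
  then show ?case unfolding polys_Suc by (rule noeth_poly_adjoin[OF subring_set_polys])
qed


subsection \<open>Common zeros of ideals over which the variables are integral\<close>

text \<open>If a variable satisfies a polynomial equation modulo a proper ideal, then one of the linear
  factors of the polynomial can be added to the ideal without producing 1: a factor for which this
  fails is invertible modulo the ideal and can be cancelled.\<close>

lemma proper_ideal_adjoin_root:
  assumes J: "ideal_in (polys n) J" "1 \<notin> J" and i: "i < n"
    and q: "q \<noteq> 0" "poly (map_poly Const q) (Var i) \<in> J"
  shows "\<exists>r K. ideal_in (polys n) K \<and> J \<subseteq> K \<and> 1 \<notin> K \<and> Var i - Const r \<in> K"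
  using q
proof (induction "Polynomial.degree q" arbitrary: q rule: less_induct)
  case less
  note B = subring_set_polys[of n]
  interpret Const: comm_ring_hom Const
    by unfold_locales (auto simp: Const_add Const_mult Const_minus)
  interpret cp: map_poly_comm_ring_hom Const ..
  show ?case
  proof (cases "Polynomial.degree q = 0")
    case True
    then obtain c where c: "q = [:c:]" using degree_eq_zeroE by blast
    with less.prems have "Const c \<in> J" "c \<noteq> 0" by (auto simp: map_poly_pCons)
    then have "Const (1 / c) * Const c \<in> J" using ideal_inD(4)[OF J(1)] by auto
    with \<open>c \<noteq> 0\<close> J(2) show ?thesis by (simp flip: Const_mult)
  next
    case False
    then obtain r where "poly q r = 0"
      using fundamental_theorem_of_algebra[of q] by (auto simp: constant_degree)
    then obtain q' where q': "q = [:- r, 1:] * q'" by (auto simp: poly_eq_0_iff_dvd)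
    with less.prems(1) have "q' \<noteq> 0" by auto
    then have deg: "Polynomial.degree q' < Polynomial.degree q"
      unfolding q' by (subst degree_mult_eq) auto
    define x where "x = Var i - Const r"
    define K where "K = {j + b * x | j b. j \<in> J \<and> b \<in> polys n}"
    have x: "x \<in> polys n" using i by (simp add: x_def)
    have K: "ideal_in (polys n) K" "J \<subseteq> K" "x \<in> K"
      unfolding K_def using ideal_in_adjoin[OF B J(1) x] by auto
    show ?thesis
    proof (cases "1 \<in> K")
      case True
      then obtain j b where jb: "1 = j + b * x" "j \<in> J" "b \<in> polys n" by (auto simp: K_def)
      define u where "u = poly (map_poly Const q') (Var i)"
      have u: "u \<in> polys n"
        unfolding u_def poly_altdef using i by (auto simp: coeff_map_poly)
      have "map_poly Const q = [:- Const r, 1:] * map_poly Const q'"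
        unfolding q' cp.hom_mult by (simp add: map_poly_pCons Const_minus)
      then have qu: "poly (map_poly Const q) (Var i) = x * u"
        by (simp only: poly_mult) (simp add: u_def x_def)
      have "u * 1 = u * (j + b * x)" using jb(1) by simp
      then have "u = u * j + b * (x * u)" by (simp only: distrib_left mult_1_right mult_1_left mult_ac)
      moreover have "u * j \<in> J" "b * (x * u) \<in> J"
        using ideal_inD(4)[OF J(1)] jb u less.prems(2) qu by auto
      ultimately have "u \<in> J" using ideal_inD(3)[OF J(1)] by metis
      then show ?thesis using less.hyps[OF deg \<open>q' \<noteq> 0\<close>] by (simp add: u_def)
    next
      case False
      with K show ?thesis by (auto simp: x_def)
    qed
  qed
qed

text \<open>The Nullstellensatz for ideals with finite residue ring over \<open>\<complex>\<close>: values for the variables are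
  chosen one after the other, keeping the ideal proper.\<close>

lemma common_zero_of_integral_ideal:
  assumes I: "ideal_in (polys n) I" "1 \<notin> I"
    and int: "\<And>i. i < n \<Longrightarrow> \<exists>q. q \<noteq> 0 \<and> poly (map_poly Const q) (Var i) \<in> I"
  shows "\<exists>v. \<forall>f\<in>I. ev v f = 0"
proof -
  have "\<exists>v J. ideal_in (polys n) J \<and> I \<subseteq> J \<and> 1 \<notin> J \<and> (\<forall>i<k. Var i - Const (v i) \<in> J)"
    if "k \<le> n" for k
    using that
  proof (induction k)
    case 0
    then show ?case using I by auto
  next
    case (Suc k)
    then obtain v J where J: "ideal_in (polys n) J" "I \<subseteq> J" "1 \<notin> J"
      "\<forall>i<k. Var i - Const (v i) \<in> J" by auto
    obtain q where "q \<noteq> 0" "poly (map_poly Const q) (Var k) \<in> J"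
      using int[of k] Suc.prems J(2) by auto
    then obtain r K where K: "ideal_in (polys n) K" "J \<subseteq> K" "1 \<notin> K" "Var k - Const r \<in> K"
      using proper_ideal_adjoin_root[OF J(1,3), of k q] Suc.prems by auto
    have "\<forall>i<Suc k. Var i - Const ((v(k := r)) i) \<in> K"
      using K(2,4) J(4) by (auto simp: less_Suc_eq)
    then show ?case using K J(2) by blast
  qed
  then obtain v J where J: "ideal_in (polys n) J" "I \<subseteq> J" "1 \<notin> J"
      "\<forall>i<n. Var i - Const (v i) \<in> J" by blast
  have "ev v f = 0" if "f \<in> I" for f
  proof (rule ccontr)
    assume nz: "ev v f \<noteq> 0"
    have f: "f \<in> polys n" "f \<in> J" using that I(1) J(2) by (auto simp: ideal_in_def)
    obtain p where p: "\<forall>j. p j \<in> polys n" "f - Const (ev v f) = (\<Sum>j<n. p j * (Var j - Const (v j)))"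
      using taylor_first_order[OF f(1)] by blast
    have "f - Const (ev v f) \<in> J"
      unfolding p(2) using p(1) J(4) by (intro ideal_in_sum[OF J(1)] ideal_inD(4)[OF J(1)]) auto
    then have "f - (f - Const (ev v f)) \<in> J"
      by (rule ideal_in_diff[OF subring_set_polys J(1) f(2)])
    moreover have "f - (f - Const (ev v f)) = Const (ev v f)" by simp
    ultimately have "Const (ev v f) \<in> J" by metis
    then have "Const (1 / ev v f) * Const (ev v f) \<in> J"
      by (intro ideal_inD(4)[OF J(1)]) auto
    then show False using J(3) nz by (simp flip: Const_mult)
  qed
  then show ?thesis by blast
qed

section \<open>Finite linear group actions and their invariants\<close>

lemma poly_altdef_le:
  fixes p :: "'a::comm_semiring_1 poly"
  assumes "Polynomial.degree p \<le> d" shows "poly p x = (\<Sum>i\<le>d. Polynomial.coeff p i * x ^ i)"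
  unfolding poly_altdef using assms
  by (intro sum.mono_neutral_left) (auto simp: Polynomial.coeff_eq_0)

text \<open>The ideal generated by an arbitrary subset.\<close>

definition gen_in :: "'a::comm_ring_1 set \<Rightarrow> 'a set \<Rightarrow> 'a set"
  where "gen_in B X = {f. \<exists>S\<subseteq>X. finite S \<and> f \<in> span_in B S}"

lemma span_in_mono:
  assumes B: "subring_set B" and "S \<subseteq> T" "finite T" "T \<subseteq> B"
  shows "span_in B S \<subseteq> span_in B T"
  using span_in_subset[OF ideal_span_in[OF B \<open>T \<subseteq> B\<close>], of S] span_in_superset[OF B \<open>finite T\<close>] \<open>S \<subseteq> T\<close>
  by blast

lemma ideal_gen_in:
  assumes B: "subring_set B" and X: "X \<subseteq> B"
  shows "ideal_in B (gen_in B X)" and "X \<subseteq> gen_in B X"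
proof -
  show "X \<subseteq> gen_in B X"
  proof
    fix x assume "x \<in> X"
    then show "x \<in> gen_in B X"
      using span_in_superset[OF B, of "{x}"] by (auto simp: gen_in_def intro!: exI[of _ "{x}"])
  qed
  have sp: "ideal_in B (span_in B S)" if "S \<subseteq> X" for S
    using that X by (intro ideal_span_in[OF B]) auto
  show "ideal_in B (gen_in B X)"
    unfolding ideal_in_def
  proof (intro conjI ballI)
    show "gen_in B X \<subseteq> B" using ideal_inD(1)[OF sp] by (auto simp: gen_in_def)
    show "0 \<in> gen_in B X" using ideal_inD(2)[OF sp[of "{}"]] by (auto simp: gen_in_def)
  next
    fix a b assume "a \<in> gen_in B X" "b \<in> gen_in B X"
    then obtain S T where ST: "S \<subseteq> X" "finite S" "a \<in> span_in B S" "T \<subseteq> X" "finite T" "b \<in> span_in B T"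
      by (auto simp: gen_in_def)
    then have "a \<in> span_in B (S \<union> T)" "b \<in> span_in B (S \<union> T)"
      using span_in_mono[OF B, of S "S \<union> T"] span_in_mono[OF B, of T "S \<union> T"] X by auto
    then have "a + b \<in> span_in B (S \<union> T)"
      using ideal_inD(3)[OF sp[of "S \<union> T"]] ST by auto
    with ST show "a + b \<in> gen_in B X" unfolding gen_in_def by blast
  next
    fix b a assume "b \<in> B" "a \<in> gen_in B X"
    then show "b * a \<in> gen_in B X" unfolding gen_in_def using ideal_inD(4)[OF sp] by blast
  qed
qed

text \<open>Finitely many generators of the ideal that \<open>X\<close> generates can be chosen in \<open>X\<close> itself.\<close>

lemma noeth_subset:
  assumes B: "subring_set B" "noeth B" and X: "X \<subseteq> B"
  shows "\<exists>S\<subseteq>X. finite S \<and> X \<subseteq> span_in B S"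
proof -
  obtain S0 where S0: "S0 \<subseteq> gen_in B X" "finite S0" "gen_in B X \<subseteq> span_in B S0"
    using B(2) ideal_gen_in(1)[OF B(1) X] unfolding noeth_def by meson
  have "\<forall>s\<in>S0. \<exists>S\<subseteq>X. finite S \<and> s \<in> span_in B S" using S0(1) by (auto simp: gen_in_def)
  then obtain U where U: "\<And>s. s \<in> S0 \<Longrightarrow> U s \<subseteq> X \<and> finite (U s) \<and> s \<in> span_in B (U s)"
    by metis
  define T where "T = (\<Union>s\<in>S0. U s)"
  have T: "T \<subseteq> X" "finite T" using U \<open>finite S0\<close> by (auto simp: T_def)
  have "s \<in> span_in B T" if "s \<in> S0" for s
    using span_in_mono[OF B(1), of "U s" T] U[OF that] T X that by (auto simp: T_def)
  then have "span_in B S0 \<subseteq> span_in B T"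
    using T X by (intro span_in_subset ideal_span_in[OF B(1)]) auto
  with T S0(3) ideal_gen_in(2)[OF B(1) X] show ?thesis by blast
qed

text \<open>Some point lies in none of the kernels of finitely many nonzero functionals: move along a line and
  avoid finitely many parameters.  Real parameters suffice for this.  The operation
  \<open>ln x t y\<close> stands for \<open>x + t y\<close>, so that the argument applies to any kind of vectors.\<close>

lemma generic_point:
  fixes \<psi> :: "'i \<Rightarrow> 'v \<Rightarrow> complex" and ln :: "'v \<Rightarrow> real \<Rightarrow> 'v \<Rightarrow> 'v"
  assumes "finite I" and ne: "E \<noteq> {}"
    and ln: "\<And>x t y. x \<in> E \<Longrightarrow> y \<in> E \<Longrightarrow> ln x t y \<in> E"
    and lin: "\<And>i x t y. i \<in> I \<Longrightarrow> \<psi> i (ln x t y) = \<psi> i x + complex_of_real t * \<psi> i y"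
    and nz: "\<And>i. i \<in> I \<Longrightarrow> \<exists>e\<in>E. \<psi> i e \<noteq> 0"
  shows "\<exists>c\<in>E. \<forall>i\<in>I. \<psi> i c \<noteq> 0"
  using assms(1) lin nz
proof (induction I rule: finite_induct)
  case empty
  show ?case using ne by auto
next
  case (insert j I)
  then obtain c where c: "c \<in> E" "\<forall>i\<in>I. \<psi> i c \<noteq> 0" by auto
  obtain e where e: "e \<in> E" "\<psi> j e \<noteq> 0" using insert.prems(2)[of j] by auto
  define bad where "bad i = {t::real. \<psi> i c + of_real t * \<psi> i e = 0}" for i
  have "finite (bad i)" if i: "i \<in> insert j I" for i
  proof (cases "\<psi> i e = 0")
    case False
    have "t = Re (- \<psi> i c / \<psi> i e)" if "t \<in> bad i" for t
    proof -
      have "of_real t = - \<psi> i c / \<psi> i e"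
        using that False by (simp add: bad_def field_simps add_eq_0_iff2)
      then show ?thesis by (metis Re_complex_of_real)
    qed
    then have "bad i \<subseteq> {Re (- \<psi> i c / \<psi> i e)}" by blast
    then show ?thesis by (rule finite_subset) simp
  next
    case True
    then have "bad i = {}" using i c(2) e(2) by (auto simp: bad_def)
    then show ?thesis by simp
  qed
  then have "finite (\<Union>i\<in>insert j I. bad i)" using insert.hyps(1) by blast
  then obtain t where t: "t \<notin> (\<Union>i\<in>insert j I. bad i)" using ex_new_if_finite infinite_UNIV_char_0 by blast
  have "\<psi> i (ln c t e) \<noteq> 0" if "i \<in> insert j I" for i
    using that t insert.prems(1)[OF that, of c t e] by (auto simp: bad_def)
  then show ?case using ln[OF c(1) e(1)] by blast
qed

locale linear_action =
  fixes G :: "('g, 'b) monoid_scheme" and n :: nat and \<tau> :: "'g \<Rightarrow> complex mat"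
  assumes group: "group G" and finite_G: "finite (carrier G)"
    and rep: "representation G n \<tau>"
begin

sublocale group G by (rule group)

text \<open>Vectors are sequences of which only the first \<open>n\<close> entries matter; the set \<open>pts\<close> below
  normalizes the others to 0, so that equality of vectors is equality of functions.\<close>

definition act :: "'g \<Rightarrow> (nat \<Rightarrow> complex) \<Rightarrow> nat \<Rightarrow> complex"
  where "act g x = (\<lambda>i. if i < n then \<Sum>j<n. \<tau> g $$ (i, j) * x j else 0)"

definition pts :: "(nat \<Rightarrow> complex) set"
  where "pts = {x. \<forall>i\<ge>n. x i = 0}"

abbreviation A :: "cpoly set"
  where "A \<equiv> invariants G n \<tau>"

lemma tau_carrier: "g \<in> carrier G \<Longrightarrow> \<tau> g \<in> carrier_mat n n"
  and tau_mult: "g \<in> carrier G \<Longrightarrow> h \<in> carrier G \<Longrightarrow> \<tau> (g \<otimes>\<^bsub>G\<^esub> h) = \<tau> g * \<tau> h"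
  and tau_one: "\<tau> \<one>\<^bsub>G\<^esub> = 1\<^sub>m n"
proof -
  let ?M = "ring_mat TYPE(complex) n ()"
  interpret M: ring ?M by (rule ring_mat)
  have hom: "\<tau> \<in> hom G (units_of ?M)" using rep by (simp add: representation_def)
  show "g \<in> carrier G \<Longrightarrow> \<tau> g \<in> carrier_mat n n"
    using hom by (auto simp: hom_def units_of_def Units_def ring_mat_def Pi_def)
  show "g \<in> carrier G \<Longrightarrow> h \<in> carrier G \<Longrightarrow> \<tau> (g \<otimes>\<^bsub>G\<^esub> h) = \<tau> g * \<tau> h"
    using hom by (auto simp: hom_def units_of_def ring_mat_def)
  have "group_hom G (units_of ?M) \<tau>"
    using hom group M.units_group by (simp add: group_hom_def group_hom_axioms_def)
  from group_hom.hom_one[OF this] show "\<tau> \<one>\<^bsub>G\<^esub> = 1\<^sub>m n"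
    by (simp add: units_of_def ring_mat_def)
qed

lemma act_pts [simp]: "act g x \<in> pts"
  by (simp add: act_def pts_def)

lemma act_act:
  assumes "g \<in> carrier G" "h \<in> carrier G"
  shows "act g (act h x) = act (g \<otimes>\<^bsub>G\<^esub> h) x"
proof
  fix i
  have "(\<Sum>j<n. \<tau> g $$ (i, j) * (\<Sum>k<n. \<tau> h $$ (j, k) * x k))
      = (\<Sum>k<n. (\<Sum>j<n. \<tau> g $$ (i, j) * \<tau> h $$ (j, k)) * x k)"
    by (subst sum_distrib_right, subst sum.swap) (simp add: sum_distrib_left mult.assoc)
  moreover have "(\<tau> g * \<tau> h) $$ (i, k) = (\<Sum>j<n. \<tau> g $$ (i, j) * \<tau> h $$ (j, k))"
    if "i < n" "k < n" for k
    using tau_carrier[OF assms(1)] tau_carrier[OF assms(2)] that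
    by (auto simp: scalar_prod_def atLeast0LessThan intro!: sum.cong)
  ultimately show "act g (act h x) i = act (g \<otimes>\<^bsub>G\<^esub> h) x i"
    by (simp add: act_def tau_mult assms)
qed

lemma act_one: "x \<in> pts \<Longrightarrow> act \<one>\<^bsub>G\<^esub> x = x"
  by (rule ext) (auto simp: act_def tau_one pts_def if_distrib[of "\<lambda>a. a * _"] sum.delta
      cong: if_cong)

lemma act_line: "act g (\<lambda>i. x i + s * y i) = (\<lambda>i. act g x i + s * act g y i)"
  by (rule ext) (simp add: act_def sum.distrib sum_distrib_left distrib_left mult.left_commute)

lemma ev_truncate:
  "f \<in> polys n \<Longrightarrow> ev (\<lambda>i. if i < n then x i else 0) f = ev x f"
  by (rule ev_cong) auto

lemma polys_eq_pts:
  assumes "f \<in> polys n" "g \<in> polys n" "\<And>x. x \<in> pts \<Longrightarrow> ev x f = ev x g" shows "f = g"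
proof (rule polys_eqI[OF assms(1,2)])
  fix x show "ev x f = ev x g"
    using assms(3)[of "\<lambda>i. if i < n then x i else 0"] assms(1,2) by (simp add: ev_truncate pts_def)
qed

lemma ev_act:
  assumes "g \<in> carrier G" "f \<in> polys n"
  shows "ev x (lin_subst (\<tau> g) f) = ev (act g x) f"
  using tau_carrier[OF assms(1)] assms(2)
  by (subst ev_lin_subst[of _ n]) (auto intro!: ev_cong[OF assms(2)] simp: act_def)

lemma polys_subst [simp]: "g \<in> carrier G \<Longrightarrow> lin_subst (\<tau> g) f \<in> polys n"
  using tau_carrier by (intro polys_lin_subst) auto

lemma invariants_iff:
  "f \<in> A \<longleftrightarrow> f \<in> polys n \<and> (\<forall>g\<in>carrier G. \<forall>x. ev (act g x) f = ev x f)"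
proof -
  have "lin_subst (\<tau> g) f = f \<longleftrightarrow> (\<forall>x. ev (act g x) f = ev x f)"
    if "f \<in> polys n" "g \<in> carrier G" for g
    using that polys_eqI[of "lin_subst (\<tau> g) f" n f] by (auto simp: ev_act[symmetric])
  then show ?thesis by (auto simp: invariants_def)
qed

lemma A_polys: "f \<in> A \<Longrightarrow> f \<in> polys n"
  by (simp add: invariants_iff)

lemma ev_act_A: "f \<in> A \<Longrightarrow> g \<in> carrier G \<Longrightarrow> ev (act g x) f = ev x f"
  by (simp add: invariants_iff)

lemma subring_A: "subring_set A"
  by (auto simp: subring_set_def invariants_iff)

lemma Const_A [simp]: "Const c \<in> A"
  by (auto simp: invariants_iff)

lemma bij_mult_right: "h \<in> carrier G \<Longrightarrow> bij_betw (\<lambda>g. g \<otimes>\<^bsub>G\<^esub> h) (carrier G) (carrier G)"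
  by (rule bij_betw_byWitness[where f' = "\<lambda>g. g \<otimes>\<^bsub>G\<^esub> inv\<^bsub>G\<^esub> h"]) (auto simp: m_assoc)

definition orbit_sum :: "cpoly \<Rightarrow> cpoly"
  where "orbit_sum f = (\<Sum>g\<in>carrier G. lin_subst (\<tau> g) f)"

lemma ev_orbit_sum: "f \<in> polys n \<Longrightarrow> ev x (orbit_sum f) = (\<Sum>g\<in>carrier G. ev (act g x) f)"
  by (simp add: orbit_sum_def ev_act)

lemma orbit_sum_A:
  assumes "f \<in> polys n" shows "orbit_sum f \<in> A"
proof -
  have "ev (act h x) (orbit_sum f) = ev x (orbit_sum f)" if "h \<in> carrier G" for h x
  proof -
    have "ev (act h x) (orbit_sum f) = (\<Sum>g\<in>carrier G. ev (act (g \<otimes>\<^bsub>G\<^esub> h) x) f)"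
      by (simp add: ev_orbit_sum assms act_act that)
    also have "\<dots> = ev x (orbit_sum f)"
      unfolding ev_orbit_sum[OF assms] by (rule sum.reindex_bij_betw[OF bij_mult_right[OF that]])
    finally show ?thesis .
  qed
  then show ?thesis by (auto simp: invariants_iff orbit_sum_def)
qed

lemma orbit_sum_mult:
  assumes "a \<in> A" "f \<in> polys n" shows "orbit_sum (f * a) = orbit_sum f * a"
  using assms A_polys[OF assms(1)]
  by (intro polys_eqI[where n = n])
     (auto simp: ev_orbit_sum A_polys[OF orbit_sum_A] ev_act_A sum_distrib_right)

lemma orbit_sum_sum:
  assumes "\<And>i. i \<in> I \<Longrightarrow> f i \<in> polys n" shows "orbit_sum (sum f I) = (\<Sum>i\<in>I. orbit_sum (f i))"
proof (rule polys_eqI[where n = n])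
  fix x
  have "ev x (orbit_sum (sum f I)) = (\<Sum>g\<in>carrier G. \<Sum>i\<in>I. ev (act g x) (f i))"
    using assms by (subst ev_orbit_sum) auto
  also have "\<dots> = ev x (\<Sum>i\<in>I. orbit_sum (f i))"
    using assms by (subst sum.swap) (auto simp: ev_orbit_sum intro!: sum.cong)
  finally show "ev x (orbit_sum (sum f I)) = ev x (\<Sum>i\<in>I. orbit_sum (f i))" .
qed (use assms in \<open>auto intro!: A_polys[OF orbit_sum_A] polys_sum\<close>)

lemma orbit_sum_A_id: "f \<in> A \<Longrightarrow> orbit_sum f = Const (of_nat (order G)) * f"
  by (intro polys_eqI[where n = n])
    (auto simp: ev_orbit_sum A_polys A_polys[OF orbit_sum_A] ev_act_A order_def)

lemma order_nz: "complex_of_nat (order G) \<noteq> 0"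
  using finite_G by (auto simp: order_def card_eq_0_iff)

definition orbit_prod :: "cpoly \<Rightarrow> cpoly"
  where "orbit_prod f = (\<Prod>g\<in>carrier G. lin_subst (\<tau> g) f)"

lemma ev_orbit_prod: "f \<in> polys n \<Longrightarrow> ev x (orbit_prod f) = (\<Prod>g\<in>carrier G. ev (act g x) f)"
  by (simp add: orbit_prod_def ev_act)

lemma orbit_prod_A:
  assumes "f \<in> polys n" shows "orbit_prod f \<in> A"
proof -
  have "ev (act h x) (orbit_prod f) = ev x (orbit_prod f)" if "h \<in> carrier G" for h x
  proof -
    have "ev (act h x) (orbit_prod f) = (\<Prod>g\<in>carrier G. ev (act (g \<otimes>\<^bsub>G\<^esub> h) x) f)"
      by (simp add: ev_orbit_prod assms act_act that)
    also have "\<dots> = ev x (orbit_prod f)"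
      unfolding ev_orbit_prod[OF assms] by (rule prod.reindex_bij_betw[OF bij_mult_right[OF that]])
    finally show ?thesis .
  qed
  then show ?thesis by (auto simp: invariants_iff orbit_prod_def)
qed

text \<open>Hilbert's argument: generators of an ideal of invariants over the polynomial ring are
  generators over the invariants, since averaging over the group is linear over the invariants.\<close>

lemma averaging_span:
  assumes S: "S \<subseteq> A" and f: "f \<in> A" "f \<in> span_in (polys n) S"
  shows "f \<in> span_in A S"
proof -
  obtain c where c: "f = (\<Sum>s\<in>S. c s * s)" "\<forall>s\<in>S. c s \<in> polys n"
    using f by (auto simp: span_in_def)
  let ?k = "Const (1 / of_nat (order G))"
  have "c s * s \<in> polys n" if "s \<in> S" for s using c(2) S A_polys that by (intro polys_mult) auto
  then have "Const (of_nat (order G)) * f = (\<Sum>s\<in>S. orbit_sum (c s * s))"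
    by (subst orbit_sum_A_id[OF f(1), symmetric], subst c(1), intro orbit_sum_sum)
  also have "\<dots> = (\<Sum>s\<in>S. orbit_sum (c s) * s)"
    using c S by (intro sum.cong refl orbit_sum_mult) auto
  finally have "?k * (Const (of_nat (order G)) * f) = (\<Sum>s\<in>S. (?k * orbit_sum (c s)) * s)"
    by (simp add: sum_distrib_left mult.assoc)
  moreover have "?k * (Const (of_nat (order G)) * f) = f"
    using order_nz by (simp add: mult.assoc[symmetric] Const_mult[symmetric])
  ultimately show ?thesis
    using c(2) by (auto simp: span_in_def intro!: exI[of _ "\<lambda>s. ?k * orbit_sum (c s)"]
        subring_setD(5)[OF subring_A] orbit_sum_A)
qed

theorem noeth_A: "noeth A"
  unfolding noeth_def
proof (intro allI impI)
  fix I assume I: "ideal_in A I"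
  then have "I \<subseteq> polys n" by (auto simp: ideal_in_def intro: A_polys)
  then obtain S where S: "S \<subseteq> I" "finite S" "I \<subseteq> span_in (polys n) S"
    using noeth_subset[OF subring_set_polys noeth_polys] by meson
  then have "I \<subseteq> span_in A S"
    using averaging_span[of S] ideal_inD(1)[OF I] by blast
  with S show "\<exists>S\<subseteq>I. finite S \<and> I \<subseteq> span_in A S" by blast
qed


subsection \<open>Integrality\<close>

definition orbit_poly :: "cpoly \<Rightarrow> cpoly poly"
  where "orbit_poly b = (\<Prod>g\<in>carrier G. [:- lin_subst (\<tau> g) b, 1:])"

lemma coeff_orbit_poly:
  assumes "b \<in> polys n" shows "Polynomial.coeff (orbit_poly b) i \<in> A"
proof -
  have "\<forall>i. Polynomial.coeff (\<Prod>g\<in>H. [:- lin_subst (\<tau> g) b, 1:]) i \<in> polys n"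
    if "H \<subseteq> carrier G" for H
    using that
  proof (induction H rule: infinite_finite_induct)
    case (insert g H)
    have "Polynomial.coeff [:- lin_subst (\<tau> g) b, 1:] i \<in> polys n" for i
      using insert.prems by (auto simp: coeff_pCons split: nat.splits)
    with insert show ?case by (auto simp: Polynomial.coeff_mult simp del: mult_pCons_left)
  qed (auto simp: Polynomial.coeff_1)
  then have polys: "Polynomial.coeff (orbit_poly b) i \<in> polys n" for i
    by (auto simp: orbit_poly_def)
  have eq: "map_poly (ev x) (orbit_poly b) = (\<Prod>g\<in>carrier G. [:- ev (act g x) b, 1:])" for x
  proof -
    interpret ev: comm_ring_hom "ev x" by (rule ev_hom)
    interpret mp: map_poly_comm_ring_hom "ev x" ..
    show ?thesis
      by (simp add: orbit_poly_def mp.hom_prod ev_act assms map_poly_pCons)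
  qed
  have "ev (act h x) (Polynomial.coeff (orbit_poly b) i) = ev x (Polynomial.coeff (orbit_poly b) i)"
    if "h \<in> carrier G" for h x
  proof -
    have "map_poly (ev (act h x)) (orbit_poly b) = map_poly (ev x) (orbit_poly b)"
      unfolding eq using prod.reindex_bij_betw[OF bij_mult_right[OF that], of "\<lambda>g. [:- ev (act g x) b, 1:]"]
      by (simp add: act_act that)
    then show ?thesis by (metis coeff_map_poly ev_zero)
  qed
  with polys show ?thesis by (auto simp: invariants_iff)
qed

lemma subst_one: "b \<in> polys n \<Longrightarrow> lin_subst (\<tau> \<one>\<^bsub>G\<^esub>) b = b"
  by (rule polys_eq_pts) (auto simp: ev_act act_one)

text \<open>The orbit polynomial is monic with invariant coefficients and has \<open>b\<close> as a root.\<close>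

lemma integral_over_A:
  assumes "b \<in> polys n"
  shows "\<exists>P. (\<forall>i. Polynomial.coeff P i \<in> A) \<and> lead_coeff P = 1 \<and> poly P b = 0"
proof (intro exI conjI allI)
  show "Polynomial.coeff (orbit_poly b) i \<in> A" for i using coeff_orbit_poly[OF assms] .
  show "lead_coeff (orbit_poly b) = 1" by (simp add: orbit_poly_def lead_coeff_prod)
  show "poly (orbit_poly b) b = 0"
    using finite_G subst_one[OF assms] by (auto simp: orbit_poly_def poly_prod prod_zero_iff intro!: bexI[of _ "\<one>\<^bsub>G\<^esub>"])
qed


subsection \<open>Complex points of the quotient are orbits\<close>

definition point :: "(nat \<Rightarrow> complex) \<Rightarrow> cpoly \<Rightarrow> complex"
  where "point x = restrict (ev x) A"

lemma point_act: "g \<in> carrier G \<Longrightarrow> point (act g x) = point x"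
  by (auto simp: point_def ev_act_A restrict_def)

lemma point_complex_points: "point x \<in> complex_points A"
  by (auto simp: complex_points_def point_def Ring.ring_hom_def ring_on_def
      subring_setD[OF subring_A] simp del: Const_1 Const_0)

text \<open>The kernel of a homomorphism to \<open>\<complex>\<close> generates a proper ideal of the polynomial ring, since
  averaging over the group would turn a representation of 1 into one by invariants.  The variables
  are integral over the invariants, so this ideal has a common zero.\<close>

lemma complex_points_are_orbits:
  assumes "\<phi> \<in> complex_points A"
  shows "\<exists>x\<in>pts. \<phi> = point x"
proof -
  have add: "\<phi> (a + b) = \<phi> a + \<phi> b" and mult: "\<phi> (a * b) = \<phi> a * \<phi> b" if "a \<in> A" "b \<in> A" for a b
    using assms that by (auto simp: complex_points_def Ring.ring_hom_def ring_on_def)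
  have Const: "\<phi> (Const c) = c" for c using assms by (auto simp: complex_points_def)
  have ext: "\<phi> \<in> extensional A" using assms by (auto simp: complex_points_def)
  have zero: "\<phi> 0 = 0" using Const[of 0] by simp
  have sum: "\<phi> (sum f X) = (\<Sum>i\<in>X. \<phi> (f i))" if "\<And>i. i \<in> X \<Longrightarrow> f i \<in> A" for f :: "cpoly \<Rightarrow> cpoly" and X
    using that by (induction X rule: infinite_finite_induct)
      (auto simp: zero intro!: add[THEN trans] subring_set_sum[OF subring_A])
  define K where "K = {f \<in> A. \<phi> f = 0}"
  have K: "K \<subseteq> polys n" by (auto simp: K_def intro: A_polys)
  note J = ideal_gen_in[OF subring_set_polys K]
  have shift: "f - Const (\<phi> f) \<in> K" if "f \<in> A" for f
  proof -
    have "\<phi> (f + Const (- \<phi> f)) = 0" using that by (simp add: add Const del: Const_minus)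
    then show ?thesis using that subring_setD(6)[OF subring_A that, of "Const (\<phi> f)"]
      by (simp add: K_def Const_minus)
  qed
  have "1 \<notin> gen_in (polys n) K"
  proof
    assume "1 \<in> gen_in (polys n) K"
    then obtain S where S: "S \<subseteq> K" "finite S" "1 \<in> span_in (polys n) S" by (auto simp: gen_in_def)
    then have "1 \<in> span_in A S"
      using subring_setD(2)[OF subring_A] by (intro averaging_span) (auto simp: K_def)
    then obtain c where c: "1 = (\<Sum>s\<in>S. c s * s)" "\<forall>s\<in>S. c s \<in> A" by (auto simp: span_in_def)
    have "\<phi> 1 = (\<Sum>s\<in>S. \<phi> (c s * s))"
      using c S(1) by (subst c(1), intro sum) (auto simp: K_def intro: subring_setD[OF subring_A])
    also have "\<dots> = 0" using c S(1) by (intro sum.neutral) (auto simp: mult K_def)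
    finally show False using Const[of 1] by simp
  qed
  moreover have "\<exists>q. q \<noteq> 0 \<and> poly (map_poly Const q) (Var i) \<in> gen_in (polys n) K" if "i < n" for i
  proof -
    obtain P where P: "\<forall>j. Polynomial.coeff P j \<in> A" "lead_coeff P = 1" "poly P (Var i) = 0"
      using integral_over_A[OF polys_Var[OF \<open>i < n\<close>]] by blast
    define q where "q = map_poly \<phi> P"
    have cq: "Polynomial.coeff q j = \<phi> (Polynomial.coeff P j)" for j
      by (simp add: q_def coeff_map_poly zero)
    have "Polynomial.coeff q (Polynomial.degree P) = 1" using P(2) Const[of 1] by (simp add: cq)
    then have "q \<noteq> 0" by auto
    have dq: "Polynomial.degree (map_poly Const q) \<le> Polynomial.degree P"
      by (intro degree_le) (auto simp: coeff_map_poly cq Polynomial.coeff_eq_0 zero)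
    have "poly (map_poly Const q) (Var i) = poly (map_poly Const q) (Var i) - poly P (Var i)"
      using P(3) by simp
    also have "\<dots> = poly (map_poly Const q - P) (Var i)" by simp
    also have "\<dots> = (\<Sum>j\<le>Polynomial.degree P. Polynomial.coeff (map_poly Const q - P) j * Var i ^ j)"
      by (rule poly_altdef_le) (use dq in \<open>auto intro: degree_diff_le\<close>)
    also have "\<dots> = (\<Sum>j\<le>Polynomial.degree P. (- (Var i ^ j)) *
        (Polynomial.coeff P j - Const (\<phi> (Polynomial.coeff P j))))"
      by (intro sum.cong) (auto simp: coeff_map_poly cq algebra_simps)
    also have "\<dots> \<in> gen_in (polys n) K"
      using P(1) that shift J(2) by (intro ideal_in_sum[OF J(1)] ideal_inD(4)[OF J(1)]) auto
    finally show ?thesis using \<open>q \<noteq> 0\<close> by blast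
  qed
  ultimately obtain v where v: "\<forall>f\<in>gen_in (polys n) K. ev v f = 0"
    using common_zero_of_integral_ideal[OF J(1)] by blast
  define x where "x = (\<lambda>i. if i < n then v i else 0)"
  have "\<phi> f = ev x f" if "f \<in> A" for f
  proof -
    have "ev v (f - Const (\<phi> f)) = 0" using v J(2) shift[OF that] by blast
    then show ?thesis using ev_truncate[OF A_polys[OF that], of v] by (simp add: x_def)
  qed
  then have "\<phi> = point x" using ext by (auto simp: point_def extensional_def)
  moreover have "x \<in> pts" by (simp add: pts_def x_def)
  ultimately show ?thesis by blast
qed

lemma complex_points_eq: "complex_points A = point ` pts"
  using complex_points_are_orbits point_complex_points by blast

lemma separating_linear_form:
  assumes "finite I" "\<And>i. i \<in> I \<Longrightarrow> u i \<in> pts" "y \<in> pts" "\<And>i. i \<in> I \<Longrightarrow> u i \<noteq> y"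
  shows "\<exists>l\<in>polys n. ev y l = 0 \<and> (\<forall>i\<in>I. ev (u i) l \<noteq> 0)"
proof -
  have "\<exists>c\<in>pts. \<forall>i\<in>I. (\<Sum>k<n. c k * (u i k - y k)) \<noteq> 0"
  proof (rule generic_point[where ln = "\<lambda>x t y k. x k + complex_of_real t * y k", OF assms(1)])
    fix i assume "i \<in> I"
    then obtain k where k: "u i k \<noteq> y k" using assms(4) by blast
    then have "k < n" using assms(2)[OF \<open>i \<in> I\<close>] assms(3) by (auto simp: pts_def) (metis not_le)
    have "(\<Sum>j<n. (if j = k then 1 else 0) * (u i j - y j)) = (\<Sum>j<n. if j = k then u i j - y j else 0)"
      by (intro sum.cong) auto
    also have "\<dots> = u i k - y k" using \<open>k < n\<close> by simp
    finally show "\<exists>e\<in>pts. (\<Sum>k<n. e k * (u i k - y k)) \<noteq> 0"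
      using k \<open>k < n\<close> by (intro bexI[of _ "\<lambda>j. if j = k then 1 else 0"]) (auto simp: pts_def)
  next
    fix i x t and e :: "nat \<Rightarrow> complex"
    show "(\<Sum>k<n. (x k + complex_of_real t * e k) * (u i k - y k))
        = (\<Sum>k<n. x k * (u i k - y k)) + complex_of_real t * (\<Sum>k<n. e k * (u i k - y k))"
      by (simp add: distrib_right sum.distrib sum_distrib_left mult.assoc)
  qed (auto simp: pts_def)
  then obtain c where c: "\<forall>i\<in>I. (\<Sum>k<n. c k * (u i k - y k)) \<noteq> 0" by blast
  then show ?thesis
    by (intro bexI[of _ "\<Sum>k<n. Const (c k) * (Var k - Const (y k))"])
      (auto intro!: polys_sum polys_mult polys_diff polys_Var polys_Const)
qed

text \<open>Invariants separate orbits: if \<open>y\<close> is not in the orbit of \<open>x\<close>, take the product over the group of an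
  affine linear function that vanishes at \<open>y\<close> but nowhere on the orbit of \<open>x\<close>.\<close>

lemma point_eq_iff:
  assumes "x \<in> pts" "y \<in> pts"
  shows "point x = point y \<longleftrightarrow> (\<exists>g\<in>carrier G. y = act g x)"
proof
  assume eq: "point x = point y"
  show "\<exists>g\<in>carrier G. y = act g x"
  proof (rule ccontr)
    assume "\<not> ?thesis"
    then obtain l where l: "l \<in> polys n" "ev y l = 0" "\<forall>g\<in>carrier G. ev (act g x) l \<noteq> 0"
      using separating_linear_form[OF finite_G, of "\<lambda>g. act g x" y] assms(2) by auto
    have "ev y (orbit_prod l) = 0"
      using l(1,2) finite_G act_one[OF assms(2)]
      by (auto simp: ev_orbit_prod intro!: bexI[of _ "\<one>\<^bsub>G\<^esub>"])
    moreover have "ev x (orbit_prod l) \<noteq> 0"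
      using l finite_G by (auto simp: ev_orbit_prod)
    ultimately show False
      using fun_cong[OF eq, of "orbit_prod l"] orbit_prod_A[OF l(1)] by (auto simp: point_def)
  qed
qed (auto simp: point_act)

end

section \<open>Local rings\<close>

subsection \<open>Subrings of a commutative ring as structures\<close>

definition prime_in :: "'a::comm_ring_1 set \<Rightarrow> 'a set \<Rightarrow> bool"
  where "prime_in B P \<longleftrightarrow> ideal_in B P \<and> 1 \<notin> P \<and> (\<forall>a\<in>B. \<forall>b\<in>B. a * b \<in> P \<longrightarrow> a \<in> P \<or> b \<in> P)"

lemma ring_on_simps [simp]:
  "carrier (ring_on B) = B" "mult (ring_on B) = (*)" "one (ring_on B) = 1"
  "zero (ring_on B) = 0" "add (ring_on B) = (+)"
  by (simp_all add: ring_on_def)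

lemma cring_ring_on:
  assumes B: "subring_set B" shows "cring (ring_on B)"
proof (rule cringI)
  show "abelian_group (ring_on B)"
    by (rule abelian_groupI)
      (auto intro: subring_setD[OF B] simp: algebra_simps intro!: bexI[of _ "- _"])
  show "comm_monoid (ring_on B)"
    by (rule comm_monoidI) (auto intro: subring_setD[OF B] simp: algebra_simps)
qed (auto simp: algebra_simps)

lemma ideal_ring_on:
  assumes B: "subring_set B" shows "ideal I (ring_on B) \<longleftrightarrow> ideal_in B I"
proof
  interpret R: cring "ring_on B" by (rule cring_ring_on[OF B])
  assume "ideal I (ring_on B)"
  then interpret ideal I "ring_on B" .
  show "ideal_in B I"
    unfolding ideal_in_def using a_subset zero_closed a_closed I_l_closed by auto
next
  interpret R: cring "ring_on B" by (rule cring_ring_on[OF B])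
  assume I: "ideal_in B I"
  have inv: "inv\<^bsub>add_monoid (ring_on B)\<^esub> x = - x" if "x \<in> B" for x
    using R.minus_equality[of "- x" x] that subring_setD(3)[OF B that]
    by (simp add: a_inv_def)
  show "ideal I (ring_on B)"
  proof (rule idealI)
    show "subgroup I (add_monoid (ring_on B))"
    proof (rule group.subgroupI)
      show "group (add_monoid (ring_on B))" by (rule R.a_group)
      show "I \<subseteq> carrier (add_monoid (ring_on B))" "I \<noteq> {}"
        using ideal_inD(1,2)[OF I] by auto
      show "inv\<^bsub>add_monoid (ring_on B)\<^esub> a \<in> I" if "a \<in> I" for a
        using inv[OF ideal_inD(1)[OF I that]] ideal_in_minus[OF B I that] by simp
      show "a \<otimes>\<^bsub>add_monoid (ring_on B)\<^esub> b \<in> I" if "a \<in> I" "b \<in> I" for a b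
        using ideal_inD(3)[OF I that] by simp
    qed
    show "ring (ring_on B)" by (rule R.ring_axioms)
    fix a x assume ax: "a \<in> I" "x \<in> carrier (ring_on B)"
    then show "x \<otimes>\<^bsub>ring_on B\<^esub> a \<in> I" using ideal_inD(4)[OF I, of x a] by simp
    then show "a \<otimes>\<^bsub>ring_on B\<^esub> x \<in> I" by (simp add: mult.commute)
  qed
qed

lemma ideal_in_eq_iff_one:
  assumes "subring_set B" "ideal_in B I" shows "I = B \<longleftrightarrow> 1 \<in> I"
  using ideal_inD(1,4)[OF assms(2)] subring_setD(2)[OF assms(1)] by (metis mult_1_right subsetI subset_antisym)

lemma primeideal_ring_on:
  assumes B: "subring_set B" shows "primeideal P (ring_on B) \<longleftrightarrow> prime_in B P"
proof
  assume "primeideal P (ring_on B)"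
  then interpret primeideal P "ring_on B" .
  have "ideal_in B P" using ideal_ring_on[OF B] ideal_axioms by blast
  then show "prime_in B P"
    using I_notcarr I_prime ideal_in_eq_iff_one[OF B] by (auto simp: prime_in_def)
next
  assume "prime_in B P"
  then show "primeideal P (ring_on B)"
    using ideal_ring_on[OF B] ideal_in_eq_iff_one[OF B, of P] cring_ring_on[OF B]
    by (intro primeidealI) (auto simp: prime_in_def)
qed

lemma genideal_ring_on:
  assumes B: "subring_set B" and "finite S" "S \<subseteq> B"
  shows "Idl\<^bsub>ring_on B\<^esub> S = span_in B S"
  unfolding genideal_def ideal_ring_on[OF B]
  using ideal_span_in[OF B \<open>S \<subseteq> B\<close>] span_in_superset[OF B \<open>finite S\<close>] span_in_subset by blast

lemma noetherian_ring_on: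
  assumes B: "subring_set B" and "noeth B" shows "noetherian_ring (ring_on B)"
proof -
  interpret R: cring "ring_on B" by (rule cring_ring_on[OF B])
  show ?thesis
  proof (rule R.noetherian_ringI)
    fix I assume "ideal I (ring_on B)"
    then have I: "ideal_in B I" using ideal_ring_on[OF B] by blast
    then obtain S where S: "S \<subseteq> I" "finite S" "I \<subseteq> span_in B S"
      using \<open>noeth B\<close> unfolding noeth_def by meson
    then have "S \<subseteq> B" "I = span_in B S" using I span_in_subset[OF I S(1)] by (auto simp: ideal_in_def)
    then show "\<exists>S\<subseteq>carrier (ring_on B). finite S \<and> I = Idl\<^bsub>ring_on B\<^esub> S"
      using S(2) genideal_ring_on[OF B] by auto
  qed
qed


subsection \<open>Localization at a prime\<close>

locale localization =
  fixes A P :: "'a::idom set"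
  assumes subring: "subring_set A" and prime: "prime_in A P"
begin

definition L :: "'a fract set"
  where "L = {Fract a s | a s. a \<in> A \<and> s \<in> A - P}"

definition extension :: "'a set \<Rightarrow> 'a fract set"
  where "extension Q = {Fract a s | a s. a \<in> Q \<and> s \<in> A - P}"

definition contraction :: "'a fract set \<Rightarrow> 'a set"
  where "contraction J = {a \<in> A. Fract a 1 \<in> J}"

lemma local_ring_at_eq: "local_ring_at A P = ring_on L"
  by (simp add: local_ring_at_def L_def)

lemma P_ideal: "ideal_in A P" using prime by (simp add: prime_in_def)

lemma denominators:
  shows "1 \<in> A - P" "s \<in> A - P \<Longrightarrow> s \<noteq> 0" "s \<in> A - P \<Longrightarrow> t \<in> A - P \<Longrightarrow> s * t \<in> A - P"
  using prime subring_setD[OF subring] ideal_inD(2)[OF P_ideal] by (auto simp: prime_in_def)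

lemma extension_ideal:
  assumes I: "ideal_in A I" shows "ideal_in L (extension I)"
  unfolding ideal_in_def
proof (intro conjI ballI)
  show "extension I \<subseteq> L" using ideal_inD(1)[OF I] by (auto simp: extension_def L_def)
  have "0 = Fract 0 (1::'a)" by (simp add: fract_collapse)
  then show "0 \<in> extension I"
    using ideal_inD(2)[OF I] denominators(1) unfolding extension_def by blast
next
  fix x y assume "x \<in> extension I" "y \<in> extension I"
  then obtain a s b t where *: "x = Fract a s" "a \<in> I" "s \<in> A - P" "y = Fract b t" "b \<in> I" "t \<in> A - P"
    by (auto simp: extension_def)
  then have "x + y = Fract (t * a + s * b) (s * t)"
    using denominators(2) by (simp add: mult.commute)
  moreover have "t * a + s * b \<in> I" using * by (intro ideal_inD(3,4)[OF I]) auto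
  ultimately show "x + y \<in> extension I"
    using denominators(3)[of s t] * unfolding extension_def by blast
next
  fix x y assume "x \<in> L" "y \<in> extension I"
  then obtain a s b t where *: "x = Fract a s" "a \<in> A" "s \<in> A - P" "y = Fract b t" "b \<in> I" "t \<in> A - P"
    by (auto simp: extension_def L_def)
  then have "x * y = Fract (a * b) (s * t)" by simp
  moreover have "a * b \<in> I" using * by (intro ideal_inD(4)[OF I]) auto
  ultimately show "x * y \<in> extension I"
    using denominators(3)[of s t] * unfolding extension_def by blast
qed

lemma subring_L: "subring_set L"
proof -
  have A: "ideal_in A A" using subring_setD[OF subring] by (auto simp: ideal_in_def)
  have L: "L = extension A" by (auto simp: L_def extension_def)
  note I = extension_ideal[OF A, folded L]
  have "1 = Fract 1 (1::'a)" by (simp add: fract_collapse)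
  then have "1 \<in> L" unfolding L_def using subring_setD(2)[OF subring] denominators(1) by blast
  moreover have "- x \<in> L" if "x \<in> L" for x
  proof -
    obtain a s where "x = Fract a s" "a \<in> A" "s \<in> A - P" using \<open>x \<in> L\<close> by (auto simp: L_def)
    then have "- x = Fract (- a) s" "- a \<in> A" using subring_setD(3)[OF subring] by auto
    then show ?thesis unfolding L_def using \<open>s \<in> A - P\<close> by blast
  qed
  ultimately show ?thesis
    using ideal_inD[OF I] by (auto simp: subring_set_def)
qed

lemma Fract_L: "a \<in> A \<Longrightarrow> s \<in> A - P \<Longrightarrow> Fract a s \<in> L"
  by (auto simp: L_def)

lemma Fract_mem_extension:
  assumes Q: "prime_in A Q" "Q \<subseteq> P" and a: "a \<in> A" "s \<in> A - P"
  shows "Fract a s \<in> extension Q \<longleftrightarrow> a \<in> Q"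
proof
  assume "Fract a s \<in> extension Q"
  then obtain b t where bt: "Fract a s = Fract b t" "b \<in> Q" "t \<in> A - P" by (auto simp: extension_def)
  then have "a * t = s * b" using a denominators(2) by (simp add: eq_fract mult.commute)
  moreover have "s * b \<in> Q" using Q a bt by (intro ideal_inD(4)[of A]) (auto simp: prime_in_def)
  ultimately have "a * t \<in> Q" by simp
  then show "a \<in> Q" using Q a bt(3) by (auto simp: prime_in_def)
qed (use a in \<open>auto simp: extension_def\<close>)

lemma extension_prime:
  assumes Q: "prime_in A Q" "Q \<subseteq> P" shows "prime_in L (extension Q)"
  unfolding prime_in_def
proof (intro conjI ballI impI)
  show "ideal_in L (extension Q)" using Q by (intro extension_ideal) (simp add: prime_in_def)
  have "Fract 1 1 \<notin> extension Q"
    using Fract_mem_extension[OF Q, of 1 1] Q(1) subring_setD(2)[OF subring] denominators(1)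
    by (auto simp: prime_in_def)
  then show "1 \<notin> extension Q" by (simp add: fract_collapse)
  fix x y assume "x \<in> L" "y \<in> L" and xy: "x * y \<in> extension Q"
  then obtain a s b t where *: "x = Fract a s" "a \<in> A" "s \<in> A - P" "y = Fract b t" "b \<in> A" "t \<in> A - P"
    by (auto simp: L_def)
  then have "a * b \<in> Q"
    using xy Fract_mem_extension[OF Q, of "a * b" "s * t"] denominators(3) subring_setD(5)[OF subring] by auto
  then have "a \<in> Q \<or> b \<in> Q" using Q(1) * by (auto simp: prime_in_def)
  then show "x \<in> extension Q \<or> y \<in> extension Q" using * by (auto simp: extension_def)
qed

lemma contraction_ideal:
  assumes J: "ideal_in L J" shows "ideal_in A (contraction J)"
  unfolding ideal_in_def
proof (intro conjI ballI)
  show "contraction J \<subseteq> A" by (auto simp: contraction_def)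
  show "0 \<in> contraction J"
    using ideal_inD(2)[OF J] subring_setD(1)[OF subring] by (simp add: contraction_def fract_collapse)
next
  fix a b assume "a \<in> contraction J" "b \<in> contraction J"
  then show "a + b \<in> contraction J"
    using ideal_inD(3)[OF J, of "Fract a 1" "Fract b 1"] subring_setD(4)[OF subring]
    by (simp add: contraction_def)
next
  fix a b assume "a \<in> A" "b \<in> contraction J"
  then show "a * b \<in> contraction J"
    using ideal_inD(4)[OF J, of "Fract a 1" "Fract b 1"] subring_setD(5)[OF subring] Fract_L denominators(1)
    by (simp add: contraction_def)
qed

lemma Fract_mem_iff_contraction:
  assumes J: "ideal_in L J" and a: "a \<in> A" "s \<in> A - P"
  shows "Fract a s \<in> J \<longleftrightarrow> a \<in> contraction J"
proof -
  have "Fract a 1 = Fract s 1 * Fract a s" "Fract a s = Fract 1 s * Fract a 1"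
    using a denominators(2) by (auto simp: eq_fract)
  moreover have "Fract s 1 \<in> L" "Fract 1 s \<in> L"
    using a denominators(1) by (auto intro!: Fract_L)
  ultimately show ?thesis
    using ideal_inD(4)[OF J] a(1) unfolding contraction_def by (metis (mono_tags, lifting) mem_Collect_eq)
qed

lemma contraction_subset_P:
  assumes J: "ideal_in L J" "1 \<notin> J" shows "contraction J \<subseteq> P"
proof
  fix a assume a: "a \<in> contraction J"
  show "a \<in> P"
  proof (rule ccontr)
    assume "a \<notin> P"
    then have s: "a \<in> A - P" using a by (simp add: contraction_def)
    then have "Fract a a \<in> J" using Fract_mem_iff_contraction[OF J(1), of a a] a by auto
    moreover have "Fract a a = 1" using denominators(2)[OF s] by (simp add: One_fract_def eq_fract)
    ultimately show False using J(2) by simp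
  qed
qed

lemma contraction_prime:
  assumes J: "prime_in L J" shows "prime_in A (contraction J)"
  unfolding prime_in_def
proof (intro conjI ballI impI)
  have I: "ideal_in L J" using J by (simp add: prime_in_def)
  show "ideal_in A (contraction J)" by (rule contraction_ideal[OF I])
  show "1 \<notin> contraction J" using J by (auto simp: prime_in_def contraction_def fract_collapse)
  fix a b assume *: "a \<in> A" "b \<in> A" "a * b \<in> contraction J"
  then have "Fract a 1 * Fract b 1 \<in> J" by (simp add: contraction_def)
  moreover have "Fract a 1 \<in> L" "Fract b 1 \<in> L" using * denominators(1) by (auto intro!: Fract_L)
  ultimately show "a \<in> contraction J \<or> b \<in> contraction J"
    using J * by (auto simp: prime_in_def contraction_def)
qed

lemma contraction_mono:
  assumes J: "ideal_in L J" "ideal_in L J'" and "contraction J \<subseteq> contraction J'" shows "J \<subseteq> J'"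
proof
  fix x assume x: "x \<in> J"
  then obtain a s where "x = Fract a s" "a \<in> A" "s \<in> A - P" using ideal_inD(1)[OF J(1)] by (force simp: L_def)
  then show "x \<in> J'" using x assms Fract_mem_iff_contraction[OF J(1)] Fract_mem_iff_contraction[OF J(2)] by blast
qed

text \<open>Fractions with numerator outside \<open>P\<close> are units, so every proper ideal lies in the extension of \<open>P\<close>.\<close>

lemma maximalideal_iff: "maximalideal M (ring_on L) \<longleftrightarrow> M = extension P"
proof -
  note PP = extension_prime[OF prime subset_refl]
  have below: "J \<subseteq> extension P" if "ideal_in L J" "1 \<notin> J" for J
  proof (rule contraction_mono[OF that(1) extension_ideal[OF P_ideal]])
    show "contraction J \<subseteq> contraction (extension P)"
    proof
      fix a assume a: "a \<in> contraction J"
      then have "a \<in> P" using contraction_subset_P[OF that] by blast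
      then have "Fract a 1 \<in> extension P" using denominators(1) unfolding extension_def by blast
      then show "a \<in> contraction (extension P)" using a by (simp add: contraction_def)
    qed
  qed
  have neq: "extension P \<noteq> L" using ideal_in_eq_iff_one[OF subring_L] PP by (auto simp: prime_in_def)
  show ?thesis
  proof
    assume "maximalideal M (ring_on L)"
    then interpret maximalideal M "ring_on L" .
    have M: "ideal_in L M" using ideal_ring_on[OF subring_L] ideal_axioms by blast
    have "1 \<notin> M" using I_notcarr ideal_in_eq_iff_one[OF subring_L M] by auto
    then have "M \<subseteq> extension P" using below M by blast
    then show "M = extension P"
      using I_maximal[of "extension P"] PP neq ideal_ring_on[OF subring_L]
      by (auto simp: prime_in_def ideal_in_def)
  next
    assume "M = extension P"
    moreover have "J = extension P \<or> J = L" if "ideal_in L J" "extension P \<subseteq> J" for J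
      using below[OF that(1)] that ideal_in_eq_iff_one[OF subring_L that(1)] by blast
    ultimately show "maximalideal M (ring_on L)"
      using PP neq ideal_ring_on[OF subring_L]
      by (intro maximalidealI) (auto simp: prime_in_def)
  qed
qed

lemma Fract_span:
  assumes F: "F \<subseteq> A" "finite F" and a: "a \<in> span_in A F"
  shows "Fract a 1 \<in> span_in L ((\<lambda>f. Fract f 1) ` F)"
proof -
  let ?S = "(\<lambda>f. Fract f 1) ` F"
  have S: "?S \<subseteq> L" using F denominators(1) by (auto intro!: Fract_L)
  have "F \<subseteq> contraction (span_in L ?S)"
    using F span_in_superset[OF subring_L, of ?S] by (auto simp: contraction_def)
  then have "span_in A F \<subseteq> contraction (span_in L ?S)"
    by (intro span_in_subset contraction_ideal ideal_span_in[OF subring_L S])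
  with a show ?thesis by (auto simp: contraction_def)
qed

lemma noeth_L:
  assumes "noeth A" shows "noeth L"
  unfolding noeth_def
proof (intro allI impI)
  fix J assume J: "ideal_in L J"
  obtain F where F: "F \<subseteq> contraction J" "finite F" "contraction J \<subseteq> span_in A F"
    using assms contraction_ideal[OF J] unfolding noeth_def by meson
  let ?S = "(\<lambda>f. Fract f 1) ` F"
  have FA: "F \<subseteq> A" using F(1) by (auto simp: contraction_def)
  then have S: "?S \<subseteq> L" using denominators(1) by (auto intro!: Fract_L)
  have "J \<subseteq> span_in L ?S"
    using F(3) Fract_span[OF FA F(2)] J
    by (intro contraction_mono ideal_span_in[OF subring_L S]) (auto simp: contraction_def)
  then show "\<exists>S\<subseteq>J. finite S \<and> J \<subseteq> span_in L S"
    using F by (intro exI[of _ ?S]) (auto simp: contraction_def)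
qed

text \<open>If \<open>A\<close> is noetherian, then the localization is a noetherian local ring, so regularity only asks
  for the number of generators of its maximal ideal.\<close>

lemma regular_iff:
  assumes "noeth A"
  shows "regular_local_ring (local_ring_at A P) \<longleftrightarrow>
    (\<exists>S\<subseteq>L. finite S \<and> span_in L S = extension P \<and> enat (card S) = krull_dim (ring_on L))"
proof -
  have "(\<exists>S\<subseteq>carrier (ring_on L). finite S \<and> Idl\<^bsub>ring_on L\<^esub> S = M \<and> enat (card S) = krull_dim (ring_on L))
      \<longleftrightarrow> (\<exists>S\<subseteq>L. finite S \<and> span_in L S = M \<and> enat (card S) = krull_dim (ring_on L))" for M
    by (intro ex_cong1) (auto simp: genideal_ring_on[OF subring_L])
  then show ?thesis
    unfolding regular_local_ring_def local_ring_at_eq maximalideal_iff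
    using cring_ring_on[OF subring_L] noetherian_ring_on[OF subring_L noeth_L[OF assms]] by simp
qed

text \<open>Generators of the maximal ideal, with their denominators cleared: the numerators generate \<open>P\<close> up
  to factors outside \<open>P\<close>.  The lemma after it is the converse.\<close>

lemma generators_up_to_denominator:
  assumes S: "finite S" "span_in L S = extension P"
  shows "\<exists>F\<subseteq>P. finite F \<and> card F \<le> card S \<and> (\<forall>f\<in>P. \<exists>s\<in>A - P. s * f \<in> span_in A F)"
proof -
  have "\<exists>a\<in>P. \<exists>s\<in>A - P. x = Fract a s" if "x \<in> S" for x
    using span_in_superset[OF subring_L S(1)] S(2) that unfolding extension_def by blast
  then have "\<forall>x\<in>S. \<exists>a. a \<in> P \<and> (\<exists>s\<in>A - P. x = Fract a s)" by blast
  then obtain a where as: "\<forall>x\<in>S. a x \<in> P \<and> (\<exists>s\<in>A - P. x = Fract (a x) s)" by (rule bchoice[THEN exE])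
  define F where "F = a ` S"
  have F: "F \<subseteq> P" "finite F" "card F \<le> card S" using as S(1) by (auto simp: F_def card_image_le)
  have FA: "F \<subseteq> A" using F(1) P_ideal by (auto simp: ideal_in_def)
  have "x \<in> extension (span_in A F)" if "x \<in> S" for x
  proof -
    have "a x \<in> span_in A F" using span_in_superset[OF subring F(2)] that by (auto simp: F_def)
    then show ?thesis unfolding extension_def using as that by blast
  qed
  then have "extension P \<subseteq> extension (span_in A F)"
    unfolding S(2)[symmetric] by (intro span_in_subset extension_ideal ideal_span_in[OF subring FA]) auto
  moreover have "Fract f 1 \<in> extension P" if "f \<in> P" for f
    using that denominators(1) by (auto simp: extension_def)
  ultimately have "\<exists>b t. Fract f 1 = Fract b t \<and> b \<in> span_in A F \<and> t \<in> A - P" if "f \<in> P" for f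
    using that unfolding extension_def by blast
  note clear = this
  have "\<exists>t\<in>A - P. t * f \<in> span_in A F" if f: "f \<in> P" for f
  proof -
    obtain b t where bt: "Fract f 1 = Fract b t" "b \<in> span_in A F" "t \<in> A - P" using clear[OF f] by blast
    then have "t * f = b" using denominators(2)[OF bt(3)] by (simp add: eq_fract mult.commute)
    with bt show ?thesis by blast
  qed
  with F show ?thesis by blast
qed

lemma span_eq_maximal:
  assumes F: "F \<subseteq> P" "finite F" "\<And>f. f \<in> P \<Longrightarrow> \<exists>s\<in>A - P. s * f \<in> span_in A F"
  shows "span_in L ((\<lambda>f. Fract f 1) ` F) = extension P" (is "span_in L ?S = _")
proof
  have FA: "F \<subseteq> A" using F(1) P_ideal by (auto simp: ideal_in_def)
  have S: "?S \<subseteq> extension P" using F(1) denominators(1) by (auto simp: extension_def)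
  then show "span_in L ?S \<subseteq> extension P" by (intro span_in_subset extension_ideal[OF P_ideal])
  have SL: "?S \<subseteq> L" using FA denominators(1) by (auto intro!: Fract_L)
  note I = ideal_span_in[OF subring_L SL]
  show "extension P \<subseteq> span_in L ?S"
  proof
    fix x assume "x \<in> extension P"
    then obtain a t where a: "x = Fract a t" "a \<in> P" "t \<in> A - P" by (auto simp: extension_def)
    obtain s where s: "s \<in> A - P" "s * a \<in> span_in A F" using F(3)[OF a(2)] by blast
    have "x = Fract 1 (s * t) * Fract (s * a) 1"
      using a s denominators(2) by (simp add: eq_fract)
    moreover have "Fract 1 (s * t) \<in> L" using denominators(1,3) a s by (auto intro!: Fract_L)
    ultimately show "x \<in> span_in L ?S" using ideal_inD(4)[OF I] Fract_span[OF FA F(2) s(2)] by metis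
  qed
qed

text \<open>The primes of the local ring correspond to the primes below \<open>P\<close>.\<close>

lemma krull_dim_eqI:
  assumes upper: "\<And>k Q. (\<And>i. i \<le> k \<Longrightarrow> prime_in A (Q i)) \<Longrightarrow> (\<And>i. i < k \<Longrightarrow> Q i \<subset> Q (Suc i)) \<Longrightarrow> k \<le> n"
    and lower: "\<And>i. i \<le> n \<Longrightarrow> prime_in A (R i)" "\<And>i. i \<le> n \<Longrightarrow> R i \<subseteq> P" "\<And>i. i < n \<Longrightarrow> R i \<subset> R (Suc i)"
  shows "krull_dim (ring_on L) = enat n"
proof -
  let ?C = "{enat k | k. \<exists>Q. (\<forall>i\<le>k. Q i \<in> Spec (ring_on L)) \<and> (\<forall>i<k. Q i \<subset> Q (Suc i))}"
  have Spec: "J \<in> Spec (ring_on L) \<longleftrightarrow> prime_in L J" for J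
    by (simp add: Spec_def primeideal_ring_on[OF subring_L])
  have "enat n \<in> ?C"
  proof -
    have "extension (R i) \<subset> extension (R (Suc i))" if i: "i < n" for i
    proof -
      obtain a where a: "a \<in> R (Suc i)" "a \<notin> R i" using lower(3)[OF i] by blast
      have "a \<in> A" using a(1) lower(1)[of "Suc i"] i by (auto simp: prime_in_def ideal_in_def)
      then have "Fract a 1 \<in> extension (R (Suc i))" "Fract a 1 \<notin> extension (R i)"
        using a i lower denominators(1) by (auto simp: Fract_mem_extension)
      moreover have "extension (R i) \<subseteq> extension (R (Suc i))"
        using lower(3)[OF i] by (auto simp: extension_def)
      ultimately show ?thesis by blast
    qed
    then show ?thesis
      using extension_prime lower(1,2) Spec by (intro CollectI exI[of _ n] conjI exI[of _ "\<lambda>i. extension (R i)"]) auto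
  qed
  moreover have "x \<le> enat n" if xC: "x \<in> ?C" for x
  proof -
    obtain k Q where k: "x = enat k" and Q: "\<And>i. i \<le> k \<Longrightarrow> prime_in L (Q i)" "\<And>i. i < k \<Longrightarrow> Q i \<subset> Q (Suc i)"
      using xC Spec by auto
    have "k \<le> n"
    proof (rule upper[of k "\<lambda>i. contraction (Q i)"])
      show "prime_in A (contraction (Q i))" if "i \<le> k" for i using contraction_prime[OF Q(1)[OF that]] .
      show "contraction (Q i) \<subset> contraction (Q (Suc i))" if "i < k" for i
      proof -
        have "\<not> contraction (Q (Suc i)) \<subseteq> contraction (Q i)"
          using contraction_mono[of "Q (Suc i)" "Q i"] Q(1)[of i] Q(1)[of "Suc i"] Q(2)[OF that] that
          by (auto simp: prime_in_def)
        moreover have "contraction (Q i) \<subseteq> contraction (Q (Suc i))"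
          using Q(2)[OF that] by (auto simp: contraction_def)
        ultimately show ?thesis by blast
      qed
    qed
    then show ?thesis using k by simp
  qed
  ultimately show ?thesis
    unfolding krull_dim_def by (intro antisym Sup_upper Sup_least) auto
qed

end


subsection \<open>Chains of primes and algebraic dependence\<close>

text \<open>More unknowns than equations: eliminate one unknown with one equation.\<close>

lemma homogeneous_system:
  fixes a :: "'j \<Rightarrow> 'i \<Rightarrow> complex"
  assumes "finite J" "finite I" "card J < card I"
  shows "\<exists>c. (\<exists>i\<in>I. c i \<noteq> 0) \<and> (\<forall>j\<in>J. (\<Sum>i\<in>I. a j i * c i) = 0)"
  using assms
proof (induction J arbitrary: I a rule: finite_induct)
  case empty
  then have "I \<noteq> {}" by auto
  then show ?case by (intro exI[of _ "\<lambda>_. 1"]) auto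
next
  case (insert j J)
  show ?case
  proof (cases "\<forall>i\<in>I. a j i = 0")
    case True
    obtain c where c: "\<exists>i\<in>I. c i \<noteq> 0" "\<forall>k\<in>J. (\<Sum>i\<in>I. a k i * c i) = 0"
      using insert.IH[of I a] insert.prems insert.hyps by auto
    moreover have "(\<Sum>i\<in>I. a j i * c i) = 0" using True by (intro sum.neutral) auto
    ultimately show ?thesis by auto
  next
    case False
    then obtain i0 where i0: "i0 \<in> I" "a j i0 \<noteq> 0" by auto
    let ?I = "I - {i0}"
    have "card J < card ?I" using insert.prems insert.hyps i0 by simp
    then obtain c where c: "\<exists>i\<in>?I. c i \<noteq> 0"
      "\<forall>k\<in>J. (\<Sum>i\<in>?I. (a k i - a k i0 * a j i / a j i0) * c i) = 0"
      using insert.IH[of ?I "\<lambda>k i. a k i - a k i0 * a j i / a j i0"] insert.prems by auto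
    define z where "z = - (\<Sum>i\<in>?I. a j i * c i) / a j i0"
    define d where "d = c(i0 := z)"
    have split: "(\<Sum>i\<in>I. a k i * d i) = a k i0 * z + (\<Sum>i\<in>?I. a k i * c i)" for k
    proof -
      have "(\<Sum>i\<in>I. a k i * d i) = a k i0 * d i0 + (\<Sum>i\<in>?I. a k i * d i)"
        using insert.prems i0 by (simp add: sum.remove)
      then show ?thesis by (simp add: d_def)
    qed
    have "(\<Sum>i\<in>I. a k i * d i) = 0" if "k \<in> J" for k
    proof -
      have "(\<Sum>i\<in>?I. a k i * c i) - a k i0 / a j i0 * (\<Sum>i\<in>?I. a j i * c i)
          = (\<Sum>i\<in>?I. (a k i - a k i0 * a j i / a j i0) * c i)"
        by (simp add: sum_distrib_left left_diff_distrib sum_subtractf mult.assoc)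
      then show ?thesis using c(2) that by (simp add: split z_def)
    qed
    moreover have "(\<Sum>i\<in>I. a j i * d i) = 0" using i0 by (simp add: split z_def)
    moreover have "\<exists>i\<in>I. d i \<noteq> 0" using c(1) by (auto simp: d_def)
    ultimately show ?thesis by (intro exI[of _ d]) auto
  qed
qed

definition exponents_le :: "nat \<Rightarrow> cpoly \<Rightarrow> bool"
  where "exponents_le d f \<longleftrightarrow> (\<forall>t\<in>Poly_Mapping.keys f. \<forall>i. Poly_Mapping.lookup t i \<le> d)"

lemma exponents_le_mono: "exponents_le d f \<Longrightarrow> d \<le> e \<Longrightarrow> exponents_le e f"
  by (auto simp: exponents_le_def intro: order_trans)

lemma exponents_le_add: "exponents_le d f \<Longrightarrow> exponents_le d g \<Longrightarrow> exponents_le d (f + g)"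
  using keys_add[of f g] by (auto simp: exponents_le_def)

lemma exponents_le_mult:
  assumes "exponents_le d f" "exponents_le e g" shows "exponents_le (d + e) (f * g)"
  unfolding exponents_le_def
proof (intro ballI allI)
  fix t i assume "t \<in> Poly_Mapping.keys (f * g)"
  then obtain a b where "t = a + b" "a \<in> Poly_Mapping.keys f" "b \<in> Poly_Mapping.keys g"
    using keys_mult[of f g] by auto
  then show "Poly_Mapping.lookup t i \<le> d + e"
    using assms by (auto simp: exponents_le_def lookup_add intro: add_mono)
qed

lemma exponents_le_Const: "exponents_le d (Const c)"
  by (simp add: exponents_le_def Const_def)

lemma exponents_le_power: "exponents_le d f \<Longrightarrow> exponents_le (k * d) (f ^ k)"
  using exponents_le_Const[of 0 1] by (induction k) (auto intro: exponents_le_mult)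

lemma exponents_le_prod:
  "(\<And>i. i \<in> I \<Longrightarrow> exponents_le (d i) (f i)) \<Longrightarrow> exponents_le (\<Sum>i\<in>I. d i) (\<Prod>i\<in>I. f i)"
  using exponents_le_Const[of 0 1]
  by (induction I rule: infinite_finite_induct) (auto intro: exponents_le_mult)

lemma exponents_le_ex:
  assumes "f \<in> polys n" shows "\<exists>d. exponents_le d f"
  using assms
proof (induction f rule: polys_induct)
  case (Const c) show ?case using exponents_le_Const by blast
next
  case (Var i)
  show ?case by (rule exI[of _ 1]) (auto simp: exponents_le_def Var_def lookup_single when_def)
next
  case (add f g)
  then obtain d e where "exponents_le d f" "exponents_le e g" by blast
  then have "exponents_le (max d e) (f + g)"
    by (intro exponents_le_add) (auto intro: exponents_le_mono)
  then show ?case ..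
next
  case (mult f g) then show ?case using exponents_le_mult by blast
qed

lemma lookup_Const_mult: "Poly_Mapping.lookup (Const c * f) t = c * Poly_Mapping.lookup f t"
proof -
  have "Const c * f = Poly_Mapping.map ((*) c) f"
    by (simp add: Const_def mult_map_scale_conv_mult)
  then show ?thesis by (simp add: Poly_Mapping.map.rep_eq when_def)
qed

lemma ev_poly_subst: "ev x (poly_subst y f) = ev (\<lambda>i. ev x (y i)) f"
  by (simp add: poly_subst_def) (simp add: ev_def monom_ev_def)

lemma poly_subst_in_subring:
  assumes B: "subring_set B" "\<And>c. Const c \<in> B" and y: "\<And>i. i < m \<Longrightarrow> y i \<in> B" and f: "f \<in> polys m"
  shows "poly_subst y f \<in> B"
proof -
  have "y i \<in> B" if "t \<in> Poly_Mapping.keys f" "i \<in> Poly_Mapping.keys t" for t i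
    using f that by (intro y) (auto simp: polys_def)
  then show ?thesis
    unfolding poly_subst_def
    by (intro subring_set_sum[OF B(1)] subring_setD(5)[OF B(1)] subring_set_prod[OF B(1)]
      subring_setD(7)[OF B(1)] B(2))
qed

text \<open>More polynomials than variables are algebraically dependent, because the number of monomials
  in them with bounded exponents grows faster than the dimension of the space that contains these
  monomials.\<close>

lemma algebraic_dependence:
  assumes y: "\<And>i. i < m \<Longrightarrow> y i \<in> polys n" and "n < m"
  shows "\<exists>f\<in>polys m. f \<noteq> 0 \<and> (\<forall>x. ev (\<lambda>i. ev x (y i)) f = 0)"
proof -
  have "\<forall>i\<in>{..<m}. \<exists>d. exponents_le d (y i)" using exponents_le_ex y by blast
  then obtain d where d: "\<And>i. i < m \<Longrightarrow> exponents_le (d i) (y i)" by (auto dest!: bchoice)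
  define D where "D = (\<Sum>i<m. d i)"
  have D: "exponents_le D (y i)" if "i < m" for i
    using exponents_le_mono[OF d[OF that], of D] that by (auto simp: D_def intro: member_le_sum)
  define N where "N = (m * D + 1) ^ n"
  define I where "I = PiE {..<m} (\<lambda>_. {..N})"
  define J where "J = {t :: nat \<Rightarrow>\<^sub>0 nat. Poly_Mapping.keys t \<subseteq> {..<n} \<and> (\<forall>i. Poly_Mapping.lookup t i \<le> m * (N * D))}"
  define Y where "Y e = (\<Prod>i<m. y i ^ e i)" for e :: "nat \<Rightarrow> nat"
  have I: "finite I" "card I = (N + 1) ^ m" by (auto simp: I_def card_PiE finite_PiE)
  have inj: "inj_on (\<lambda>t. restrict (Poly_Mapping.lookup t) {..<n}) J"
  proof (rule inj_onI)
    fix s t assume "s \<in> J" "t \<in> J"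
      and eq: "restrict (Poly_Mapping.lookup s) {..<n} = restrict (Poly_Mapping.lookup t) {..<n}"
    have "Poly_Mapping.lookup s i = Poly_Mapping.lookup t i" for i
    proof (cases "i < n")
      case True then show ?thesis using fun_cong[OF eq, of i] by simp
    next
      case False
      then have "i \<notin> Poly_Mapping.keys s" "i \<notin> Poly_Mapping.keys t"
        using \<open>s \<in> J\<close> \<open>t \<in> J\<close> by (auto simp: J_def)
      then show ?thesis by (simp add: in_keys_iff)
    qed
    then show "s = t" by (intro poly_mapping_eqI)
  qed
  have sub: "(\<lambda>t. restrict (Poly_Mapping.lookup t) {..<n}) ` J \<subseteq> PiE {..<n} (\<lambda>_. {..m * (N * D)})"
    by (rule image_subsetI) (simp add: J_def restrict_PiE_iff)
  have finJ: "finite J"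
    by (rule inj_on_finite[OF inj sub]) (auto intro: finite_PiE)
  have "card J \<le> card (PiE {..<n} (\<lambda>_. {..m * (N * D)}))"
    by (rule card_inj_on_le[OF inj sub]) (auto intro: finite_PiE)
  also have "\<dots> = (m * (N * D) + 1) ^ n" by (simp add: card_PiE)
  also have "\<dots> \<le> ((m * D + 1) * (N + 1)) ^ n" by (intro power_mono) (auto simp: algebra_simps)
  also have "\<dots> = N * (N + 1) ^ n" by (simp only: power_mult_distrib N_def)
  also have "\<dots> < (N + 1) * (N + 1) ^ n" by simp
  also have "\<dots> = (N + 1) ^ Suc n" by simp
  also have "\<dots> \<le> (N + 1) ^ m" using \<open>n < m\<close> by (intro power_increasing) auto
  finally have "card J < card I" using I by simp
  then obtain c where c: "\<exists>e\<in>I. c e \<noteq> 0" "\<forall>t\<in>J. (\<Sum>e\<in>I. Poly_Mapping.lookup (Y e) t * c e) = 0"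
    using homogeneous_system[OF finJ I(1), of "\<lambda>t e. Poly_Mapping.lookup (Y e) t"] by blast
  have Y: "Y e \<in> polys n" for e using y by (auto simp: Y_def intro!: polys_prod polys_power)
  have keysY: "Poly_Mapping.keys (Y e) \<subseteq> J" if "e \<in> I" for e
  proof
    fix t assume t: "t \<in> Poly_Mapping.keys (Y e)"
    have "exponents_le (\<Sum>i<m. e i * D) (Y e)"
      unfolding Y_def using D by (intro exponents_le_prod exponents_le_power) auto
    moreover have "(\<Sum>i<m. e i * D) \<le> (\<Sum>i<m. N * D)"
      using that by (intro sum_mono mult_right_mono) (auto simp: I_def PiE_def Pi_def)
    ultimately have "exponents_le (m * (N * D)) (Y e)" by (auto intro: exponents_le_mono)
    then show "t \<in> J" using t Y[of e] by (auto simp: J_def exponents_le_def polys_def)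
  qed
  have zero: "(\<Sum>e\<in>I. Const (c e) * Y e) = 0"
  proof (rule poly_mapping_eqI)
    fix t
    show "Poly_Mapping.lookup (\<Sum>e\<in>I. Const (c e) * Y e) t = Poly_Mapping.lookup 0 t"
    proof (cases "t \<in> J")
      case True
      have "(\<Sum>e\<in>I. c e * Poly_Mapping.lookup (Y e) t) = (\<Sum>e\<in>I. Poly_Mapping.lookup (Y e) t * c e)"
        by (intro sum.cong) (simp_all add: mult.commute)
      then show ?thesis using c(2) True by (simp add: lookup_sum lookup_Const_mult)
    next
      case False
      then have "Poly_Mapping.lookup (Y e) t = 0" if "e \<in> I" for e
        using keysY[OF that] by (meson in_keys_iff subsetD)
      then show ?thesis by (simp add: lookup_sum lookup_Const_mult)
    qed
  qed
  define mon where "mon e = (\<Sum>i<m. Poly_Mapping.single i (e i))" for e :: "nat \<Rightarrow> nat"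
  have lookup_mon: "Poly_Mapping.lookup (mon e) i = (if i < m then e i else 0)" for e i
  proof -
    have "Poly_Mapping.lookup (mon e) i = (\<Sum>j<m. if j = i then e j else 0)"
      unfolding mon_def by (simp add: lookup_sum lookup_single when_def)
    then show ?thesis by simp
  qed
  have keys_mon: "Poly_Mapping.keys (mon e) \<subseteq> {..<m}" for e
    by (auto simp: in_keys_iff lookup_mon split: if_splits)
  have mon_inj: "e = e'" if "e \<in> I" "e' \<in> I" "mon e = mon e'" for e e'
  proof (rule PiE_ext[of _ "{..<m}" "\<lambda>_. {..N}"])
    show "e i = e' i" if "i \<in> {..<m}" for i
      using arg_cong[OF \<open>mon e = mon e'\<close>, of "\<lambda>t. Poly_Mapping.lookup t i"] that by (simp add: lookup_mon)
  qed (use that in \<open>auto simp: I_def\<close>)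
  define f where "f = (\<Sum>e\<in>I. Poly_Mapping.single (mon e) (c e))"
  have "f \<in> polys m" unfolding f_def using keys_mon by (intro polys_sum polys_single) auto
  moreover have "f \<noteq> 0"
  proof -
    obtain e where e: "e \<in> I" "c e \<noteq> 0" using c(1) by blast
    have "Poly_Mapping.lookup f (mon e) = (\<Sum>e'\<in>I. if e' = e then c e' else 0)"
      unfolding f_def lookup_sum
      by (intro sum.cong) (use mon_inj e in \<open>auto simp: lookup_single when_def\<close>)
    also have "\<dots> = c e" using e I by simp
    finally show ?thesis using e(2) by auto
  qed
  moreover have "ev (\<lambda>i. ev x (y i)) f = 0" for x
  proof -
    have "monom_ev (\<lambda>i. ev x (y i)) (mon e) = ev x (Y e)" for e
      by (subst monom_ev_superset[OF _ keys_mon]) (auto simp: Y_def lookup_mon)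
    then have "ev (\<lambda>i. ev x (y i)) f = ev x (\<Sum>e\<in>I. Const (c e) * Y e)"
      by (simp add: f_def ev_single)
    then show ?thesis by (simp add: zero)
  qed
  ultimately show ?thesis by blast
qed

text \<open>A nonzero polynomial cannot relate elements that are picked from the steps of a chain of
  primes: the part of lowest order in the last element would be a relation for the shorter
  chain.\<close>

lemma no_relation_along_chain:
  assumes A: "subring_set A" "A \<subseteq> polys n" "\<And>c. Const c \<in> A"
    and "f \<in> polys m" "f \<noteq> 0"
    and "\<And>i. i \<le> m \<Longrightarrow> prime_in A (R i)" "\<And>i. i < m \<Longrightarrow> R (Suc i) \<subseteq> R i"
    and "\<And>i. i < m \<Longrightarrow> y i \<in> R i - R (Suc i)"
  shows "poly_subst y f \<notin> R m"
  using assms(4-)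
proof (induction m arbitrary: f)
  case 0
  then obtain c where c: "f = Const c" "c \<noteq> 0" using polys_0 by fastforce
  have sub: "poly_subst y f = Const c"
    using c by (auto simp: poly_subst_def Const_def)
  show ?case
  proof
    assume "poly_subst y f \<in> R 0"
    then have "Const (1 / c) * Const c \<in> R 0"
      using 0(3)[of 0] A(3) unfolding sub by (auto simp: prime_in_def intro!: ideal_inD(4)[of A])
    then show False using c(2) 0(3)[of 0] by (simp add: prime_in_def flip: Const_mult)
  qed
next
  case (Suc m)
  obtain p where p: "\<And>i. Polynomial.coeff p i \<in> polys m" "f = poly p (Var m)"
    using Suc.prems(1) by (auto simp: polys_Suc poly_adjoin_def)
  have p0: "p \<noteq> 0" using p(2) Suc.prems(2) by auto
  have yA: "y i \<in> A" if "i < Suc m" for i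
    using Suc.prems(3)[of i] Suc.prems(5)[OF that] that by (auto simp: prime_in_def ideal_in_def)
  have substA: "poly_subst y g \<in> A" if "g \<in> polys m" for g
    using yA that by (intro poly_subst_in_subring[OF A(1,3)]) auto
  have substA': "poly_subst y g \<in> A" if "g \<in> polys (Suc m)" for g
    using yA that by (rule poly_subst_in_subring[OF A(1,3)])
  define q where "q = map_poly (poly_subst y) p"
  have subst0: "poly_subst y 0 = 0" by (simp add: poly_subst_def)
  have cq: "Polynomial.coeff q i = poly_subst y (Polynomial.coeff p i)" for i
    by (simp add: q_def coeff_map_poly subst0)
  have cqA: "Polynomial.coeff q i \<in> A" for i using substA p(1) by (simp add: cq)
  have fq: "poly_subst y f = poly q (y m)"
  proof (rule polys_eqI[where n = n])
    show "poly_subst y f \<in> polys n" using substA'[OF Suc.prems(1)] A(2) by blast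
    show "poly q (y m) \<in> polys n"
      unfolding poly_altdef using cqA yA[of m] A(2) by (intro polys_sum polys_mult polys_power) auto
    fix x
    have dq: "Polynomial.degree q \<le> Polynomial.degree p"
      by (intro degree_le) (auto simp: cq Polynomial.coeff_eq_0 subst0)
    have "poly q (y m) = (\<Sum>i\<le>Polynomial.degree p. Polynomial.coeff q i * y m ^ i)"
      by (rule poly_altdef_le[OF dq])
    then show "ev x (poly_subst y f) = ev x (poly q (y m))"
      by (simp add: ev_poly_subst p(2) ev_poly cq)
  qed
  define k where "k = (LEAST i. Polynomial.coeff p i \<noteq> 0)"
  have "\<exists>i. Polynomial.coeff p i \<noteq> 0"
    using p0 by (intro exI[of _ "Polynomial.degree p"]) simp
  then have ck: "Polynomial.coeff p k \<noteq> 0" unfolding k_def by (rule LeastI_ex)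
  have "Polynomial.coeff p i = 0" if "i < k" for i using not_less_Least[of i] that unfolding k_def by blast
  then have "Polynomial.monom 1 k dvd q" by (auto simp: monom_1_dvd_iff' cq subst0)
  then obtain r where r: "q = Polynomial.monom 1 k * r" by (auto elim: dvdE)
  have cr: "Polynomial.coeff r i = Polynomial.coeff q (k + i)" for i
    by (simp add: r Polynomial.coeff_monom_mult)
  obtain r0 r' where rr: "r = pCons r0 r'" by (cases r) auto
  have r0: "r0 = poly_subst y (Polynomial.coeff p k)" using cr[of 0] by (simp add: rr cq)
  have r': "poly r' (y m) \<in> A"
  proof -
    have "Polynomial.coeff r' i \<in> A" for i using cr[of "Suc i"] cqA by (simp add: rr)
    then show ?thesis
      unfolding poly_altdef using yA[of m]
      by (intro subring_set_sum[OF A(1)] subring_setD(5)[OF A(1)] subring_setD(7)[OF A(1)]) auto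
  qed
  have ym: "y m \<in> R m" "y m \<notin> R (Suc m)" using Suc.prems(5)[of m] by auto
  note prime = Suc.prems(3)[of "Suc m", simplified]
  have Rm: "ideal_in A (R m)" using Suc.prems(3)[of m] by (simp add: prime_in_def)
  have r0A: "r0 \<in> A" using substA p(1) by (simp add: r0)
  have poly_r: "poly r (y m) = r0 + poly r' (y m) * y m" by (simp add: rr mult.commute)
  have poly_rA: "poly r (y m) \<in> A"
    unfolding poly_r using r0A r' yA[of m] by (auto intro!: subring_setD(4,5)[OF A(1)])
  show ?case
  proof
    assume "poly_subst y f \<in> R (Suc m)"
    then have in_R: "y m ^ k * poly r (y m) \<in> R (Suc m)" by (simp add: fq r poly_monom)
    have "y m ^ j \<notin> R (Suc m)" for j
    proof (induction j)
      case 0 show ?case using prime by (simp add: prime_in_def)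
    next
      case (Suc j)
      then show ?case
        using prime ym(2) yA[of m] subring_setD(7)[OF A(1), of "y m" j] by (auto simp: prime_in_def)
    qed
    then have "poly r (y m) \<in> R (Suc m)"
      using in_R prime poly_rA yA[of m] subring_setD(7)[OF A(1), of "y m" k] by (auto simp: prime_in_def)
    then have "poly r (y m) \<in> R m" using Suc.prems(4)[of m] by auto
    moreover have "poly r' (y m) * y m \<in> R m" using ideal_inD(4)[OF Rm r' ym(1)] .
    ultimately have "poly r (y m) - poly r' (y m) * y m \<in> R m" by (rule ideal_in_diff[OF A(1) Rm])
    then have "r0 \<in> R m" by (simp add: poly_r)
    moreover have "poly_subst y (Polynomial.coeff p k) \<notin> R m"
      using Suc.prems(3-5) by (intro Suc.IH p(1) ck) auto
    ultimately show False by (simp add: r0)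
  qed
qed

text \<open>Elements \<open>y i\<close> that distinguish the members of a chain would be algebraically independent.\<close>

lemma prime_chain_length_le:
  assumes A: "subring_set A" "A \<subseteq> polys n" "\<And>c. Const c \<in> A"
    and Q: "\<And>i. i \<le> k \<Longrightarrow> prime_in A (Q i)" "\<And>i. i < k \<Longrightarrow> Q i \<subset> Q (Suc i)"
  shows "k \<le> n"
proof (rule ccontr)
  assume "\<not> k \<le> n"
  define R where "R i = Q (k - i)" for i
  have step: "R (Suc i) \<subset> R i" if "i < k" for i
    using Q(2)[of "k - Suc i"] that by (simp add: R_def Suc_diff_Suc)
  then have "\<forall>i\<in>{..<k}. \<exists>y. y \<in> R i - R (Suc i)" by blast
  then obtain y where y: "\<And>i. i < k \<Longrightarrow> y i \<in> R i - R (Suc i)" by (auto dest!: bchoice)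
  have R: "prime_in A (R i)" for i using Q(1) by (simp add: R_def)
  have yn: "y i \<in> polys n" if "i < k" for i
    using y[OF that] R[of i] A(2) by (auto simp: prime_in_def ideal_in_def)
  obtain f where f: "f \<in> polys k" "f \<noteq> 0" "\<forall>x. ev (\<lambda>i. ev x (y i)) f = 0"
    using algebraic_dependence[of k y n] yn \<open>\<not> k \<le> n\<close> by auto
  have "poly_subst y f \<in> polys n"
    using yn f(1) by (intro poly_subst_in_subring[OF subring_set_polys]) auto
  then have "poly_subst y f = 0" using f(3) by (intro polys_eq_0I) (auto simp: ev_poly_subst)
  moreover have "poly_subst y f \<notin> R k"
    using step y R by (intro no_relation_along_chain[OF A f(1,2)]) auto
  ultimately show False using R[of k] by (auto simp: prime_in_def ideal_in_def)
qed

section \<open>Regular points of the quotient\<close>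

lemma det_in_subring:
  assumes B: "subring_set B" and M: "M \<in> carrier_mat k k" "\<And>i j. i < k \<Longrightarrow> j < k \<Longrightarrow> M $$ (i, j) \<in> B"
  shows "Determinant.det M \<in> B"
proof -
  have "signof p \<in> B" for p :: "nat \<Rightarrow> nat"
    using subring_setD(2,3)[OF B] by (auto simp: sign_def)
  then show ?thesis
    unfolding det_def'[OF M(1)] using M(2)
    by (intro subring_set_sum[OF B] subring_setD(5)[OF B] subring_set_prod[OF B])
       (auto dest: permutes_in_image)
qed

context linear_action
begin

lemma act_one_coord: "i < n \<Longrightarrow> act \<one>\<^bsub>G\<^esub> x i = x i"
  by (auto simp: act_def tau_one if_distrib[of "\<lambda>a. a * _"] sum.delta cong: if_cong)

subsection \<open>Dimension\<close>

definition vanishing :: "(nat \<Rightarrow> complex) \<Rightarrow> cpoly set"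
  where "vanishing w = {f \<in> A. ev w f = 0}"

lemma prime_vanishing: "prime_in A (vanishing w)"
  unfolding prime_in_def ideal_in_def vanishing_def
  by (auto intro: subring_setD[OF subring_A])

lemma localization_vanishing: "localization A (vanishing w)"
  using subring_A prime_vanishing by (simp add: localization_def)

text \<open>The functions that vanish on the affine subspace through \<open>w\<close> on which the first \<open>i\<close> coordinates
  agree with those of \<open>w\<close>.  For \<open>i = 0, \<dots>, n\<close> these ideals form a strict chain of primes that starts
  with the zero ideal and ends with the ideal of \<open>w\<close>.\<close>

definition flag :: "(nat \<Rightarrow> complex) \<Rightarrow> nat \<Rightarrow> cpoly set"
  where "flag w i = {f \<in> polys n. \<forall>x. (\<forall>j<i. x j = w j) \<longrightarrow> ev x f = 0}"

text \<open>If \<open>a\<close> does not vanish at \<open>x\<close> and \<open>b\<close> does not vanish at \<open>y\<close>, then their product does not vanish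
  identically on the line through \<open>x\<close> and \<open>y\<close>.\<close>

lemma prime_flag: "prime_in (polys n) (flag w i)"
  unfolding prime_in_def
proof (intro conjI ballI impI)
  show "ideal_in (polys n) (flag w i)" by (auto simp: ideal_in_def flag_def)
  have "ev w 1 \<noteq> 0" by simp
  then show "1 \<notin> flag w i" unfolding flag_def by blast
  fix a b assume ab: "a \<in> polys n" "b \<in> polys n" "a * b \<in> flag w i"
  show "a \<in> flag w i \<or> b \<in> flag w i"
  proof (rule ccontr)
    assume "\<not> ?thesis"
    then obtain x y where xy: "\<forall>j<i. x j = w j" "ev x a \<noteq> 0" "\<forall>j<i. y j = w j" "ev y b \<noteq> 0"
      using ab by (auto simp: flag_def)
    let ?l = "\<lambda>s j. x j + s * (y j - x j)"
    obtain p q where pq: "\<forall>s. ev (?l s) a = poly p s" "\<forall>s. ev (?l s) b = poly q s"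
      using ev_line[OF ab(1), of x "\<lambda>j. y j - x j"] ev_line[OF ab(2), of x "\<lambda>j. y j - x j"] by blast
    have "poly p 0 = ev x a" using pq(1)[rule_format, of 0] by simp
    moreover have "poly q 1 = ev y b" using pq(2)[rule_format, of 1] by simp
    ultimately have "p * q \<noteq> 0" using xy by auto
    then obtain s where "poly (p * q) s \<noteq> 0" using poly_all_0_iff_0 by blast
    moreover have "ev (?l s) (a * b) = 0" using ab(3) xy by (auto simp: flag_def)
    ultimately show False using pq by simp
  qed
qed

text \<open>Incomparability for the integral extension of the invariants by the polynomials: consecutive
  members of the flag have distinct intersections with the invariants.  Otherwise the constant
  coefficient of an integral equation for \<open>b\<close> modulo the smaller prime, which lies in the larger prime,
  would lie in the smaller one too, and the equation could be divided by \<open>b\<close> until it reads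
  \<open>1 = 0\<close>.\<close>

lemma flag_strict:
  assumes i: "i < n" shows "\<exists>f\<in>A. f \<in> flag w (Suc i) \<and> f \<notin> flag w i"
proof (rule ccontr)
  assume neg: "\<not> ?thesis"
  define b where "b = Var i - Const (w i)"
  have b: "b \<in> polys n" "b \<in> flag w (Suc i)" using i by (auto simp: b_def flag_def)
  have "ev (w(i := w i + 1)) b = 1" by (simp add: b_def)
  moreover have "\<forall>j<i. (w(i := w i + 1)) j = w j" by simp
  ultimately have nb: "b \<notin> flag w i" unfolding flag_def by fastforce
  have F: "ideal_in (polys n) (flag w j)" for j using prime_flag by (simp add: prime_in_def)
  have "False" if "\<forall>j. Polynomial.coeff P j \<in> A" "lead_coeff P = 1" "poly P b \<in> flag w i" for P
    using that
  proof (induction "Polynomial.degree P" arbitrary: P)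
    case 0
    then have "P = 1" by (metis degree_0_id one_pCons)
    then show False using 0 prime_flag[of w i] by (simp add: prime_in_def)
  next
    case (Suc k)
    obtain c Q where P: "P = pCons c Q" by (cases P) auto
    have Q0: "Q \<noteq> 0" using Suc.hyps(2) P by auto
    have QA: "\<forall>j. Polynomial.coeff Q j \<in> A" using Suc.prems(1) P by (metis coeff_pCons_Suc)
    have cA: "c \<in> A" using Suc.prems(1) P by (metis coeff_pCons_0)
    have Qb: "poly Q b \<in> polys n"
      unfolding poly_altdef using QA b(1) A_polys by (intro polys_sum polys_mult polys_power) auto
    have Pb: "poly P b = c + poly Q b * b" by (simp add: P mult.commute)
    have "poly Q b * b \<in> flag w (Suc i)" using ideal_inD(4)[OF F Qb b(2)] .
    moreover have "poly P b \<in> flag w (Suc i)" using Suc.prems(3) by (auto simp: flag_def)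
    ultimately have "poly P b - poly Q b * b \<in> flag w (Suc i)"
      by (intro ideal_in_diff[OF subring_set_polys F])
    then have "c \<in> flag w (Suc i)" by (simp add: Pb)
    then have "c \<in> flag w i" using neg cA by blast
    then have "poly P b - c \<in> flag w i" using Suc.prems(3) by (intro ideal_in_diff[OF subring_set_polys F])
    then have "poly Q b * b \<in> flag w i" by (simp add: Pb)
    then have "poly Q b \<in> flag w i" using prime_flag[of w i] Qb b(1) nb by (auto simp: prime_in_def)
    moreover have "lead_coeff Q = 1" "Polynomial.degree Q = k" using Suc.prems(2) Suc.hyps(2) P Q0 by auto
    ultimately show False using Suc.hyps(1)[of Q] QA by auto
  qed
  moreover obtain P where "\<forall>j. Polynomial.coeff P j \<in> A" "lead_coeff P = 1" "poly P b = 0"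
    using integral_over_A[OF b(1)] by blast
  ultimately show False using ideal_inD(2)[OF F] by metis
qed

lemma krull_dim_local_ring: "krull_dim (ring_on (localization.L A (vanishing w))) = enat n"
proof -
  interpret loc: localization A "vanishing w" by (rule localization_vanishing)
  show ?thesis
  proof (rule loc.krull_dim_eqI[where R = "\<lambda>i. A \<inter> flag w i"])
    show "k \<le> n" if "\<And>i. i \<le> k \<Longrightarrow> prime_in A (Q i)" "\<And>i. i < k \<Longrightarrow> Q i \<subset> Q (Suc i)" for k Q
    proof (rule prime_chain_length_le[OF subring_A, where Q = Q])
      show "A \<subseteq> polys n" using A_polys by blast
    qed (simp_all add: that)
    show "prime_in A (A \<inter> flag w i)" if "i \<le> n" for i
      using prime_flag[of w i] A_polys subring_setD[OF subring_A]
      by (auto simp: prime_in_def ideal_in_def)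
    show "A \<inter> flag w i \<subseteq> vanishing w" if "i \<le> n" for i
      by (auto simp: flag_def vanishing_def)
    show "A \<inter> flag w i \<subset> A \<inter> flag w (Suc i)" if "i < n" for i
    proof -
      have "flag w i \<subseteq> flag w (Suc i)" by (auto simp: flag_def)
      then show ?thesis using flag_strict[OF that, of w] by blast
    qed
  qed
qed

lemma regular_at_iff:
  "regular_local_ring (local_ring_at A (vanishing w)) \<longleftrightarrow>
    (\<exists>S\<subseteq>localization.L A (vanishing w). finite S \<and>
      span_in (localization.L A (vanishing w)) S = localization.extension A (vanishing w) (vanishing w) \<and>
      card S = n)"
  using localization.regular_iff[OF localization_vanishing noeth_A] krull_dim_local_ring by simp


subsection \<open>Free points are regular\<close>

definition free_at :: "(nat \<Rightarrow> complex) \<Rightarrow> bool"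
  where "free_at w \<longleftrightarrow> (\<forall>g\<in>carrier G. act g w = w \<longrightarrow> g = \<one>\<^bsub>G\<^esub>)"

lemma differential_orbit_sum:
  assumes f: "f \<in> polys n"
  shows "differential n (orbit_sum f) x y = (\<Sum>g\<in>carrier G. differential n f (act g x) (act g y))"
proof (rule differential_unique)
  show "orbit_sum f \<in> polys n" using orbit_sum_A[OF f] by (rule A_polys)
  have "(\<lambda>s. ev (\<lambda>i. x i + s * y i) (orbit_sum f))
      = (\<lambda>s. \<Sum>g\<in>carrier G. ev (\<lambda>i. act g x i + s * act g y i) f)"
    by (simp add: ev_orbit_sum[OF f] act_line)
  then show "((\<lambda>s. ev (\<lambda>i. x i + s * y i) (orbit_sum f)) has_field_derivative
      (\<Sum>g\<in>carrier G. differential n f (act g x) (act g y))) (at 0)"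
    using differential[OF f] by (simp add: DERIV_sum)
qed

lemma differential_invariant:
  assumes f: "f \<in> A" and g: "g \<in> carrier G"
  shows "differential n f (act g x) (act g y) = differential n f x y"
proof -
  have "ev (\<lambda>i. act g x i + s * act g y i) f = ev (\<lambda>i. x i + s * y i) f" for s
    using ev_act_A[OF f g, of "\<lambda>i. x i + s * y i"] by (simp add: act_line)
  then have "((\<lambda>s. ev (\<lambda>i. x i + s * y i) f) has_field_derivative differential n f (act g x) (act g y)) (at 0)"
    using differential[OF A_polys[OF f], of "act g x" "act g y"] by simp
  from differential_unique[OF A_polys[OF f] this] show ?thesis by simp
qed

lemma bump:
  assumes w: "w \<in> pts" "free_at w"
  shows "\<exists>h\<in>polys n. ev w h = 1 \<and> (\<forall>g\<in>carrier G - {\<one>\<^bsub>G\<^esub>}. ev (act g w) h = 0)"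
proof -
  have "\<exists>l\<in>polys n. ev (act g w) l = 0 \<and> ev w l \<noteq> 0" if "g \<in> carrier G - {\<one>\<^bsub>G\<^esub>}" for g
    using separating_linear_form[of "{()}" "\<lambda>_. w" "act g w"] w that by (auto simp: free_at_def)
  then have "\<forall>g\<in>carrier G - {\<one>\<^bsub>G\<^esub>}. \<exists>l. l \<in> polys n \<and> ev (act g w) l = 0 \<and> ev w l \<noteq> 0" by blast
  then obtain l where l: "\<forall>g\<in>carrier G - {\<one>\<^bsub>G\<^esub>}. l g \<in> polys n \<and> ev (act g w) (l g) = 0 \<and> ev w (l g) \<noteq> 0"
    by (rule bchoice[THEN exE])
  define h where "h = (\<Prod>g\<in>carrier G - {\<one>\<^bsub>G\<^esub>}. l g)"
  have "h \<in> polys n" using l by (auto simp: h_def intro!: polys_prod)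
  moreover have "ev w h \<noteq> 0" using l finite_G by (auto simp: h_def)
  moreover have "ev (act g w) h = 0" if "g \<in> carrier G - {\<one>\<^bsub>G\<^esub>}" for g
    using l that finite_G by (auto simp: h_def)
  ultimately show ?thesis
    by (intro bexI[of _ "Const (1 / ev w h) * h"]) auto
qed

text \<open>At a point \<open>w\<close> with trivial stabilizer the quotient has the expected coordinates: multiply the
  coordinate functions \<open>X i\<close> centred at \<open>w\<close> by the square \<open>H\<close> of a function that is 1 at \<open>w\<close> and 0 at
  the rest of the orbit, and average.  The square makes the differentials at the rest of the orbit
  vanish, so the average \<open>f i\<close> has the same differential at \<open>w\<close> as \<open>X i\<close>.

  The matrix that expresses the \<open>f i\<close> in terms of the \<open>X i\<close> is therefore the identity at \<open>w\<close>.  By its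
  adjugate, its determinant \<open>D\<close> times \<open>X i\<close> is a combination of the \<open>f i\<close>.  So for an invariant
  \<open>p\<close> that vanishes at \<open>w\<close>, the product \<open>D * p\<close> is one too, and averaging \<open>H * D * p\<close> makes the
  coefficients invariant, while the factor in front of \<open>p\<close> still has the value 1 at \<open>w\<close>.\<close>

lemma local_coordinates:
  assumes w: "w \<in> pts" "free_at w"
  shows "\<exists>f. (\<forall>i<n. f i \<in> vanishing w) \<and> (\<forall>i<n. \<forall>y. differential n (f i) w y = y i) \<and>
    (\<forall>p\<in>vanishing w. \<exists>s\<in>A - vanishing w. \<exists>c. (\<forall>i. c i \<in> A) \<and> s * p = (\<Sum>i<n. c i * f i))"
proof -
  obtain h where h: "h \<in> polys n" "ev w h = 1" "\<And>g. g \<in> carrier G - {\<one>\<^bsub>G\<^esub>} \<Longrightarrow> ev (act g w) h = 0"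
    using bump[OF w] by blast
  define X where "X i = Var i - Const (w i)" for i
  define H where "H = h * h"
  define f where "f i = orbit_sum (X i * H)" for i
  have X: "X i \<in> polys n" if "i < n" for i using that by (simp add: X_def)
  have H: "H \<in> polys n" using h(1) by (simp add: H_def)
  have split: "(\<Sum>g\<in>carrier G. F g) = F \<one>\<^bsub>G\<^esub> + (\<Sum>g\<in>carrier G - {\<one>\<^bsub>G\<^esub>}. F g)" for F :: "'g \<Rightarrow> complex"
    using finite_G by (simp add: sum.remove)
  have sum_at_w: "ev w (orbit_sum (k * H)) = ev w k" if k: "k \<in> polys n" for k
    unfolding ev_orbit_sum[OF polys_mult[OF k H]] split
    by (simp add: h(3) H_def act_one[OF w(1)] h(2))
  have fA: "f i \<in> vanishing w" if "i < n" for i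
    using orbit_sum_A[OF polys_mult[OF X[OF that] H]] sum_at_w[OF X[OF that]]
    by (simp add: vanishing_def f_def) (simp add: X_def)
  have df: "differential n (f i) w y = y i" if i: "i < n" for i y
  proof -
    have dX: "differential n (X i) x y = y i" for x y
      using i by (simp add: X_def differential_diff)
    have "differential n (f i) w y =
        (\<Sum>g\<in>carrier G. act g y i * ev (act g w) H + ev (act g w) (X i) * differential n H (act g w) (act g y))"
      using X[OF i] H by (simp add: f_def differential_orbit_sum differential_mult dX)
    also have "\<dots> = y i"
      unfolding split using i h(1)
      by (simp add: H_def differential_mult h(2,3) act_one[OF w(1)] act_one_coord X_def)
    finally show ?thesis .
  qed
  have "\<exists>a. (\<forall>j. a j \<in> polys n) \<and> f i = (\<Sum>j<n. a j * X j)" if "i < n" for i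
    using taylor_first_order[of "f i" n w] fA[OF that] A_polys by (auto simp: vanishing_def X_def)
  then have "\<forall>i\<in>{..<n}. \<exists>a. (\<forall>j. a j \<in> polys n) \<and> f i = (\<Sum>j<n. a j * X j)" by blast
  then obtain a where a: "\<forall>i\<in>{..<n}. (\<forall>j. a i j \<in> polys n) \<and> f i = (\<Sum>j<n. a i j * X j)"
    by (rule bchoice[THEN exE])
  have a_w: "ev w (a i j) = (if i = j then 1 else 0)" if "i < n" "j < n" for i j
  proof -
    define y where "y k = (if k = j then 1 else (0::complex))" for k
    have *: "differential n (a i k * X k) w y = ev w (a i k) * y k" if "k < n" for k
    proof -
      have "differential n (X k) w y = y k" using that by (simp add: X_def differential_diff)
      moreover have "ev w (X k) = 0" by (simp add: X_def)
      ultimately show ?thesis using a \<open>i < n\<close> X[OF that] by (simp add: differential_mult)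
    qed
    have "differential n (f i) w y = (\<Sum>k<n. ev w (a i k) * y k)"
    proof -
      have "a i k * X k \<in> polys n" if "k < n" for k using a \<open>i < n\<close> X[OF that] by (intro polys_mult) auto
      then have "differential n (\<Sum>k<n. a i k * X k) w y = (\<Sum>k<n. differential n (a i k * X k) w y)"
        by (intro differential_sum) auto
      moreover have "f i = (\<Sum>k<n. a i k * X k)" using a \<open>i < n\<close> by blast
      ultimately show ?thesis using * by simp
    qed
    also have "\<dots> = (\<Sum>k<n. if k = j then ev w (a i k) else 0)" by (intro sum.cong) (auto simp: y_def)
    also have "\<dots> = ev w (a i j)" using \<open>j < n\<close> by simp
    finally show ?thesis using df[OF \<open>i < n\<close>, of y] by (simp add: y_def)
  qed
  define M where "M = mat n n (\<lambda>(i, j). a i j)"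
  define D where "D = Determinant.det M"
  define N where "N = adj_mat M"
  have M: "M \<in> carrier_mat n n" by (simp add: M_def)
  have D: "D \<in> polys n"
    unfolding D_def using a by (intro det_in_subring[OF subring_set_polys M]) (auto simp: M_def)
  have N: "N \<in> carrier_mat n n" "N * M = D \<cdot>\<^sub>m 1\<^sub>m n"
    using adj_mat[OF M] by (auto simp: N_def D_def)
  have N_polys: "N $$ (i, j) \<in> polys n" if "i < n" "j < n" for i j
  proof -
    have "mat_delete M j i \<in> carrier_mat (n - 1) (n - 1)" using mat_delete_carrier[OF M] .
    moreover have "mat_delete M j i $$ (k, l) \<in> polys n" if "k < n - 1" "l < n - 1" for k l
      using that a by (auto simp: mat_delete_def M_def)
    ultimately have "Determinant.det (mat_delete M j i) \<in> polys n"
      by (intro det_in_subring[OF subring_set_polys])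
    then show ?thesis using that M by (auto simp: N_def adj_mat_def cofactor_def)
  qed
  have "ev w D = Determinant.det (map_mat (ev w) M)"
    unfolding D_def using comm_ring_hom.hom_det[OF ev_hom] by metis
  also have "map_mat (ev w) M = 1\<^sub>m n" by (rule eq_matI) (auto simp: M_def a_w)
  finally have D_w: "ev w D = 1" by simp
  have DX: "D * X j = (\<Sum>i<n. N $$ (j, i) * f i)" if j: "j < n" for j
  proof -
    have "(\<Sum>i<n. N $$ (j, i) * f i) = (\<Sum>i<n. \<Sum>k<n. N $$ (j, i) * a i k * X k)"
      using a by (intro sum.cong) (auto simp: sum_distrib_left mult.assoc)
    also have "\<dots> = (\<Sum>k<n. (\<Sum>i<n. N $$ (j, i) * a i k) * X k)"
      by (subst sum.swap) (simp add: sum_distrib_right)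
    also have "\<dots> = (\<Sum>k<n. (N * M) $$ (j, k) * X k)"
      using j N(1) by (intro sum.cong) (auto simp: scalar_prod_def M_def atLeast0LessThan)
    also have "\<dots> = (\<Sum>k<n. if k = j then D * X k else 0)"
      unfolding N(2) using j by (intro sum.cong) auto
    also have "\<dots> = D * X j" using j by simp
    finally show ?thesis by simp
  qed
  have "\<exists>s\<in>A - vanishing w. \<exists>c. (\<forall>i. c i \<in> A) \<and> s * p = (\<Sum>i<n. c i * f i)" if p: "p \<in> vanishing w" for p
  proof -
    have pA: "p \<in> A" using p by (simp add: vanishing_def)
    obtain q where q: "\<forall>j. q j \<in> polys n" "p = (\<Sum>j<n. q j * X j)"
      using taylor_first_order[OF A_polys[OF pA], of w] p by (auto simp: vanishing_def X_def)
    define b where "b i = (\<Sum>j<n. q j * N $$ (j, i))" for i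
    have b: "b i \<in> polys n" if "i < n" for i
      using q(1) N_polys that by (auto simp: b_def intro!: polys_sum polys_mult)
    have "D * p = (\<Sum>j<n. q j * (D * X j))"
      by (simp add: q(2) sum_distrib_left mult.left_commute)
    also have "\<dots> = (\<Sum>j<n. \<Sum>i<n. q j * N $$ (j, i) * f i)"
      using DX by (intro sum.cong) (auto simp: sum_distrib_left mult.assoc)
    also have "\<dots> = (\<Sum>i<n. b i * f i)"
      by (subst sum.swap) (simp add: b_def sum_distrib_right)
    finally have Dp: "D * p = (\<Sum>i<n. b i * f i)" .
    define s where "s = orbit_sum (D * H)"
    have fA': "f i \<in> A" if "i < n" for i using fA[OF that] by (simp add: vanishing_def)
    have "s * p = orbit_sum (D * H * p)"
      unfolding s_def by (rule orbit_sum_mult[OF pA polys_mult[OF D H], symmetric])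
    also have "D * H * p = H * (D * p)" by (simp only: mult_ac)
    also have "H * (D * p) = (\<Sum>i<n. (H * b i) * f i)"
      by (simp only: Dp sum_distrib_left mult.assoc)
    also have "orbit_sum (\<Sum>i<n. (H * b i) * f i) = (\<Sum>i<n. orbit_sum ((H * b i) * f i))"
      using b H fA' A_polys by (intro orbit_sum_sum polys_mult) auto
    also have "\<dots> = (\<Sum>i<n. orbit_sum (H * b i) * f i)"
      using b H fA' by (intro sum.cong orbit_sum_mult polys_mult) auto
    also have "\<dots> = (\<Sum>i<n. (if i < n then orbit_sum (H * b i) else 0) * f i)"
      by (intro sum.cong) auto
    finally have sp: "s * p = (\<Sum>i<n. (if i < n then orbit_sum (H * b i) else 0) * f i)" .
    have cA: "(if i < n then orbit_sum (H * b i) else 0) \<in> A" for i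
      using b H subring_setD(1)[OF subring_A] by (auto intro!: orbit_sum_A polys_mult)
    have "s \<in> A - vanishing w"
      using sum_at_w[OF D] D_w orbit_sum_A[OF polys_mult[OF D H]] by (simp add: s_def vanishing_def)
    then show ?thesis
      by (rule bexI[rotated]) (rule exI[of _ "\<lambda>i. if i < n then orbit_sum (H * b i) else 0"], intro conjI allI cA sp)
  qed
  then show ?thesis by (intro exI[of _ f] conjI allI impI ballI fA df)
qed

theorem free_imp_regular:
  assumes w: "w \<in> pts" "free_at w"
  shows "regular_local_ring (local_ring_at A (vanishing w))"
proof -
  interpret loc: localization A "vanishing w" by (rule localization_vanishing)
  obtain f where f: "\<And>i. i < n \<Longrightarrow> f i \<in> vanishing w" "\<And>i y. i < n \<Longrightarrow> differential n (f i) w y = y i"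
    "\<And>p. p \<in> vanishing w \<Longrightarrow> \<exists>s\<in>A - vanishing w. \<exists>c. (\<forall>i. c i \<in> A) \<and> s * p = (\<Sum>i<n. c i * f i)"
    using local_coordinates[OF w] by blast
  have inj: "inj_on f {..<n}"
  proof (rule inj_onI)
    fix i j assume ij: "i \<in> {..<n}" "j \<in> {..<n}" "f i = f j"
    let ?y = "\<lambda>k. if k = i then 1 else (0::complex)"
    have "?y i = differential n (f i) w ?y" using ij(1) by (intro f(2)[symmetric]) simp
    also have "\<dots> = differential n (f j) w ?y" by (simp only: ij(3))
    also have "\<dots> = ?y j" using ij(2) by (intro f(2)) simp
    finally show "i = j" by (simp split: if_splits)
  qed
  define F where "F = f ` {..<n}"
  have F: "F \<subseteq> vanishing w" "finite F" "card F = n" using f(1) inj by (auto simp: F_def card_image)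
  have "\<exists>s\<in>A - vanishing w. s * p \<in> span_in A F" if p: "p \<in> vanishing w" for p
  proof -
    obtain s c where s: "s \<in> A - vanishing w" "\<forall>i. c i \<in> A" "s * p = (\<Sum>i<n. c i * f i)"
      using f(3)[OF p] by blast
    have "s * p = (\<Sum>g\<in>F. c (the_inv_into {..<n} f g) * g)"
      unfolding F_def sum.reindex[OF inj] s(3) by (intro sum.cong) (auto simp: the_inv_into_f_f[OF inj])
    then have "s * p \<in> span_in A F" using s(2) by (auto simp: span_in_def)
    then show ?thesis using s(1) by blast
  qed
  then have span: "span_in loc.L ((\<lambda>f. Fract f 1) ` F) = loc.extension (vanishing w)"
    by (intro loc.span_eq_maximal F)
  have "inj_on (\<lambda>f. Fract f 1) F" by (rule inj_onI) (simp add: eq_fract)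
  then have "card ((\<lambda>f. Fract f 1) ` F) = n" using F by (simp add: card_image)
  moreover have "(\<lambda>f. Fract f 1) ` F \<subseteq> loc.L"
  proof -
    have "F \<subseteq> A" using F(1) by (auto simp: vanishing_def)
    then show ?thesis using loc.denominators(1) by (auto intro!: loc.Fract_L)
  qed
  ultimately show ?thesis
    unfolding regular_at_iff using span F(2) by (intro exI[of _ "(\<lambda>f. Fract f 1) ` F"]) auto
qed

end

subsection \<open>Regular points are free\<close>

text \<open>The action contains no pseudoreflections: for \<open>g \<noteq> 1\<close> the rank of \<open>g - 1\<close> is at least two.  This is
  expressed by two rows \<open>r, r'\<close> of \<open>g - 1\<close> that are linearly independent as linear forms.\<close>

locale small_linear_action = linear_action +
  assumes no_reflections: "\<And>g. g \<in> carrier G \<Longrightarrow> g \<noteq> \<one>\<^bsub>G\<^esub> \<Longrightarrow>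
    \<exists>r<n. \<exists>r'<n. \<exists>x\<in>pts. \<exists>y\<in>pts.
      (act g x r - x r) * (act g y r' - y r') \<noteq> (act g y r - y r) * (act g x r' - x r')"
begin

lemma ev_displacement:
  assumes "g \<in> carrier G" "r < n"
  shows "ev x (lin_subst (\<tau> g) (Var r) - Var r) = act g x r - x r"
  using assms by (simp add: ev_act)

text \<open>A hypersurface through \<open>v\<close> cannot be contained in the fixed loci near \<open>v\<close>.  On a line through
  \<open>v\<close> on which \<open>J\<close> does not vanish identically, \<open>v\<close> is an isolated zero, so each nearby parallel line
  contains a nearby zero; and a general parallel line misses all fixed loci, because their
  codimension is at least two.\<close>

lemma free_zero_nearby:
  assumes v: "v \<in> pts" "\<not> free_at v" and J: "J \<in> polys n" "ev v J = 0"
    and U: "open U" "v \<in> U"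
  shows "\<exists>x\<in>U \<inter> pts. free_at x \<and> ev x J = 0"
proof -
  let ?H = "carrier G - {\<one>\<^bsub>G\<^esub>}"
  obtain g0 where "g0 \<in> ?H" using v(2) by (auto simp: free_at_def)
  then have "0 < n" using no_reflections[of g0] by auto
  \<comment> \<open>If \<open>J\<close> is zero, any other hypersurface through \<open>v\<close> will do.\<close>
  define J' where "J' = (if J = 0 then Var 0 - Const (v 0) else J)"
  have "Var 0 - Const (v 0) \<noteq> 0"
  proof
    assume "Var 0 - Const (v 0) = 0"
    then have "ev (\<lambda>_. v 0 + 1) (Var 0 - Const (v 0)) = 0" by simp
    then show False by simp
  qed
  then have J': "J' \<in> polys n" "J' \<noteq> 0" "ev v J' = 0" "\<And>x. ev x J' = 0 \<Longrightarrow> ev x J = 0"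
    using J \<open>0 < n\<close> by (auto simp: J'_def split: if_splits)
  have "\<forall>g\<in>?H. \<exists>R. fst R < n \<and> snd R < n \<and> (\<exists>x\<in>pts. \<exists>y\<in>pts.
      (act g x (fst R) - x (fst R)) * (act g y (snd R) - y (snd R))
      \<noteq> (act g y (fst R) - y (fst R)) * (act g x (snd R) - x (snd R)))"
    using no_reflections by fastforce
  then obtain R where R: "\<forall>g\<in>?H. fst (R g) < n \<and> snd (R g) < n \<and> (\<exists>x\<in>pts. \<exists>y\<in>pts.
      (act g x (fst (R g)) - x (fst (R g))) * (act g y (snd (R g)) - y (snd (R g)))
      \<noteq> (act g y (fst (R g)) - y (fst (R g))) * (act g x (snd (R g)) - x (snd (R g))))"
    by (rule bchoice[THEN exE])
  define a where "a g x = act g x (fst (R g)) - x (fst (R g))" for g x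
  define b where "b g x = act g x (snd (R g)) - x (snd (R g))" for g x
  have minor: "\<exists>x\<in>pts. \<exists>y\<in>pts. a g x * b g y \<noteq> a g y * b g x" if "g \<in> ?H" for g
    using R that unfolding a_def b_def by blast
  have lin: "a g (\<lambda>i. x i + s * y i) = a g x + s * a g y" "b g (\<lambda>i. x i + s * y i) = b g x + s * b g y" for g x y s
    by (simp_all add: a_def b_def act_line algebra_simps)
  have fixed: "a g x = 0" "b g x = 0" if "act g x = x" for g x using that by (simp_all add: a_def b_def)
  \<comment> \<open>The lines have a direction \<open>e\<close> in which \<open>J'\<close> is not identically zero at \<open>v\<close> and the second form
    of each \<open>g\<close> is nonzero; it exists because a product of nonzero polynomials is nonzero.\<close>
  have "\<exists>e\<in>pts. ev (\<lambda>i. v i + e i) J' \<noteq> 0 \<and> (\<forall>g\<in>?H. b g e \<noteq> 0)"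
  proof -
    define l where "l g = (let q = lin_subst (\<tau> g) (Var (snd (R g))) - Var (snd (R g)) in q - Const (ev v q))" for g
    have evl: "ev x (l g) = b g x - b g v" if "g \<in> ?H" for g x
      using R that ev_displacement[of g "snd (R g)"] by (simp add: l_def Let_def b_def)
    have l0: "l g \<noteq> 0" if g: "g \<in> ?H" for g
    proof
      assume "l g = 0"
      then have "b g x = b g v" for x using evl[OF g, of x] by simp
      moreover have "b g (\<lambda>_. 0) = 0" by (simp add: b_def act_def)
      ultimately have "b g x = 0" for x by metis
      then show False using minor[OF g] by auto
    qed
    have lp: "l g \<in> polys n" if "g \<in> ?H" for g using R that by (simp add: l_def Let_def)
    define K where "K = J' * (\<Prod>g\<in>?H. l g)"
    have "K \<in> polys n" using J'(1) lp unfolding K_def by (intro polys_mult polys_prod) auto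
    moreover have "K \<noteq> 0" using J'(2) l0 finite_G by (simp add: K_def)
    ultimately obtain x where x: "x \<in> pts" "ev x K \<noteq> 0" using polys_eq_pts[of K 0] by auto
    have "ev x J' \<noteq> 0" "\<forall>g\<in>?H. b g x - b g v \<noteq> 0"
      using x(2) evl finite_G by (auto simp: K_def)
    moreover have "b g (\<lambda>i. x i - v i) = b g x - b g v" for g
      using lin(2)[of g x "-1" v] by (simp add: algebra_simps)
    ultimately show ?thesis
      using x(1) v(1) by (intro bexI[of _ "\<lambda>i. x i - v i"]) (auto simp: pts_def)
  qed
  then obtain e where e: "e \<in> pts" "ev (\<lambda>i. v i + e i) J' \<noteq> 0" "\<And>g. g \<in> ?H \<Longrightarrow> b g e \<noteq> 0" by blast
  \<comment> \<open>A line in direction \<open>e\<close> that meets a fixed locus lies in the kernel of the form \<open>\<mu>\<close>.\<close>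
  define \<mu> where "\<mu> g x = a g x * b g e - b g x * a g e" for g x
  have \<mu>_lin: "\<mu> g (\<lambda>i. x i + s * y i) = \<mu> g x + s * \<mu> g y" for g x y s
    by (simp add: \<mu>_def lin algebra_simps)
  have "\<exists>c\<in>pts. \<forall>g\<in>?H. \<mu> g c \<noteq> 0"
  proof (rule generic_point[where ln = "\<lambda>x t y k. x k + complex_of_real t * y k"])
    fix g assume g: "g \<in> ?H"
    obtain x y where xy: "x \<in> pts" "y \<in> pts" "a g x * b g y \<noteq> a g y * b g x" using minor[OF g] by blast
    show "\<exists>c\<in>pts. \<mu> g c \<noteq> 0"
    proof (rule ccontr)
      assume "\<not> ?thesis"
      then have z: "a g x * b g e = b g x * a g e" "a g y * b g e = b g y * a g e" using xy by (auto simp: \<mu>_def)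
      have "(a g x * b g y) * b g e = b g y * (a g x * b g e)" by (simp add: mult_ac)
      also have "\<dots> = b g x * (b g y * a g e)" by (simp add: z mult_ac)
      also have "\<dots> = b g x * (a g y * b g e)" by (simp add: z)
      also have "\<dots> = (a g y * b g x) * b g e" by (simp add: mult_ac)
      finally show False using xy(3) e(3)[OF g] by simp
    qed
  qed (use finite_G \<mu>_lin in \<open>auto simp: pts_def intro!: exI[of _ "\<lambda>_. 0"]\<close>)
  then obtain c where c: "c \<in> pts" "\<And>g. g \<in> ?H \<Longrightarrow> \<mu> g c \<noteq> 0" by blast
  define pt where "pt = (\<lambda>(\<epsilon>::complex, t::complex) i. (v i + \<epsilon> * c i) + t * e i)"
  define F where "F z = ev (pt z) J'" for z
  have cont_pt: "continuous_on S pt" for S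
    by (rule continuous_on_coordinatewise_then_product)
       (auto simp: pt_def case_prod_unfold intro!: continuous_intros)
  have cont_F: "continuous_on S F" for S
    unfolding F_def by (rule continuous_on_compose2[OF continuous_ev[of UNIV] cont_pt]) auto
  have pt0: "pt (0, 0) = v" by (simp add: pt_def)
  have "open (pt -` U)" using cont_pt[of UNIV] U(1) by (simp add: continuous_on_open_vimage)
  then obtain r0 where r0: "r0 > 0" "ball (0, 0) r0 \<subseteq> pt -` U"
    using U(2) pt0 by (metis open_contains_ball vimage_eq)
  have line: "\<exists>q. \<forall>t. F (\<epsilon>, t) = poly q t" for \<epsilon>
    using ev_line[OF J'(1), of "\<lambda>i. v i + \<epsilon> * c i" e] by (simp add: F_def pt_def)
  obtain q where q: "\<And>t. F (0, t) = poly q t" using line by blast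
  have "F (0, 1) \<noteq> 0" using e(2) by (simp add: F_def pt_def)
  then have "q \<noteq> 0" using q by auto
  then have "finite (cmod ` {t. poly q t = 0})" using poly_roots_finite by blast
  moreover have "infinite {0<..<r0/2}" using r0(1) by (simp add: infinite_Ioo)
  ultimately obtain r where r: "r \<in> {0<..<r0/2}" "r \<notin> cmod ` {t. poly q t = 0}"
    by (meson finite_subset subsetI)
  have sphere: "F (0, t) \<noteq> 0" if "cmod t = r" for t using r(2) that q by auto
  obtain m where m: "m > 0" "\<And>t. cmod t = r \<Longrightarrow> m \<le> cmod (F (0, t))"
  proof -
    have "continuous_on (sphere 0 r) (\<lambda>t. cmod (F (0, t)))"
      using q by (auto intro!: continuous_intros)
    then obtain t0 where "t0 \<in> sphere 0 r" "\<forall>t\<in>sphere 0 r. cmod (F (0, t0)) \<le> cmod (F (0, t))"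
      using continuous_attains_inf[of "sphere 0 r" "\<lambda>t. cmod (F (0, t))"] r(1) by auto
    then show ?thesis using that[of "cmod (F (0, t0))"] sphere by auto
  qed
  have "uniformly_continuous_on (cball 0 1 \<times> cball 0 r) F"
    by (intro compact_uniformly_continuous cont_F compact_Times) auto
  then obtain \<delta> where \<delta>: "\<delta> > 0" "\<And>z z'. z \<in> cball 0 1 \<times> cball 0 r \<Longrightarrow> z' \<in> cball 0 1 \<times> cball 0 r \<Longrightarrow>
      dist z' z < \<delta> \<Longrightarrow> dist (F z') (F z) < m / 2"
    using m(1) unfolding uniformly_continuous_on_def by (meson half_gt_zero)
  \<comment> \<open>The parameter \<open>\<epsilon>\<close> of the parallel line is small, so that the zero persists, and differs from the
    finitely many values for which \<open>\<mu>\<close> vanishes on the line for some \<open>g\<close>.\<close>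
  define bad where "bad = (\<lambda>g. - \<mu> g v / \<mu> g c) ` ?H"
  have "infinite (ball (0::complex) (min (min \<delta> 1) (r0 / 2)))"
    using \<delta>(1) r0(1) by (intro uncountable_infinite uncountable_ball) auto
  moreover have "finite bad" using finite_G by (simp add: bad_def)
  ultimately obtain \<epsilon> where \<epsilon>: "\<epsilon> \<in> ball 0 (min (min \<delta> 1) (r0 / 2))" "\<epsilon> \<notin> bad"
    by (meson finite_subset subsetI)
  have close: "cmod (F (\<epsilon>, t) - F (0, t)) < m / 2" if "cmod t \<le> r" for t
    using \<delta>(2)[of "(0, t)" "(\<epsilon>, t)"] that \<epsilon>(1) by (simp add: dist_Pair_Pair dist_norm)
  obtain p where p: "\<And>t. F (\<epsilon>, t) = poly p t" using line by blast
  obtain t where t: "t \<in> ball 0 r" "F (\<epsilon>, t) = 0"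
  proof (rule holomorphic_contract_to_zero[of 0 r "\<lambda>t. F (\<epsilon>, t)"])
    show "continuous_on (cball 0 r) (\<lambda>t. F (\<epsilon>, t))" "(\<lambda>t. F (\<epsilon>, t)) holomorphic_on ball 0 r"
      unfolding p by (auto intro!: continuous_intros holomorphic_intros)
    show "cmod (F (\<epsilon>, 0)) < cmod (F (\<epsilon>, t))" if "cmod (0 - t) = r" for t
    proof -
      have "F (0, 0) = 0" using J'(3) by (simp add: F_def pt0)
      then have "cmod (F (\<epsilon>, 0)) < m / 2" using close[of 0] r(1) by simp
      moreover have "m \<le> cmod (F (0, t))" "cmod (F (\<epsilon>, t) - F (0, t)) < m / 2"
        using m(2) close[of t] that by auto
      moreover have "cmod (F (0, t)) \<le> cmod (F (\<epsilon>, t)) + cmod (F (\<epsilon>, t) - F (0, t))"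
        by (metis norm_minus_commute norm_triangle_sub)
      ultimately show ?thesis by linarith
    qed
  qed (use r(1) in auto)
  define x where "x = pt (\<epsilon>, t)"
  have "x \<in> pts" using v(1) c(1) e(1) by (auto simp: x_def pt_def pts_def)
  moreover have "x \<in> U"
  proof -
    have "dist (0, 0) (\<epsilon>, t) \<le> cmod \<epsilon> + cmod t"
      by (simp add: dist_Pair_Pair sqrt_sum_squares_le_sum)
    also have "\<dots> < r0" using \<epsilon>(1) t(1) r(1) by auto
    finally show ?thesis using r0(2) by (auto simp: x_def)
  qed
  moreover have "free_at x"
    unfolding free_at_def
  proof (intro ballI impI, rule ccontr)
    fix g assume g: "g \<in> carrier G" "act g x = x" "g \<noteq> \<one>\<^bsub>G\<^esub>"
    have "\<mu> g x = 0" using fixed[OF g(2)] by (simp add: \<mu>_def)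
    moreover have "\<mu> g x = (\<mu> g v + \<epsilon> * \<mu> g c) + t * \<mu> g e"
      by (simp add: x_def pt_def \<mu>_lin)
    moreover have "\<mu> g e = 0" by (simp add: \<mu>_def mult.commute)
    ultimately have "\<mu> g v + \<epsilon> * \<mu> g c = 0" by simp
    then have "\<epsilon> = - \<mu> g v / \<mu> g c" using c(2)[of g] g by (simp add: field_simps add_eq_0_iff)
    then show False using \<epsilon>(2) g by (auto simp: bad_def)
  qed
  moreover have "ev x J = 0" using J'(4) t(2) by (simp add: F_def x_def)
  ultimately show ?thesis by blast
qed

end

context linear_action
begin

text \<open>The differentials of the invariants generate a finite module over the polynomial ring, by the
  Hilbert basis theorem for polynomials that are linear in \<open>n\<close> additional variables.\<close>

lemma finitely_many_differentials:
  "\<exists>H\<subseteq>A. finite H \<and> (\<forall>h\<in>A. \<exists>c. \<forall>x\<in>pts. \<forall>y.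
    differential n h x y = (\<Sum>k\<in>H. ev x (c k) * differential n k x y))"
proof -
  define \<theta> where "\<theta> h = (\<Sum>i<n. partial n h i * Var (n + i))" for h
  have \<theta>: "\<theta> h \<in> polys (n + n)" if "h \<in> A" for h
    unfolding \<theta>_def using A_polys[OF that] polys_mono[of n "n + n"]
    by (intro polys_sum polys_mult polys_Var) auto
  then have "\<theta> ` A \<subseteq> polys (n + n)" by blast
  then obtain S where S: "S \<subseteq> \<theta> ` A" "finite S" "\<theta> ` A \<subseteq> span_in (polys (n + n)) S"
    using noeth_subset[OF subring_set_polys noeth_polys] by meson
  obtain H where H: "H \<subseteq> A" "finite H" "S = \<theta> ` H" "inj_on \<theta> H"
    using S(1,2) by (metis finite_imageD subset_image_inj)
  define ext where "ext x y = (\<lambda>i. if i < n then x i else y (i - n))" for x y :: "nat \<Rightarrow> complex"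
  have ev_\<theta>: "ev (ext x (\<lambda>i. t * y i)) (\<theta> h) = t * differential n h x y" if "h \<in> A" for h x y t
  proof -
    have "ev (ext x (\<lambda>i. t * y i)) (partial n h i) = ev x (partial n h i)" for i
      using A_polys[OF that] by (intro ev_cong[of _ n]) (auto simp: ext_def)
    then show ?thesis
      by (simp add: \<theta>_def differential_def sum_distrib_left ext_def mult_ac)
  qed
  have "\<exists>c. \<forall>x\<in>pts. \<forall>y. differential n h x y = (\<Sum>k\<in>H. ev x (c k) * differential n k x y)"
    if h: "h \<in> A" for h
  proof -
    have "\<theta> h \<in> span_in (polys (n + n)) S" using S(3) h by blast
    then obtain d where d: "\<forall>s\<in>S. d s \<in> polys (n + n)" "\<theta> h = (\<Sum>s\<in>S. d s * s)" by (auto simp: span_in_def)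
    define c where "c k = d (\<theta> k)" for k
    have c: "c k \<in> polys (n + n)" if "k \<in> H" for k using d(1) H(3) that by (simp add: c_def)
    have \<theta>h: "\<theta> h = (\<Sum>k\<in>H. c k * \<theta> k)" unfolding d(2) H(3) sum.reindex[OF H(4)] by (simp add: c_def)
    have "differential n h x y = (\<Sum>k\<in>H. ev x (c k) * differential n k x y)" if x: "x \<in> pts" for x y
    proof -
      let ?z = "\<lambda>t i. ext x (\<lambda>_. 0) i + t * ext (\<lambda>_. 0) y i"
      have z: "?z t = ext x (\<lambda>i. t * y i)" for t by (auto simp: ext_def)
      have "\<forall>k\<in>H. \<exists>q. \<forall>t. ev (?z t) (c k) = poly q t" using ev_line c by blast
      then obtain q where q: "\<forall>k\<in>H. \<forall>t. ev (?z t) (c k) = poly (q k) t" by (rule bchoice[THEN exE])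
      have qk: "ev (ext x (\<lambda>i. t * y i)) (c k) = poly (q k) t" if "k \<in> H" for k t
        using q that unfolding z by blast
      define Q where "Q = (\<Sum>k\<in>H. Polynomial.smult (differential n k x y) (q k)) - [:differential n h x y:]"
      have "poly ([:0, 1:] * Q) t = 0" for t
      proof -
        have "t * differential n h x y = ev (ext x (\<lambda>i. t * y i)) (\<theta> h)" by (simp add: ev_\<theta>[OF h])
        also have "\<dots> = (\<Sum>k\<in>H. ev (ext x (\<lambda>i. t * y i)) (c k) * ev (ext x (\<lambda>i. t * y i)) (\<theta> k))"
          by (simp add: \<theta>h)
        also have "\<dots> = (\<Sum>k\<in>H. poly (q k) t * (t * differential n k x y))"
          using H(1) by (intro sum.cong refl) (simp add: qk ev_\<theta> subset_iff)
        also have "\<dots> = t * (\<Sum>k\<in>H. differential n k x y * poly (q k) t)"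
          by (simp add: sum_distrib_left mult_ac)
        finally show ?thesis by (auto simp: Q_def poly_sum right_diff_distrib)
      qed
      then have "[:0, 1:] * Q = 0" using poly_all_0_iff_0 by blast
      then have "Q = 0" by simp
      then have "poly Q 0 = 0" by simp
      then have "(\<Sum>k\<in>H. differential n k x y * poly (q k) 0) = differential n h x y"
        unfolding Q_def by (simp add: poly_sum)
      moreover have "ext x (\<lambda>i. 0 * y i) = x" using x by (auto simp: ext_def pts_def)
      then have "poly (q k) 0 = ev x (c k)" if "k \<in> H" for k using qk[OF that, of 0] by simp
      ultimately show ?thesis by (simp add: mult.commute)
    qed
    then show ?thesis by blast
  qed
  with H show ?thesis by blast
qed

text \<open>If \<open>n\<close> functions generate the maximal ideal at \<open>v\<close>, then their differentials generate all
  differentials of invariants at every point near \<open>v\<close>.  This is Nakayama's lemma for the module of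
  differentials, in the form of a diagonally dominant linear system.\<close>

lemma generators_control_differentials:
  assumes f: "\<And>j. j < n \<Longrightarrow> f j \<in> vanishing v"
    and gen: "\<And>p. p \<in> vanishing v \<Longrightarrow> \<exists>s\<in>A - vanishing v. \<exists>c. (\<forall>j<n. c j \<in> A) \<and> s * p = (\<Sum>j<n. c j * f j)"
  shows "\<exists>U. open U \<and> v \<in> U \<and> (\<forall>x\<in>U \<inter> pts. \<forall>y. (\<forall>j<n. differential n (f j) x y = 0) \<longrightarrow>
    (\<forall>h\<in>A. differential n h x y = 0))"
proof -
  obtain H where H: "H \<subseteq> A" "finite H" "\<forall>h\<in>A. \<exists>c. \<forall>x\<in>pts. \<forall>y.
      differential n h x y = (\<Sum>k\<in>H. ev x (c k) * differential n k x y)"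
    using finitely_many_differentials by blast
  define k0 where "k0 k = k - Const (ev v k)" for k
  have k0: "k0 k \<in> vanishing v" if "k \<in> H" for k
    using H(1) that subring_setD(6)[OF subring_A, of k "Const (ev v k)"] by (auto simp: vanishing_def k0_def)
  have dk0: "differential n (k0 k) x y = differential n k x y" if "k \<in> H" for k x y
    using H(1) that A_polys by (auto simp: k0_def differential_diff)
  have "\<exists>s \<epsilon>. ev v s \<noteq> 0 \<and> (\<forall>l\<in>H. ev v (\<epsilon> l) = 0) \<and>
      (\<forall>x\<in>pts. \<forall>y. (\<forall>j<n. differential n (f j) x y = 0) \<longrightarrow>
        ev x s * differential n k x y = (\<Sum>l\<in>H. ev x (\<epsilon> l) * differential n l x y))"
    if k: "k \<in> H" for k
  proof -
    obtain s c where sc: "s \<in> A - vanishing v" "\<forall>j<n. c j \<in> A" "s * k0 k = (\<Sum>j<n. c j * f j)"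
      using gen[OF k0[OF k]] by blast
    have sA: "s \<in> A" "ev v s \<noteq> 0" using sc(1) by (auto simp: vanishing_def)
    obtain \<alpha> where \<alpha>: "\<forall>x\<in>pts. \<forall>y. differential n s x y = (\<Sum>l\<in>H. ev x (\<alpha> l) * differential n l x y)"
      using H(3) sA(1) by blast
    have "\<forall>j\<in>{..<n}. \<exists>\<beta>. \<forall>x\<in>pts. \<forall>y. differential n (c j) x y = (\<Sum>l\<in>H. ev x (\<beta> l) * differential n l x y)"
      using H(3) sc(2) by blast
    then obtain \<beta> where \<beta>: "\<forall>j\<in>{..<n}. \<forall>x\<in>pts. \<forall>y. differential n (c j) x y = (\<Sum>l\<in>H. ev x (\<beta> j l) * differential n l x y)"
      by (rule bchoice[THEN exE])
    define \<epsilon> where "\<epsilon> l = (\<Sum>j<n. \<beta> j l * f j) - \<alpha> l * k0 k" for l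
    have fp: "f j \<in> polys n" "c j \<in> polys n" if "j < n" for j
      using f[OF that] sc(2) that A_polys by (auto simp: vanishing_def)
    have kp: "k0 k \<in> polys n" using k0[OF k] A_polys by (auto simp: vanishing_def)
    have "ev x s * differential n k x y = (\<Sum>l\<in>H. ev x (\<epsilon> l) * differential n l x y)"
      if x: "x \<in> pts" and y: "\<forall>j<n. differential n (f j) x y = 0" for x y
    proof -
      have "differential n (s * k0 k) x y = (\<Sum>j<n. differential n (c j * f j) x y)"
        unfolding sc(3) using fp by (intro differential_sum) auto
      also have "\<dots> = (\<Sum>j<n. differential n (c j) x y * ev x (f j))"
        using fp y by (intro sum.cong) (auto simp: differential_mult)
      also have "\<dots> = (\<Sum>j<n. \<Sum>l\<in>H. ev x (\<beta> j l) * differential n l x y * ev x (f j))"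
        using \<beta> x by (intro sum.cong) (auto simp: sum_distrib_right)
      also have "\<dots> = (\<Sum>l\<in>H. (\<Sum>j<n. ev x (\<beta> j l * f j)) * differential n l x y)"
        by (subst sum.swap) (intro sum.cong refl, simp add: sum_distrib_right sum_distrib_left mult_ac)
      finally have 1: "differential n (s * k0 k) x y = (\<Sum>l\<in>H. (\<Sum>j<n. ev x (\<beta> j l * f j)) * differential n l x y)" .
      have 2: "differential n (s * k0 k) x y
          = (\<Sum>l\<in>H. ev x (\<alpha> l) * differential n l x y) * ev x (k0 k) + ev x s * differential n k x y"
        using A_polys[OF sA(1)] kp \<alpha> x by (simp add: differential_mult dk0[OF k])
      have "ev x s * differential n k x y = (\<Sum>l\<in>H. (\<Sum>j<n. ev x (\<beta> j l * f j)) * differential n l x y)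
          - (\<Sum>l\<in>H. ev x (\<alpha> l) * differential n l x y) * ev x (k0 k)"
        using 1 2 by (simp add: algebra_simps)
      also have "\<dots> = (\<Sum>l\<in>H. (\<Sum>j<n. ev x (\<beta> j l * f j)) * differential n l x y
          - ev x (\<alpha> l) * differential n l x y * ev x (k0 k))"
        by (simp only: sum_distrib_right sum_subtractf)
      also have "\<dots> = (\<Sum>l\<in>H. ev x (\<epsilon> l) * differential n l x y)"
        by (intro sum.cong refl) (simp add: \<epsilon>_def algebra_simps)
      finally show ?thesis .
    qed
    moreover have "ev v (\<epsilon> l) = 0" for l
      using f k0[OF k] by (simp add: \<epsilon>_def vanishing_def)
    ultimately show ?thesis using sA(2) by (intro exI[of _ s] exI[of _ \<epsilon>]) blast
  qed
  then have "\<forall>k\<in>H. \<exists>s. \<exists>\<epsilon>. ev v s \<noteq> 0 \<and> (\<forall>l\<in>H. ev v (\<epsilon> l) = 0) \<and>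
      (\<forall>x\<in>pts. \<forall>y. (\<forall>j<n. differential n (f j) x y = 0) \<longrightarrow>
        ev x s * differential n k x y = (\<Sum>l\<in>H. ev x (\<epsilon> l) * differential n l x y))"
    by blast
  then obtain s where "\<forall>k\<in>H. \<exists>\<epsilon>. ev v (s k) \<noteq> 0 \<and> (\<forall>l\<in>H. ev v (\<epsilon> l) = 0) \<and>
      (\<forall>x\<in>pts. \<forall>y. (\<forall>j<n. differential n (f j) x y = 0) \<longrightarrow>
        ev x (s k) * differential n k x y = (\<Sum>l\<in>H. ev x (\<epsilon> l) * differential n l x y))"
    by (rule bchoice[THEN exE])
  then obtain \<epsilon> where s\<epsilon>: "\<forall>k\<in>H. ev v (s k) \<noteq> 0 \<and> (\<forall>l\<in>H. ev v (\<epsilon> k l) = 0) \<and>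
      (\<forall>x\<in>pts. \<forall>y. (\<forall>j<n. differential n (f j) x y = 0) \<longrightarrow>
        ev x (s k) * differential n k x y = (\<Sum>l\<in>H. ev x (\<epsilon> k l) * differential n l x y))"
    by (rule bchoice[THEN exE])
  define dom where "dom k x = cmod (ev x (s k)) - (\<Sum>l\<in>H. cmod (ev x (\<epsilon> k l)))" for k x
  have cont: "continuous_on UNIV (dom k)" for k
    unfolding dom_def by (intro continuous_intros continuous_ev)
  define U where "U = (\<Inter>k\<in>H. dom k -` {0<..})"
  have "open (dom k -` {0<..})" for k
    using cont[of k] open_greaterThan by (simp add: continuous_on_open_vimage)
  then have "open U" using H(2) by (auto simp: U_def)
  moreover have "v \<in> U" using s\<epsilon> by (auto simp: U_def dom_def)
  moreover have "differential n h x y = 0"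
    if x: "x \<in> U \<inter> pts" and y: "\<forall>j<n. differential n (f j) x y = 0" and h: "h \<in> A" for x y h
  proof -
    have "differential n k x y = 0" if "k \<in> H" for k
    proof (rule ccontr)
      assume nz: "differential n k x y \<noteq> 0"
      let ?m = "\<lambda>k. cmod (differential n k x y)"
      have "Max (?m ` H) \<in> ?m ` H" using H(2) that by (intro Max_in) auto
      then obtain l where l0: "Max (?m ` H) = ?m l" "l \<in> H" by (rule imageE)
      have le: "?m k \<le> ?m l" if "k \<in> H" for k
        unfolding l0(1)[symmetric] using that H(2) by (intro Max_ge) auto
      note l = l0(2) le
      have pos: "cmod (differential n l x y) > 0" using l(2)[OF that] nz by (meson less_le_trans zero_less_norm_iff)
      have "cmod (ev x (s l)) * cmod (differential n l x y) = cmod (\<Sum>k\<in>H. ev x (\<epsilon> l k) * differential n k x y)"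
        using s\<epsilon> l(1) x y by (auto simp flip: norm_mult)
      also have "\<dots> \<le> (\<Sum>k\<in>H. cmod (ev x (\<epsilon> l k)) * cmod (differential n l x y))"
        by (rule order_trans[OF norm_sum]) (auto simp: norm_mult intro!: sum_mono mult_left_mono l(2))
      also have "\<dots> = (\<Sum>k\<in>H. cmod (ev x (\<epsilon> l k))) * cmod (differential n l x y)" by (simp add: sum_distrib_right)
      finally have "cmod (ev x (s l)) \<le> (\<Sum>k\<in>H. cmod (ev x (\<epsilon> l k)))" using pos by simp
      moreover have "dom l x > 0" using x l(1) by (auto simp: U_def)
      ultimately show False by (simp add: dom_def)
    qed
    moreover obtain c where "differential n h x y = (\<Sum>k\<in>H. ev x (c k) * differential n k x y)"
      using H(3) h x by blast
    ultimately show ?thesis by simp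
  qed
  ultimately show ?thesis by blast
qed

end

context small_linear_action
begin

text \<open>At a point \<open>v\<close> with nontrivial stabilizer, the Jacobian determinant \<open>J\<close> of \<open>n\<close> generators vanishes,
  so it also vanishes at some point \<open>x\<close> near \<open>v\<close> with trivial stabilizer.  A tangent vector at \<open>x\<close>
  that the differentials of the generators annihilate is then annihilated by the differentials of
  all invariants.  But among these are those of local coordinates.\<close>

theorem regular_imp_free:
  assumes v: "v \<in> pts" and reg: "regular_local_ring (local_ring_at A (vanishing v))"
  shows "free_at v"
proof (rule ccontr)
  assume nf: "\<not> free_at v"
  interpret loc: localization A "vanishing v" by (rule localization_vanishing)
  obtain S where S: "finite S" "span_in loc.L S = loc.extension (vanishing v)" "card S = n"
    using reg unfolding regular_at_iff by blast
  obtain F where F: "F \<subseteq> vanishing v" "finite F" "card F \<le> n"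
    "\<forall>p\<in>vanishing v. \<exists>s\<in>A - vanishing v. s * p \<in> span_in A F"
    using loc.generators_up_to_denominator[OF S(1,2)] S(3) by blast
  obtain e where e: "bij_betw e {..<card F} F"
    using ex_bij_betw_nat_finite[OF F(2)] by (auto simp: atLeast0LessThan)
  \<comment> \<open>Fewer than \<open>n\<close> generators are padded with zeros.\<close>
  define f where "f j = (if j < card F then e j else 0)" for j
  have f: "f j \<in> vanishing v" for j
    using e F(1) subring_setD(1)[OF subring_A] by (auto simp: f_def bij_betw_def vanishing_def)
  have fp: "f j \<in> polys n" for j using f[of j] A_polys by (auto simp: vanishing_def)
  have gen: "\<exists>s\<in>A - vanishing v. \<exists>c. (\<forall>j<n. c j \<in> A) \<and> s * p = (\<Sum>j<n. c j * f j)" if p: "p \<in> vanishing v" for p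
  proof -
    obtain s where sp: "s \<in> A - vanishing v" "s * p \<in> span_in A F" using F(4) p by blast
    then obtain c where s: "s \<in> A - vanishing v" "\<forall>g\<in>F. c g \<in> A" "s * p = (\<Sum>g\<in>F. c g * g)"
      by (auto simp: span_in_def)
    define c' where "c' j = (if j < card F then c (e j) else 0)" for j
    have "(\<Sum>j<n. c' j * f j) = (\<Sum>j<card F. c' j * f j)"
      using F(3) by (intro sum.mono_neutral_right) (auto simp: f_def)
    also have "\<dots> = (\<Sum>j<card F. c (e j) * e j)" by (intro sum.cong) (auto simp: f_def c'_def)
    also have "\<dots> = (\<Sum>g\<in>F. c g * g)" by (rule sum.reindex_bij_betw[OF e])
    finally have "s * p = (\<Sum>j<n. c' j * f j)" using s(3) by simp
    moreover have "\<forall>j<n. c' j \<in> A"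
      using s(2) e subring_setD(1)[OF subring_A] by (auto simp: c'_def bij_betw_def)
    ultimately show ?thesis using s(1) by blast
  qed
  obtain U where U: "open U" "v \<in> U" "\<forall>x\<in>U \<inter> pts. \<forall>y. (\<forall>j<n. differential n (f j) x y = 0) \<longrightarrow>
      (\<forall>h\<in>A. differential n h x y = 0)"
    using generators_control_differentials[of f v] f gen by blast
  define M where "M = mat n n (\<lambda>(j, i). partial n (f j) i)"
  define J where "J = Determinant.det M"
  have M: "M \<in> carrier_mat n n" by (simp add: M_def)
  have Jp: "J \<in> polys n"
    unfolding J_def using fp by (intro det_in_subring[OF subring_set_polys M]) (auto simp: M_def)
  have evJ: "ev x J = Determinant.det (map_mat (ev x) M)" for x
    unfolding J_def using comm_ring_hom.hom_det[OF ev_hom] by metis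
  have mult: "map_mat (ev x) M *\<^sub>v vec n y = vec n (\<lambda>j. differential n (f j) x y)" for x y
    by (rule eq_vecI) (auto simp: M_def scalar_prod_def differential_def atLeast0LessThan)
  have kernel: "ev x J = 0 \<longleftrightarrow> (\<exists>y. (\<exists>i<n. y i \<noteq> 0) \<and> (\<forall>j<n. differential n (f j) x y = 0))" for x
  proof -
    have "ev x J = 0 \<longleftrightarrow> (\<exists>u. u \<in> carrier_vec n \<and> u \<noteq> 0\<^sub>v n \<and> map_mat (ev x) M *\<^sub>v u = 0\<^sub>v n)"
      unfolding evJ using M by (intro det_0_iff_vec_prod_zero) auto
    also have "\<dots> \<longleftrightarrow> (\<exists>y. (\<exists>i<n. y i \<noteq> 0) \<and> (\<forall>j<n. differential n (f j) x y = 0))"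
    proof
      assume "\<exists>u. u \<in> carrier_vec n \<and> u \<noteq> 0\<^sub>v n \<and> map_mat (ev x) M *\<^sub>v u = 0\<^sub>v n"
      then obtain u where u: "u \<in> carrier_vec n" "u \<noteq> 0\<^sub>v n" "map_mat (ev x) M *\<^sub>v u = 0\<^sub>v n" by blast
      have uv: "u = vec n (\<lambda>i. vec_index u i)" using u(1) by (intro eq_vecI) auto
      then have "vec n (\<lambda>j. differential n (f j) x (vec_index u)) = 0\<^sub>v n" using u(3) mult by metis
      then have "\<forall>j<n. differential n (f j) x (vec_index u) = 0" by (metis index_vec index_zero_vec(1))
      moreover have "\<exists>i<n. vec_index u i \<noteq> 0" using u(1,2) by (metis carrier_vecD eq_vecI index_zero_vec)
      ultimately show "\<exists>y. (\<exists>i<n. y i \<noteq> 0) \<and> (\<forall>j<n. differential n (f j) x y = 0)" by blast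
    next
      assume "\<exists>y. (\<exists>i<n. y i \<noteq> 0) \<and> (\<forall>j<n. differential n (f j) x y = 0)"
      then obtain y i where y: "i < n" "y i \<noteq> 0" "\<forall>j<n. differential n (f j) x y = 0" by blast
      have "vec n y \<noteq> 0\<^sub>v n" using y(1,2) by (metis index_vec index_zero_vec(1))
      moreover have "map_mat (ev x) M *\<^sub>v vec n y = 0\<^sub>v n" unfolding mult using y(3) by (intro eq_vecI) auto
      ultimately show "\<exists>u. u \<in> carrier_vec n \<and> u \<noteq> 0\<^sub>v n \<and> map_mat (ev x) M *\<^sub>v u = 0\<^sub>v n"
        using vec_carrier by blast
    qed
    finally show ?thesis .
  qed
  \<comment> \<open>An element that fixes \<open>v\<close> moves some tangent vector \<open>u\<close>, but the differentials of invariants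
    at \<open>v\<close> have the same values on \<open>u\<close> and on its image.\<close>
  obtain g where g: "g \<in> carrier G" "act g v = v" "g \<noteq> \<one>\<^bsub>G\<^esub>" using nf by (auto simp: free_at_def)
  obtain r u where ru: "r < n" "act g u r - u r \<noteq> 0"
    using no_reflections[OF g(1,3)] by (metis mult_zero_left)
  have "differential n (f j) v (\<lambda>i. act g u i - u i) = 0" for j
    using differential_invariant[of "f j" g v u] f[of j] g by (simp add: differential_minus vanishing_def)
  then have "ev v J = 0"
    unfolding kernel using ru
    by (intro exI[of _ "\<lambda>i. act g u i - u i"] conjI exI[of _ r] allI impI) auto
  then obtain x where x: "x \<in> U \<inter> pts" "free_at x" "ev x J = 0"
    using free_zero_nearby[OF v nf Jp _ U(1,2)] by blast
  obtain y i where y: "i < n" "y i \<noteq> 0" "\<forall>j<n. differential n (f j) x y = 0" using x(3) kernel by blast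
  have d0: "differential n h x y = 0" if "h \<in> A" for h using U(3) x(1) y(3) that by blast
  obtain z where "\<forall>i<n. z i \<in> vanishing x" "\<forall>i<n. \<forall>y. differential n (z i) x y = y i"
    using local_coordinates[of x] x by blast
  then show False using d0[of "z i"] y(1,2) by (auto simp: vanishing_def)
qed

theorem regular_iff_free:
  "v \<in> pts \<Longrightarrow> regular_local_ring (local_ring_at A (vanishing v)) \<longleftrightarrow> free_at v"
  using regular_imp_free free_imp_regular by blast

end

section \<open>The fundamental group of a quotient by a free action\<close>

locale free_action_quotient =
  fixes G :: "('g, 'b) monoid_scheme" and X :: "'a::real_normed_vector set"
    and p :: "'a \<Rightarrow> 'c::topological_space" and act :: "'g \<Rightarrow> 'a \<Rightarrow> 'a"
  assumes group: "group G" and finite_G: "finite (carrier G)"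
    and cont_p: "continuous_on X p"
    and open_p: "\<And>U. openin (top_of_set X) U \<Longrightarrow> openin (top_of_set (p ` X)) (p ` U)"
    and act_X: "\<And>g x. g \<in> carrier G \<Longrightarrow> x \<in> X \<Longrightarrow> act g x \<in> X"
    and cont_act: "\<And>g. g \<in> carrier G \<Longrightarrow> continuous_on X (act g)"
    and act_mult: "\<And>g h x. g \<in> carrier G \<Longrightarrow> h \<in> carrier G \<Longrightarrow> x \<in> X \<Longrightarrow>
      act g (act h x) = act (g \<otimes>\<^bsub>G\<^esub> h) x"
    and act_one: "\<And>x. x \<in> X \<Longrightarrow> act \<one>\<^bsub>G\<^esub> x = x"
    and free: "\<And>g x. g \<in> carrier G \<Longrightarrow> x \<in> X \<Longrightarrow> act g x = x \<Longrightarrow> g = \<one>\<^bsub>G\<^esub>"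
    and orbits: "\<And>x y. x \<in> X \<Longrightarrow> y \<in> X \<Longrightarrow> p x = p y \<longleftrightarrow> (\<exists>g\<in>carrier G. y = act g x)"
begin

sublocale group G by (rule group)

lemma act_inv: "g \<in> carrier G \<Longrightarrow> x \<in> X \<Longrightarrow> act (inv\<^bsub>G\<^esub> g) (act g x) = x"
  "g \<in> carrier G \<Longrightarrow> x \<in> X \<Longrightarrow> act g (act (inv\<^bsub>G\<^esub> g) x) = x"
  by (auto simp: act_mult act_one)

lemma act_eq:
  assumes "g \<in> carrier G" "h \<in> carrier G" "x \<in> X" "act g x = act h x"
  shows "g = h"
proof -
  have "act (inv\<^bsub>G\<^esub> h \<otimes>\<^bsub>G\<^esub> g) x = act (inv\<^bsub>G\<^esub> h) (act g x)" using assms(1-3) by (simp add: act_mult)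
  also have "\<dots> = x" unfolding assms(4) using assms(2,3) by (rule act_inv(1))
  finally have "act (inv\<^bsub>G\<^esub> h \<otimes>\<^bsub>G\<^esub> g) x = x" .
  then have "inv\<^bsub>G\<^esub> h \<otimes>\<^bsub>G\<^esub> g = \<one>\<^bsub>G\<^esub>" using free assms by auto
  then show ?thesis using assms by (metis inv_closed inv_equality inv_inv)
qed

lemma wandering_nhd:
  assumes x: "x \<in> X"
  shows "\<exists>U. openin (top_of_set X) U \<and> x \<in> U \<and>
    (\<forall>g\<in>carrier G. \<forall>u\<in>U. act g u \<in> U \<longrightarrow> g = \<one>\<^bsub>G\<^esub>)"
proof -
  let ?H = "carrier G - {\<one>\<^bsub>G\<^esub>}"
  have nhd: "\<exists>U. openin (top_of_set X) U \<and> x \<in> U \<and> (\<forall>u\<in>U. act g u \<notin> U)" if "g \<in> ?H" for g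
  proof -
    have "x \<noteq> act g x" using free[of g x] x that by auto
    from hausdorff[OF this] obtain P Q where PQ: "open P" "open Q" "x \<in> P" "act g x \<in> Q" "P \<inter> Q = {}"
      by (elim exE conjE)
    have "openin (top_of_set X) (X \<inter> P)" using PQ(1) by (auto simp: openin_open)
    moreover have "openin (top_of_set X) (X \<inter> act g -` Q)"
      using that PQ(2) by (intro continuous_openin_preimage_gen cont_act) auto
    ultimately have "openin (top_of_set X) ((X \<inter> P) \<inter> (X \<inter> act g -` Q))"
      by (rule openin_Int)
    moreover have "x \<in> (X \<inter> P) \<inter> (X \<inter> act g -` Q)" using PQ(3,4) x by simp
    moreover have "\<forall>u\<in>(X \<inter> P) \<inter> (X \<inter> act g -` Q). act g u \<notin> (X \<inter> P) \<inter> (X \<inter> act g -` Q)"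
      using PQ(5) by blast
    ultimately show ?thesis by (intro exI[of _ "(X \<inter> P) \<inter> (X \<inter> act g -` Q)"] conjI)
  qed
  have "\<forall>g\<in>?H. \<exists>U. openin (top_of_set X) U \<and> x \<in> U \<and> (\<forall>u\<in>U. act g u \<notin> U)"
    by (intro ballI nhd)
  then obtain U where U: "\<forall>g\<in>?H. openin (top_of_set X) (U g) \<and> x \<in> U g \<and> (\<forall>u\<in>U g. act g u \<notin> U g)"
    by (rule bchoice[THEN exE])
  let ?U = "(\<Inter>g\<in>?H. U g) \<inter> topspace (top_of_set X)"
  have "openin (top_of_set X) ?U" using finite_G U by (intro openin_INT) auto
  moreover have "x \<in> ?U" using U x by auto
  moreover have "g = \<one>\<^bsub>G\<^esub>" if "g \<in> carrier G" "u \<in> ?U" "act g u \<in> ?U" for g u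
    using U that by auto
  ultimately show ?thesis by blast
qed

lemma openin_act:
  assumes "g \<in> carrier G" "openin (top_of_set X) U"
  shows "openin (top_of_set X) (act g ` U)"
proof -
  have UX: "U \<subseteq> X" using assms(2) by (rule openin_imp_subset)
  have "act g ` U = X \<inter> act (inv\<^bsub>G\<^esub> g) -` U"
  proof (intro subset_antisym subsetI)
    fix y assume "y \<in> X \<inter> act (inv\<^bsub>G\<^esub> g) -` U"
    then show "y \<in> act g ` U" using act_inv(2)[OF assms(1)] by (intro image_eqI[of _ _ "act (inv\<^bsub>G\<^esub> g) y"]) auto
  qed (use UX assms act_X act_inv(1) in auto)
  moreover have "openin (top_of_set X) (X \<inter> act (inv\<^bsub>G\<^esub> g) -` U)"
    using assms act_X by (intro continuous_openin_preimage[OF cont_act]) auto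
  ultimately show ?thesis by simp
qed

text \<open>The pullback of the quotient map along a map \<open>h\<close> is a covering of the domain of \<open>h\<close>.
  It is used instead of the quotient map itself because it lives in normed spaces, where lifting
  theorems for coverings apply.\<close>

definition pullback :: "'d set \<Rightarrow> ('d \<Rightarrow> 'c) \<Rightarrow> ('d \<times> 'a) set"
  where "pullback T h = {(t, x). t \<in> T \<and> x \<in> X \<and> p x = h t}"

text \<open>The sheets over a small neighbourhood of \<open>t\<close> come from the translates of a neighbourhood of a point
  over \<open>h t\<close> that is disjoint from all its other translates.\<close>

lemma covering_space_pullback:
  fixes h :: "'d::real_normed_vector \<Rightarrow> 'c"
  assumes h: "continuous_on T h" "h ` T \<subseteq> p ` X"
  shows "covering_space (pullback T h) fst T"
  unfolding covering_space_def
proof (intro conjI ballI)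
  let ?E = "pullback T h"
  show "continuous_on ?E fst" by (intro continuous_intros)
  show "fst ` ?E = T"
  proof (intro subset_antisym subsetI)
    fix t assume "t \<in> T"
    then obtain x where "x \<in> X" "p x = h t" using h(2) by (metis image_subset_iff imageE)
    with \<open>t \<in> T\<close> show "t \<in> fst ` ?E" by (intro image_eqI[of _ _ "(t, x)"]) (auto simp: pullback_def)
  qed (auto simp: pullback_def)
  fix t assume t: "t \<in> T"
  then obtain x where x: "x \<in> X" "p x = h t" using h(2) by (metis image_subset_iff imageE)
  obtain U where U: "openin (top_of_set X) U" "x \<in> U"
    "\<And>g u. g \<in> carrier G \<Longrightarrow> u \<in> U \<Longrightarrow> act g u \<in> U \<Longrightarrow> g = \<one>\<^bsub>G\<^esub>"
    using wandering_nhd[OF x(1)] by metis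
  have UX: "U \<subseteq> X" using U(1) by (rule openin_imp_subset)
  define T0 where "T0 = T \<inter> h -` (p ` U)"
  have T0: "openin (top_of_set T) T0"
    unfolding T0_def using h by (intro continuous_openin_preimage[where T = "p ` X"] open_p U(1)) auto
  have disj: "g = k" if "g \<in> carrier G" "k \<in> carrier G" "u \<in> U" "w \<in> U" "act g u = act k w" for g k u w
  proof -
    have "w = act (inv\<^bsub>G\<^esub> k) (act g u)" using that UX act_inv(1)[of k w] by auto
    then have "w = act (inv\<^bsub>G\<^esub> k \<otimes>\<^bsub>G\<^esub> g) u" using that UX act_mult[of "inv\<^bsub>G\<^esub> k" g u] by auto
    then have "inv\<^bsub>G\<^esub> k \<otimes>\<^bsub>G\<^esub> g = \<one>\<^bsub>G\<^esub>" using U(3)[of _ u] that by auto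
    then show ?thesis using that by (metis inv_closed inv_equality inv_inv)
  qed
  define V where "V g = {(s, y). (s, y) \<in> ?E \<and> s \<in> T0 \<and> y \<in> act g ` U}" for g
  have union: "\<Union> (V ` carrier G) = ?E \<inter> fst -` T0"
  proof (intro subset_antisym subsetI)
    fix e assume "e \<in> ?E \<inter> fst -` T0"
    then obtain s y where e: "e = (s, y)" "(s, y) \<in> ?E" "s \<in> T0" by (cases e) auto
    then obtain u where "u \<in> U" "p u = p y" by (auto simp: T0_def pullback_def)
    then obtain g where "g \<in> carrier G" "y = act g u"
      using orbits[of u y] UX e by (auto simp: pullback_def)
    with e \<open>u \<in> U\<close> show "e \<in> \<Union> (V ` carrier G)" by (auto simp: V_def)
  qed (auto simp: V_def)
  have V_open: "openin (top_of_set ?E) (V g)" if "g \<in> carrier G" for g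
  proof -
    have "V g = (?E \<inter> fst -` T0) \<inter> (?E \<inter> snd -` (act g ` U))" by (auto simp: V_def)
    moreover have "openin (top_of_set ?E) (?E \<inter> fst -` T0)"
      by (rule continuous_openin_preimage[where T = T]) (auto simp: T0 pullback_def intro!: continuous_intros)
    moreover have "openin (top_of_set ?E) (?E \<inter> snd -` (act g ` U))"
      by (rule continuous_openin_preimage[where T = X])
        (auto simp: openin_act[OF that U(1)] pullback_def intro!: continuous_intros)
    ultimately show ?thesis by auto
  qed
  have V_disj: "pairwise disjnt (V ` carrier G)"
  proof (intro pairwiseI)
    fix P Q assume "P \<in> V ` carrier G" "Q \<in> V ` carrier G" "P \<noteq> Q"
    then obtain g k where "g \<in> carrier G" "k \<in> carrier G" "P = V g" "Q = V k" "g \<noteq> k" by auto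
    then show "disjnt P Q" using disj[of g k] by (force simp: disjnt_def V_def)
  qed
  have V_homeo: "\<exists>q. homeomorphism (V g) T0 fst q" if g: "g \<in> carrier G" for g
  proof -
    have "continuous_on (V g) fst" by (intro continuous_intros)
    moreover have "fst ` V g = T0"
    proof (intro subset_antisym subsetI)
      fix s assume "s \<in> T0"
      then obtain u where u: "u \<in> U" "p u = h s" "s \<in> T" by (auto simp: T0_def)
      have "p (act g u) = p u" using orbits[of u "act g u"] act_X g u UX by (metis subsetD)
      then have "(s, act g u) \<in> V g"
        using u act_X[OF g, of u] UX \<open>s \<in> T0\<close> by (auto simp: V_def pullback_def)
      then show "s \<in> fst ` V g" by force
    qed (auto simp: V_def)
    moreover have "inj_on fst (V g)"
    proof (rule inj_onI)
      fix e e' assume "e \<in> V g" "e' \<in> V g" "fst e = fst e'"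
      then obtain s u u' where e: "e = (s, act g u)" "e' = (s, act g u')" "u \<in> U" "u' \<in> U"
        "p (act g u) = p (act g u')"
        by (auto simp: V_def pullback_def)
      then obtain k where k: "k \<in> carrier G" "act g u' = act k (act g u)"
        using orbits[of "act g u" "act g u'"] act_X[OF g] UX by auto
      then have "act g u' = act (k \<otimes>\<^bsub>G\<^esub> g) u" using act_mult g e(3) UX by auto
      then have "g = k \<otimes>\<^bsub>G\<^esub> g" using disj[of g "k \<otimes>\<^bsub>G\<^esub> g" u' u] g k e by auto
      then have "k = \<one>\<^bsub>G\<^esub>" using g k by (metis one_unique r_cancel_one')
      then show "e = e'" using k e act_one act_X[OF g] UX by auto
    qed
    moreover have "openin (top_of_set T0) (fst ` W)" if W: "openin (top_of_set (V g)) W" for W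
    proof (subst openin_subopen, intro ballI)
      fix s assume "s \<in> fst ` W"
      then obtain y where sy: "(s, y) \<in> W" by auto
      obtain O' where O': "open O'" "W = V g \<inter> O'" using W by (auto simp: openin_open)
      then have "(s, y) \<in> O'" using sy by auto
      then obtain P Q where PQ: "open P" "open Q" "(s, y) \<in> P \<times> Q" "P \<times> Q \<subseteq> O'"
        using open_prod_elim[OF O'(1)] by blast
      let ?N = "T0 \<inter> (P \<inter> h -` (p ` (act g ` U \<inter> Q)))"
      have "openin (top_of_set X) (act g ` U \<inter> Q)"
        using openin_act[OF g U(1)] PQ(2) by (meson openin_Int_open)
      then have "openin (top_of_set T) (T \<inter> h -` (p ` (act g ` U \<inter> Q)))"
        using h by (intro continuous_openin_preimage[where T = "p ` X"] open_p) auto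
      then have "openin (top_of_set T) (T0 \<inter> ((T \<inter> h -` (p ` (act g ` U \<inter> Q))) \<inter> P))"
        using T0 PQ(1) by (meson openin_Int openin_Int_open)
      moreover have "T0 \<inter> ((T \<inter> h -` (p ` (act g ` U \<inter> Q))) \<inter> P) = ?N" by (auto simp: T0_def)
      ultimately have "openin (top_of_set T) ?N" by simp
      then have "openin (top_of_set T0) ?N"
        by (rule openin_subset_trans) (auto simp: T0_def)
      moreover have "s \<in> ?N"
      proof -
        have "s \<in> T0" "y \<in> act g ` U" "h s = p y" using sy O'(2) by (auto simp: V_def pullback_def)
        then show ?thesis using PQ(3) by blast
      qed
      moreover have "?N \<subseteq> fst ` W"
      proof
        fix s' assume s': "s' \<in> ?N"
        then obtain y' where y': "y' \<in> act g ` U" "y' \<in> Q" "h s' = p y'" by auto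
        then have "(s', y') \<in> V g \<inter> O'"
          using s' PQ(4) act_X[OF g] UX by (auto simp: V_def pullback_def T0_def)
        then show "s' \<in> fst ` W" using O'(2) by force
      qed
      ultimately show "\<exists>N. openin (top_of_set T0) N \<and> s \<in> N \<and> N \<subseteq> fst ` W" by blast
    qed
    ultimately show ?thesis by (metis homeomorphism_injective_open_map)
  qed
  have "p x \<in> p ` U" using U(2) by blast
  then have "t \<in> T0" using t x(2) by (simp add: T0_def)
  then show "\<exists>T0. t \<in> T0 \<and> openin (top_of_set T) T0 \<and> (\<exists>v. \<Union> v = ?E \<inter> fst -` T0 \<and>
      (\<forall>u\<in>v. openin (top_of_set ?E) u) \<and> pairwise disjnt v \<and> (\<forall>u\<in>v. \<exists>q. homeomorphism u T0 fst q))"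
    using T0 union V_open V_disj V_homeo
    by (intro exI[of _ T0] conjI exI[of _ "V ` carrier G"]) auto
qed

lemma lift_exists:
  fixes h :: "'d::real_normed_vector \<Rightarrow> 'c"
  assumes T: "convex T" "t0 \<in> T" and h: "continuous_on T h" "h ` T \<subseteq> p ` X"
    and x0: "x0 \<in> X" "p x0 = h t0"
  shows "\<exists>k. continuous_on T k \<and> k ` T \<subseteq> X \<and> (\<forall>t\<in>T. p (k t) = h t) \<and> k t0 = x0"
proof -
  obtain g where g: "continuous_on T g" "g \<in> T \<rightarrow> pullback T h" "g t0 = (t0, x0)" "\<And>t. t \<in> T \<Longrightarrow> fst (g t) = t"
  proof (rule covering_space_lift_strong[OF covering_space_pullback[OF h], of "(t0, x0)" t0 T "\<lambda>t. t"])
    show "(t0, x0) \<in> pullback T h" using T x0 by (auto simp: pullback_def)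
    show "simply_connected T" "locally path_connected T"
      using T(1) by (auto intro: convex_imp_simply_connected convex_imp_locally_path_connected)
  qed (use T in auto)
  have "continuous_on T (\<lambda>t. snd (g t))" using g(1) by (intro continuous_intros)
  moreover have "snd (g t) \<in> X \<and> p (snd (g t)) = h t" if "t \<in> T" for t
  proof -
    have "g t \<in> pullback T h" using g(2) that by auto
    then show ?thesis using g(4)[OF that] by (cases "g t") (auto simp: pullback_def)
  qed
  ultimately show ?thesis using g(3) by (intro exI[of _ "\<lambda>t. snd (g t)"]) auto
qed

lemma lift_unique:
  fixes T :: "'d::real_normed_vector set"
  assumes T: "connected T" "t0 \<in> T" "t \<in> T"
    and k: "continuous_on T k" "k ` T \<subseteq> X" "k' ` T \<subseteq> X" "continuous_on T k'"
      "\<And>t. t \<in> T \<Longrightarrow> p (k t) = p (k' t)" "k t0 = k' t0"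
  shows "k t = k' t"
proof -
  define h where "h t = p (k t)" for t
  have h: "continuous_on T h" "h ` T \<subseteq> p ` X"
    using k cont_p continuous_on_compose2[of X p T k] by (auto simp: h_def)
  have "(t, k t) = (t, k' t)"
    by (rule covering_space_lift_unique[OF covering_space_pullback[OF h], of "\<lambda>t. (t, k t)" t0 "\<lambda>t. (t, k' t)" T "\<lambda>t. t"])
      (use k T in \<open>auto simp: pullback_def h_def intro!: continuous_intros\<close>)
  then show ?thesis by simp
qed

lemma p_act: "g \<in> carrier G \<Longrightarrow> x \<in> X \<Longrightarrow> p (act g x) = p x"
  using orbits[of x "act g x"] act_X by auto

lemma path_lift_unique:
  assumes "path k" "path_image k \<subseteq> X" "path k'" "path_image k' \<subseteq> X"
    "\<And>t. t \<in> {0..1} \<Longrightarrow> p (k t) = p (k' t)" "pathstart k = pathstart k'" "t \<in> {0..1}"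
  shows "k t = k' t"
  using lift_unique[of "{0..1}" 0 t k k'] assms
  by (auto simp: path_def path_image_def pathstart_def)

lemma path_p:
  assumes "path k" "path_image k \<subseteq> X"
  shows "path (p \<circ> k)" "path_image (p \<circ> k) \<subseteq> p ` X"
  using assms continuous_on_subset[OF cont_p] by (auto intro!: path_continuous_image simp: path_image_compose)

text \<open>The loop \<open>l\<close> lifts to a path from \<open>x\<close> that ends at the translate of \<open>x\<close> by \<open>g\<close>.  This is a
  relation for arbitrary paths \<open>l\<close>; for loops at \<open>p x\<close> it is a function.\<close>

definition monodromy :: "'a \<Rightarrow> (real \<Rightarrow> 'c) \<Rightarrow> 'g \<Rightarrow> bool"
  where "monodromy x l g \<longleftrightarrow> g \<in> carrier G \<and> (\<exists>k. path k \<and> path_image k \<subseteq> X \<and> pathstart k = x \<and>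
    pathfinish k = act g x \<and> (\<forall>t\<in>{0..1}. p (k t) = l t))"

definition loops :: "'a \<Rightarrow> (real \<Rightarrow> 'c) set"
  where "loops x = {l. path l \<and> path_image l \<subseteq> p ` X \<and> pathstart l = p x \<and> pathfinish l = p x}"

lemma monodromy_exists:
  assumes x: "x \<in> X" and l: "l \<in> loops x" shows "\<exists>g. monodromy x l g"
proof -
  obtain k where k: "continuous_on {0..1} k" "k ` {0..1} \<subseteq> X" "\<forall>t\<in>{0..1}. p (k t) = l t" "k 0 = x"
    using lift_exists[of "{0..1}" "0::real" l x] x l
    by (auto simp: loops_def path_def path_image_def pathstart_def)
  have "p x = p (k 1)" using k(3) l by (auto simp: loops_def pathfinish_def)
  moreover have "k 1 \<in> X" using k(2) by (auto simp: image_subset_iff)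
  ultimately obtain g where "g \<in> carrier G" "k 1 = act g x" using orbits[of x "k 1"] x by auto
  with k show ?thesis
    unfolding monodromy_def path_def path_image_def pathstart_def pathfinish_def by blast
qed

lemma monodromy_unique:
  assumes x: "x \<in> X" and "monodromy x l g" "monodromy x l h" shows "g = h"
proof -
  obtain k k' where k: "path k" "path_image k \<subseteq> X" "pathstart k = x" "pathfinish k = act g x"
    "\<forall>t\<in>{0..1}. p (k t) = l t" "path k'" "path_image k' \<subseteq> X" "pathstart k' = x"
    "pathfinish k' = act h x" "\<forall>t\<in>{0..1}. p (k' t) = l t"
    using assms(2,3) by (auto simp: monodromy_def)
  then have "k 1 = k' 1" using path_lift_unique[of k k' 1] by auto
  then show ?thesis using k act_eq[of g h x] assms by (auto simp: pathfinish_def monodromy_def)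
qed

text \<open>Lift the homotopy.  Its two edges with constant values lift to constant paths, so the lifts of both
  loops end at the same point.\<close>

lemma monodromy_homotopic:
  assumes x: "x \<in> X" and l: "l \<in> loops x" and hom: "homotopic_paths (p ` X) l l'"
    and g: "monodromy x l g"
  shows "monodromy x l' g"
proof -
  obtain H where H: "continuous_on ({0..1} \<times> {0..1}) H" "H \<in> ({0..1} \<times> {0..1}) \<rightarrow> p ` X"
    "\<forall>t\<in>{0..1}. H (0, t) = l t" "\<forall>t\<in>{0..1}. H (1, t) = l' t"
    "\<forall>s\<in>{0..1::real}. pathstart (H \<circ> Pair s) = pathstart l \<and> pathfinish (H \<circ> Pair s) = pathfinish l"
    using hom unfolding homotopic_paths by blast
  have ends: "H (s, 0) = p x" "H (s, 1) = p x" if "s \<in> {0..1}" for s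
    using H(5) that l by (auto simp: pathstart_def pathfinish_def loops_def)
  let ?Q = "{0..1::real} \<times> {0..1::real}"
  have "\<exists>K. continuous_on ?Q K \<and> K ` ?Q \<subseteq> X \<and> (\<forall>t\<in>?Q. p (K t) = H t) \<and> K (0, 0) = x"
    by (rule lift_exists) (use x H(1,2) ends(1)[of 0] in \<open>auto intro: convex_Times\<close>)
  then obtain K where K: "continuous_on ?Q K" "K ` ?Q \<subseteq> X" "\<And>t. t \<in> ?Q \<Longrightarrow> p (K t) = H t" "K (0, 0) = x"
    by blast
  have contK: "continuous_on {0..1} (\<lambda>t. K (s, t))" "continuous_on {0..1} (\<lambda>t. K (t, s))"
    if "s \<in> {0..1}" for s
    by (rule continuous_on_compose2[OF K(1)]; use that in \<open>auto intro!: continuous_intros\<close>)+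
  obtain k where k: "path k" "path_image k \<subseteq> X" "pathstart k = x" "pathfinish k = act g x"
    "\<forall>t\<in>{0..1}. p (k t) = l t"
    using g by (auto simp: monodromy_def)
  have g': "g \<in> carrier G" using g by (simp add: monodromy_def)
  have K0: "K (0, t) = k t" if "t \<in> {0..1}" for t
    by (rule lift_unique[of "{0..1}" "0::real"])
      (use that contK(1)[of 0] K k H(3) in \<open>auto simp: path_def path_image_def pathstart_def\<close>)
  have const: "K (s, e) = y" if s: "s \<in> {0..1}" and e: "e \<in> {0, 1}" and y: "y \<in> X" "p y = p x" "K (0, e) = y" for s e y
  proof (rule lift_unique[where T = "{0..1}" and ?t0.0 = 0 and t = s and k = "\<lambda>s. K (s, e)" and k' = "\<lambda>_. y"])
    show "continuous_on {0..1} (\<lambda>s. K (s, e))" using e by (intro contK(2)) auto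
    show "(\<lambda>s. K (s, e)) ` {0..1} \<subseteq> X" using K(2) e by auto
    show "(\<lambda>_. y) ` {0..1::real} \<subseteq> X" using y(1) by auto
    show "p (K (s, e)) = p y" if "s \<in> {0..1}" for s
      using K(3)[of "(s, e)"] ends[OF that] that e y(2) by auto
  qed (use s y(3) in auto)
  have Kx: "K (s, 0) = x" if "s \<in> {0..1}" for s
    using const[OF that _ x] K(4) by auto
  have Kg: "K (s, 1) = act g x" if "s \<in> {0..1}" for s
    using const[OF that, of 1 "act g x"] K0[of 1] k(4) act_X[OF g' x] p_act[OF g' x]
    by (auto simp: pathfinish_def)
  show ?thesis
    unfolding monodromy_def
  proof (intro conjI exI[of _ "\<lambda>t. K (1, t)"] g')
    show "path (\<lambda>t. K (1, t))" using contK(1)[of 1] by (simp add: path_def)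
    show "path_image (\<lambda>t. K (1, t)) \<subseteq> X" using K(2) by (auto simp: path_image_def)
    show "pathstart (\<lambda>t. K (1, t)) = x" "pathfinish (\<lambda>t. K (1, t)) = act g x"
      using Kx[of 1] Kg[of 1] by (auto simp: pathstart_def pathfinish_def)
    show "\<forall>t\<in>{0..1}. p (K (1, t)) = l' t" using K(3) H(4) by auto
  qed
qed

lemma monodromy_join:
  assumes x: "x \<in> X" and l: "monodromy x l g" "monodromy x l' h"
  shows "monodromy x (l +++ l') (g \<otimes>\<^bsub>G\<^esub> h)"
proof -
  obtain k k' where k: "path k" "path_image k \<subseteq> X" "pathstart k = x" "pathfinish k = act g x"
    "\<forall>t\<in>{0..1}. p (k t) = l t" "path k'" "path_image k' \<subseteq> X" "pathstart k' = x"
    "pathfinish k' = act h x" "\<forall>t\<in>{0..1}. p (k' t) = l' t"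
    using l by (auto simp: monodromy_def)
  have gh: "g \<in> carrier G" "h \<in> carrier G" using l by (auto simp: monodromy_def)
  let ?k = "k +++ (act g \<circ> k')"
  have k'X: "k' t \<in> X" if "t \<in> {0..1}" for t using k(7) that by (auto simp: path_image_def)
  have "path (act g \<circ> k')"
    using k(6,7) cont_act[OF gh(1)] by (intro path_continuous_image) (auto intro: continuous_on_subset)
  moreover have "pathstart (act g \<circ> k') = act g x" using k by (simp add: pathstart_compose)
  ultimately have "path ?k" using k by auto
  moreover have "path_image ?k \<subseteq> X"
    using k'X k(2) act_X[OF gh(1)] by (intro subset_path_image_join) (auto simp: path_image_def)
  moreover have "pathstart ?k = x" "pathfinish ?k = act (g \<otimes>\<^bsub>G\<^esub> h) x"
    using k gh x by (auto simp: pathfinish_compose act_mult)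
  moreover have "\<forall>t\<in>{0..1}. p (?k t) = (l +++ l') t"
    using k(5,10) p_act[OF gh(1) k'X] by (auto simp: joinpaths_def)
  ultimately show ?thesis using gh unfolding monodromy_def by blast
qed

lemma monodromy_surj:
  assumes "path_connected X" and x: "x \<in> X" and g: "g \<in> carrier G"
  shows "\<exists>l\<in>loops x. monodromy x l g"
proof -
  obtain k where k: "path k" "path_image k \<subseteq> X" "pathstart k = x" "pathfinish k = act g x"
    using assms act_X[OF g x] unfolding path_connected_def by blast
  have "p \<circ> k \<in> loops x"
    using k p_act[OF g x] path_p[OF k(1,2)] by (auto simp: loops_def pathstart_compose pathfinish_compose)
  moreover have "monodromy x (p \<circ> k) g" using k g unfolding monodromy_def by auto
  ultimately show ?thesis by blast
qed

lemma homotopic_if_monodromy_eq: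
  assumes "simply_connected X" and l: "l \<in> loops x" "l' \<in> loops x" "monodromy x l g" "monodromy x l' g"
  shows "homotopic_paths (p ` X) l l'"
proof -
  obtain k k' where k: "path k" "path_image k \<subseteq> X" "pathstart k = x" "pathfinish k = act g x"
    "\<forall>t\<in>{0..1}. p (k t) = l t" "path k'" "path_image k' \<subseteq> X" "pathstart k' = x"
    "pathfinish k' = act g x" "\<forall>t\<in>{0..1}. p (k' t) = l' t"
    using l(3,4) by (auto simp: monodromy_def)
  then have "homotopic_paths X k k'"
    using assms(1) unfolding simply_connected_eq_homotopic_paths by auto
  then have "homotopic_paths (p ` X) (p \<circ> k) (p \<circ> k')"
    by (rule homotopic_paths_continuous_image) (auto simp: cont_p)
  moreover have "homotopic_paths (p ` X) (p \<circ> k) l" "homotopic_paths (p ` X) (p \<circ> k') l'"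
    using k path_p[OF k(1,2)] path_p[OF k(6,7)] by (intro homotopic_paths_eq; simp)+
  ultimately show ?thesis by (meson homotopic_paths_trans homotopic_paths_sym)
qed

text \<open>Homotopy classes of loops at \<open>p x\<close> are the fibres of the monodromy: homotopic loops have the same
  monodromy, and loops with the same monodromy have lifts with the same endpoints, which are
  homotopic because \<open>X\<close> is simply connected.  Every group element occurs because \<open>X\<close> is path
  connected, and concatenation of loops corresponds to the group multiplication.\<close>

theorem fundamental_group_quotient:
  assumes sc: "simply_connected X" and x: "x \<in> X"
  shows "fundamental_group (p ` X) (p x) \<cong> G"
proof -
  let ?F = "fundamental_group (p ` X) (p x)"
  define \<Psi> where "\<Psi> g = {l \<in> loops x. monodromy x l g}" for g
  have pc: "path_connected X" using sc by (rule simply_connected_imp_path_connected)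
  have loop_class: "loop_class (p ` X) l = \<Psi> g" if "l \<in> loops x" "monodromy x l g" for l g
  proof (intro subset_antisym subsetI)
    fix l' assume "l' \<in> loop_class (p ` X) l"
    then have hom: "homotopic_paths (p ` X) l l'" by (simp add: loop_class_def)
    have "l' \<in> loops x"
      using that(1) homotopic_paths_imp_path[OF hom] homotopic_paths_imp_subset[OF hom]
        homotopic_paths_imp_pathstart[OF hom] homotopic_paths_imp_pathfinish[OF hom]
      by (auto simp: loops_def)
    then show "l' \<in> \<Psi> g" using monodromy_homotopic[OF x that(1) hom that(2)] by (simp add: \<Psi>_def)
  next
    fix l' assume "l' \<in> \<Psi> g"
    then show "l' \<in> loop_class (p ` X) l"
      using homotopic_if_monodromy_eq[OF sc that(1) _ that(2)] by (auto simp: \<Psi>_def loop_class_def)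
  qed
  have carrier: "carrier ?F = \<Psi> ` carrier G"
  proof (intro subset_antisym subsetI)
    fix C assume "C \<in> carrier ?F"
    then obtain l where l: "l \<in> loops x" "C = loop_class (p ` X) l"
      by (auto simp: fundamental_group_def loops_def)
    then obtain g where "monodromy x l g" using monodromy_exists[OF x] by blast
    then show "C \<in> \<Psi> ` carrier G" using loop_class l by (auto simp: monodromy_def)
  next
    fix C assume "C \<in> \<Psi> ` carrier G"
    then obtain g where g: "g \<in> carrier G" "C = \<Psi> g" by auto
    then obtain l where "l \<in> loops x" "monodromy x l g" using monodromy_surj[OF pc x] by blast
    then show "C \<in> carrier ?F"
      using loop_class g by (auto simp: fundamental_group_def loops_def intro!: image_eqI[of _ _ l])
  qed
  have nonempty: "\<exists>l. l \<in> \<Psi> g" if "g \<in> carrier G" for g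
    using monodromy_surj[OF pc x that] by (auto simp: \<Psi>_def)
  have mult: "\<Psi> g \<otimes>\<^bsub>?F\<^esub> \<Psi> h = \<Psi> (g \<otimes>\<^bsub>G\<^esub> h)" if "g \<in> carrier G" "h \<in> carrier G" for g h
  proof -
    have "loop_class (p ` X) (l +++ l') = \<Psi> (g \<otimes>\<^bsub>G\<^esub> h)" if "l \<in> \<Psi> g" "l' \<in> \<Psi> h" for l l'
    proof (rule loop_class)
      show "l +++ l' \<in> loops x"
        using that by (auto simp: \<Psi>_def loops_def intro: subset_path_image_join[THEN subsetD])
      show "monodromy x (l +++ l') (g \<otimes>\<^bsub>G\<^esub> h)"
        using that by (intro monodromy_join[OF x]) (auto simp: \<Psi>_def)
    qed
    then show ?thesis
      using nonempty[OF that(1)] nonempty[OF that(2)] by (auto simp: fundamental_group_def)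
  qed
  have inj: "inj_on \<Psi> (carrier G)"
  proof (rule inj_onI)
    fix g h assume "g \<in> carrier G" "h \<in> carrier G" "\<Psi> g = \<Psi> h"
    then show "g = h" using nonempty[of g] monodromy_unique[OF x] by (auto simp: \<Psi>_def)
  qed
  have "\<Psi> \<in> iso G ?F"
    using carrier mult inj by (auto simp: iso_def hom_def bij_betw_def)
  then have "G \<cong> ?F" by (auto simp: is_iso_def)
  then show ?thesis by (rule iso_sym)
qed

end

section \<open>Complements of subspaces of complex codimension two\<close>

text \<open>A piecewise linear path, written as a sum of clamped linear functions so that its
  continuity is evident.\<close>

definition polygon :: "nat \<Rightarrow> (nat \<Rightarrow> 'a::real_vector) \<Rightarrow> real \<Rightarrow> 'a"
  where "polygon N a t = a 0 + (\<Sum>k<N. max 0 (min 1 (real N * t - real k)) *\<^sub>R (a (Suc k) - a k))"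

lemma polygon_on_piece:
  assumes "m < N" "real m \<le> real N * t" "real N * t \<le> real (Suc m)"
  shows "polygon N a t = a m + (real N * t - real m) *\<^sub>R (a (Suc m) - a m)"
proof -
  let ?c = "\<lambda>k. max 0 (min 1 (real N * t - real k)) *\<^sub>R (a (Suc k) - a k)"
  have "(\<Sum>k<N. ?c k) = (\<Sum>k<m. ?c k) + (\<Sum>k\<in>{m..<N}. ?c k)"
    using assms(1) by (simp add: lessThan_atLeast0 sum.atLeastLessThan_concat)
  also have "(\<Sum>k\<in>{m..<N}. ?c k) = ?c m + (\<Sum>k\<in>{Suc m..<N}. ?c k)"
    using assms(1) by (rule sum.atLeast_Suc_lessThan)
  finally have "(\<Sum>k<N. ?c k) = (\<Sum>k<m. ?c k) + (?c m + (\<Sum>k\<in>{Suc m..<N}. ?c k))" .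
  moreover have "(\<Sum>k<m. ?c k) = (\<Sum>k<m. a (Suc k) - a k)"
    using assms(2) by (intro sum.cong) (auto simp: min_def max_def)
  moreover have "(\<Sum>k<m. a (Suc k) - a k) = a m - a 0" by (rule sum_lessThan_telescope)
  moreover have "?c m = (real N * t - real m) *\<^sub>R (a (Suc m) - a m)" using assms(2,3) by (auto simp: min_def max_def)
  moreover have "(\<Sum>k\<in>{Suc m..<N}. ?c k) = 0"
    using assms(3) by (intro sum.neutral) (auto simp: min_def max_def)
  ultimately show ?thesis by (simp add: polygon_def)
qed

lemma continuous_polygon: "continuous_on S (polygon N (a :: nat \<Rightarrow> 'a::real_normed_vector))"
  unfolding polygon_def by (intro continuous_intros)

lemma unit_interval_piece:
  assumes "0 < N" "t \<in> {0..1::real}"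
  obtains m where "m < N" "real m \<le> real N * t" "real N * t \<le> real (Suc m)"
proof (cases "t = 1")
  case True
  then show ?thesis using assms(1) by (intro that[of "N - 1"]) auto
next
  case False
  have nn: "0 \<le> real N * t" using assms by simp
  have "real N * t < real N" using False assms by simp
  then have "nat \<lfloor>real N * t\<rfloor> < N" using nn by (simp add: nat_less_iff floor_less_iff)
  moreover have "real (nat \<lfloor>real N * t\<rfloor>) \<le> real N * t" "real N * t \<le> real (Suc (nat \<lfloor>real N * t\<rfloor>))"
    using nn by (auto simp: of_nat_nat) linarith
  ultimately show ?thesis by (rule that)
qed

lemma polygon_in_segment:
  fixes a :: "nat \<Rightarrow> 'a::real_vector"
  assumes "m < N" "real m \<le> real N * t" "real N * t \<le> real (Suc m)"
  shows "polygon N a t \<in> closed_segment (a m) (a (Suc m))"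
  unfolding polygon_on_piece[OF assms] using assms
  by (auto simp: in_segment algebra_simps intro!: exI[of _ "real N * t - real m"])

text \<open>The surjections \<open>\<Lambda> i\<close> onto a real vector space of dimension four witness that the sets \<open>W i\<close> have
  real codimension at least four.\<close>

locale codim_two_complement =
  fixes E :: "'a::real_normed_vector set" and I :: "'i set" and W :: "'i \<Rightarrow> 'a set"
    and \<Lambda> :: "'i \<Rightarrow> 'a \<Rightarrow> complex \<times> complex"
  assumes subspace: "subspace E" and finite_I: "finite I"
    and closed_W: "\<And>i. i \<in> I \<Longrightarrow> closedin (top_of_set E) (W i)"
    and ker: "\<And>i x. i \<in> I \<Longrightarrow> x \<in> W i \<Longrightarrow> \<Lambda> i x = 0"
    and linear: "\<And>i. i \<in> I \<Longrightarrow> linear (\<Lambda> i)"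
    and surj: "\<And>i z. i \<in> I \<Longrightarrow> \<exists>x\<in>E. \<Lambda> i x = z"
begin

definition V :: "'a set"
  where "V = E - (\<Union>i\<in>I. W i)"

text \<open>A cone with apex \<open>c\<close> over a segment from \<open>a\<close> to \<open>b\<close> that misses \<open>W i\<close> can only meet \<open>W i\<close> if
  \<open>\<Lambda> i c\<close> lies in the real span of \<open>\<Lambda> i a\<close> and \<open>\<Lambda> i b\<close>.  Two vectors do not span a real vector space
  of dimension four, so a general apex avoids this for finitely many segments.\<close>

lemma generic_apex:
  assumes "finite P"
  shows "\<exists>c\<in>E. \<forall>(a, b)\<in>P. \<forall>i\<in>I. \<Lambda> i c \<notin> span {\<Lambda> i a, \<Lambda> i b}"
proof -
  have "\<exists>v. v \<noteq> 0 \<and> span {\<Lambda> i a, \<Lambda> i b} \<subseteq> {x. v \<bullet> x = 0}" for i a b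
  proof -
    have "dim {\<Lambda> i a, \<Lambda> i b} \<le> card {\<Lambda> i a, \<Lambda> i b}" by (rule dim_le_card') simp
    also have "\<dots> \<le> 2" by (simp add: card_insert_if)
    finally have "dim {\<Lambda> i a, \<Lambda> i b} < DIM(complex \<times> complex)" by simp
    then show ?thesis by (metis lowdim_subset_hyperplane)
  qed
  note ex_v = this
  define v where "v i a b = (SOME v. v \<noteq> 0 \<and> span {\<Lambda> i a, \<Lambda> i b} \<subseteq> {x. v \<bullet> x = 0})" for i a b
  have v: "v i a b \<noteq> 0" "span {\<Lambda> i a, \<Lambda> i b} \<subseteq> {x. v i a b \<bullet> x = 0}" for i a b
    using someI_ex[OF ex_v[of i a b]] by (auto simp: v_def)
  define \<psi> where "\<psi> = (\<lambda>(i, a, b) c. complex_of_real (v i a b \<bullet> \<Lambda> i c))"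
  have "\<exists>c\<in>E. \<forall>j \<in> (\<lambda>(i, a, b). (i, a, b)) ` (I \<times> P). \<psi> j c \<noteq> 0"
  proof (rule generic_point[where ln = "\<lambda>x t y. x + t *\<^sub>R y"])
    fix j assume "j \<in> (\<lambda>(i, a, b). (i, a, b)) ` (I \<times> P)"
    then obtain i a b where j: "j = (i, a, b)" "i \<in> I" by auto
    obtain e where "e \<in> E" "\<Lambda> i e = v i a b" using surj[OF j(2)] by blast
    then show "\<exists>e\<in>E. \<psi> j e \<noteq> 0" using v(1)[of i a b] by (auto simp: \<psi>_def j intro!: bexI[of _ e])
    show "\<psi> j (x + t *\<^sub>R y) = \<psi> j x + complex_of_real t * \<psi> j y" for x t y
      using linear[OF j(2)] by (simp add: \<psi>_def j linear_add linear_scale inner_add_right)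
  qed (use finite_I assms subspace in \<open>auto simp: subspace_def\<close>)
  then obtain c where c: "c \<in> E" "\<And>i a b. i \<in> I \<Longrightarrow> (a, b) \<in> P \<Longrightarrow> v i a b \<bullet> \<Lambda> i c \<noteq> 0"
    by (force simp: \<psi>_def)
  then show ?thesis using v(2) by (intro bexI[of _ c]) fastforce+
qed

lemma cone_subset:
  assumes seg: "closed_segment a b \<subseteq> V" and c: "c \<in> E" "\<And>i. i \<in> I \<Longrightarrow> \<Lambda> i c \<notin> span {\<Lambda> i a, \<Lambda> i b}"
    and y: "y \<in> closed_segment a b"
  shows "closed_segment y c \<subseteq> V"
proof
  fix z assume "z \<in> closed_segment y c"
  then obtain u where u: "z = (1 - u) *\<^sub>R y + u *\<^sub>R c" "0 \<le> u" "u \<le> 1" by (auto simp: in_segment)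
  obtain s where s: "y = (1 - s) *\<^sub>R a + s *\<^sub>R b" using y by (auto simp: in_segment)
  have yV: "y \<in> V" using seg y by blast
  then have "z \<in> E" using u(1) c(1) subspace by (auto simp: V_def intro!: subspace_add subspace_scale)
  moreover have "z \<notin> W i" if i: "i \<in> I" for i
  proof
    assume "z \<in> W i"
    then have "\<Lambda> i z = 0" by (rule ker[OF i])
    then have z0: "(1 - u) *\<^sub>R \<Lambda> i y + u *\<^sub>R \<Lambda> i c = 0"
      using linear[OF i] by (simp add: u(1) linear_add linear_scale)
    show False
    proof (cases "u = 0")
      case True
      then show ?thesis using \<open>z \<in> W i\<close> yV i u(1) by (auto simp: V_def)
    next
      case False
      have "u *\<^sub>R \<Lambda> i c = - ((1 - u) *\<^sub>R \<Lambda> i y)" using z0 by (simp add: eq_neg_iff_add_eq_0 add.commute)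
      then have "(1 / u) *\<^sub>R (u *\<^sub>R \<Lambda> i c) = (1 / u) *\<^sub>R (- ((1 - u) *\<^sub>R \<Lambda> i y))" by simp
      then have "\<Lambda> i c = (1 / u) *\<^sub>R (- ((1 - u) *\<^sub>R \<Lambda> i y))" using False by simp
      moreover have "\<Lambda> i y \<in> span {\<Lambda> i a, \<Lambda> i b}"
      proof -
        have "\<Lambda> i y = (1 - s) *\<^sub>R \<Lambda> i a + s *\<^sub>R \<Lambda> i b"
          using linear[OF i] by (simp add: s linear_add linear_scale)
        moreover have "(1 - s) *\<^sub>R \<Lambda> i a \<in> span {\<Lambda> i a, \<Lambda> i b}" "s *\<^sub>R \<Lambda> i b \<in> span {\<Lambda> i a, \<Lambda> i b}"
          by (rule span_scale[OF span_base], simp)+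
        ultimately show ?thesis by (metis span_add)
      qed
      ultimately have "\<Lambda> i c \<in> span {\<Lambda> i a, \<Lambda> i b}" by (auto intro!: span_scale span_neg)
      then show ?thesis using c(2)[OF i] by blast
    qed
  qed
  ultimately show "z \<in> V" by (auto simp: V_def)
qed

lemma openin_V: "openin (top_of_set E) V"
proof -
  have "closedin (top_of_set E) (\<Union>i\<in>I. W i)" using finite_I closed_W by (intro closedin_Union) auto
  then show ?thesis by (simp add: V_def openin_diff)
qed

lemma path_connected_V: "path_connected V"
  unfolding path_connected_component
proof (intro ballI)
  fix a b assume ab: "a \<in> V" "b \<in> V"
  obtain c where c: "c \<in> E" "\<forall>(a, b)\<in>{(a, a), (b, b)}. \<forall>i\<in>I. \<Lambda> i c \<notin> span {\<Lambda> i a, \<Lambda> i b}"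
    using generic_apex[of "{(a, a), (b, b)}"] by auto
  have "closed_segment a c \<subseteq> V" "closed_segment b c \<subseteq> V"
    using cone_subset[of a a c a] cone_subset[of b b c b] c ab by simp_all
  then have "path_component V x c" if "x \<in> {a, b}" for x
    using that unfolding path_component_def by (intro exI[of _ "linepath x c"]) auto
  then show "path_component V a b" by (metis insertI1 insertI2 path_component_sym path_component_trans)
qed

text \<open>A loop is homotopic to a polygon close to it, and the cone over the polygon with a general apex lies
  in \<open>V\<close>.\<close>

theorem simply_connected_V: "simply_connected V"
  unfolding simply_connected_eq_contractible_loop_some
proof (intro conjI path_connected_V allI impI)
  fix p assume p: "path p \<and> path_image p \<subseteq> V \<and> pathfinish p = pathstart p"
  obtain U where U: "open U" "V = E \<inter> U" using openin_V by (auto simp: openin_open)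
  have "compact (path_image p)" using p by auto
  then obtain \<delta> where \<delta>: "\<delta> > 0" "(\<Union>x\<in>path_image p. ball x \<delta>) \<subseteq> U"
    using compact_subset_open_imp_ball_epsilon_subset[of "path_image p" U] U p by auto
  have "uniformly_continuous_on {0..1} p"
    using p by (intro compact_uniformly_continuous) (auto simp: path_def)
  then obtain \<eta> where \<eta>: "\<eta> > 0" "\<And>s t. s \<in> {0..1} \<Longrightarrow> t \<in> {0..1} \<Longrightarrow> dist s t < \<eta> \<Longrightarrow> dist (p s) (p t) < \<delta>"
    using \<delta>(1) unfolding uniformly_continuous_on_def by meson
  obtain N where N: "0 < N" "1 / real N < \<eta>"
    using reals_Archimedean[OF \<eta>(1)] by (metis inverse_eq_divide zero_less_Suc)
  define a where "a k = p (real k / real N)" for k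
  define q where "q = polygon N a"
  have near: "ball (a k) \<delta> \<inter> E \<subseteq> V" if "k \<le> N" for k
  proof -
    have "a k \<in> path_image p" using that N by (auto simp: a_def path_image_def)
    then show ?thesis using \<delta>(2) U(2) by blast
  qed
  have dist_a: "dist (a m) (p t) < \<delta>" if "m \<le> N" "t \<in> {0..1}" "\<bar>real m - real N * t\<bar> \<le> 1" for m t
  proof -
    have "\<bar>real m / real N - t\<bar> = \<bar>real m - real N * t\<bar> / real N" using N by (simp add: field_simps abs_divide)
    also have "\<dots> \<le> 1 / real N" using that N by (intro divide_right_mono) auto
    finally have "dist (real m / real N) t < \<eta>" using N by (simp add: dist_real_def)
    then show ?thesis unfolding a_def using that N by (intro \<eta>(2)) auto
  qed
  have pE: "p t \<in> E" if "t \<in> {0..1}" for t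
  proof -
    have "p t \<in> path_image p" using that by (simp add: path_image_def)
    then show ?thesis using p by (auto simp: V_def)
  qed
  have aE: "a k \<in> E" if "k \<le> N" for k using pE that N by (simp add: a_def)
  have cE: "convex E" using subspace by (rule subspace_imp_convex)
  have aa: "a (Suc m) \<in> ball (a m) \<delta>" if "m < N" for m
    using dist_a[of m "real (Suc m) / real N"] that N by (simp add: a_def)
  have seg_ball: "closed_segment x y \<subseteq> V" if "m \<le> N" "x \<in> ball (a m) \<delta> \<inter> E" "y \<in> ball (a m) \<delta> \<inter> E" for m x y
  proof -
    have "closed_segment x y \<subseteq> ball (a m) \<delta> \<inter> E"
      using that cE by (intro closed_segment_subset convex_Int) auto
    then show ?thesis using near[OF that(1)] by blast
  qed
  have seg: "closed_segment (a m) (a (Suc m)) \<subseteq> V" if "m < N" for m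
    using that aa aE \<delta>(1) by (intro seg_ball[of m]) auto
  have q_seg: "\<exists>m<N. q t \<in> closed_segment (a m) (a (Suc m)) \<and> p t \<in> ball (a m) \<delta>" if t: "t \<in> {0..1}" for t
  proof -
    obtain m where m: "m < N" "real m \<le> real N * t" "real N * t \<le> real (Suc m)"
      using unit_interval_piece[OF N(1) t] by metis
    then show ?thesis using polygon_in_segment[OF m, of a] dist_a[of m t] t
      by (intro exI[of _ m]) (auto simp: q_def)
  qed
  have q: "path q" "pathstart q = p 0" "pathfinish q = p 1"
  proof -
    show "path q" unfolding path_def q_def by (rule continuous_polygon)
    have "q 0 = a 0" using polygon_on_piece[of 0 N 0 a] N by (simp add: q_def)
    then show "pathstart q = p 0" by (simp add: pathstart_def a_def)
    have "q 1 = a N" using polygon_on_piece[of "N - 1" N 1 a] N by (simp add: q_def of_nat_diff)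
    then show "pathfinish q = p 1" using N by (simp add: pathfinish_def a_def)
  qed
  have "homotopic_loops V p q"
  proof (rule homotopic_loops_linear)
    fix t :: real assume t: "t \<in> {0..1}"
    then obtain m where m: "m < N" "q t \<in> closed_segment (a m) (a (Suc m))" "p t \<in> ball (a m) \<delta>"
      using q_seg by blast
    have "closed_segment (a m) (a (Suc m)) \<subseteq> ball (a m) \<delta> \<inter> E"
      using m(1) aa aE \<delta>(1) cE by (intro closed_segment_subset convex_Int) auto
    then show "closed_segment (p t) (q t) \<subseteq> V"
      using m pE[OF t] by (intro seg_ball[of m]) auto
  qed (use p q in \<open>auto simp: pathstart_def pathfinish_def\<close>)
  moreover obtain c where c: "c \<in> E" "\<forall>(a, b)\<in>(\<lambda>m. (a m, a (Suc m))) ` {..<N}. \<forall>i\<in>I. \<Lambda> i c \<notin> span {\<Lambda> i a, \<Lambda> i b}"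
    using generic_apex[of "(\<lambda>m. (a m, a (Suc m))) ` {..<N}"] by auto
  have cone: "closed_segment (q t) c \<subseteq> V" if "t \<in> {0..1}" for t
  proof -
    obtain m where m: "m < N" "q t \<in> closed_segment (a m) (a (Suc m))" using q_seg[OF \<open>t \<in> {0..1}\<close>] by blast
    show ?thesis using c m by (intro cone_subset[OF seg[OF m(1)] c(1) _ m(2)]) auto
  qed
  have "homotopic_loops V q (linepath c c)"
    by (rule homotopic_loops_linear) (use q p cone in \<open>auto simp: pathstart_def pathfinish_def linepath_refl path_def\<close>)
  moreover have "c \<in> V" using cone[of 0] by auto
  ultimately show "\<exists>a. a \<in> V \<and> homotopic_loops V p (linepath a a)" by (meson homotopic_loops_trans)
qed

lemma V_nonempty: "V \<noteq> {}"
proof -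
  obtain c where c: "c \<in> E" "\<forall>(a, b)\<in>{(0, 0)}. \<forall>i\<in>I. \<Lambda> i c \<notin> span {\<Lambda> i a, \<Lambda> i b}"
    using generic_apex[of "{(0, 0)}"] by auto
  have "c \<notin> W i" if "i \<in> I" for i
    using c(2) ker[OF that, of c] that span_zero[of "{\<Lambda> i 0, \<Lambda> i 0}"] by auto
  then show ?thesis using c(1) by (auto simp: V_def)
qed

end

section \<open>The topology of the quotient\<close>

lemma monic_root_bound:
  fixes x :: complex
  assumes "lead_coeff p = 1" "poly p x = 0"
  shows "cmod x \<le> 1 + (\<Sum>j\<le>Polynomial.degree p. cmod (Polynomial.coeff p j))"
proof (cases "cmod x \<le> 1")
  case True
  then show ?thesis by (meson add_increasing2 norm_ge_zero sum_nonneg)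
next
  case False
  define d where "d = Polynomial.degree p"
  have "d \<noteq> 0"
  proof
    assume "d = 0"
    then have "p = 1" using assms(1) unfolding d_def by (metis degree_0_id one_pCons)
    then show False using assms(2) by simp
  qed
  have "poly p x = (\<Sum>j<d. Polynomial.coeff p j * x ^ j) + x ^ d"
    using assms(1) by (simp add: poly_altdef d_def flip: lessThan_Suc_atMost)
  then have "x ^ d = - (\<Sum>j<d. Polynomial.coeff p j * x ^ j)" using assms(2) by (simp add: eq_neg_iff_add_eq_0 add.commute)
  then have "cmod x ^ d = cmod (\<Sum>j<d. Polynomial.coeff p j * x ^ j)" by (metis norm_minus_cancel norm_power)
  also have "\<dots> \<le> (\<Sum>j<d. cmod (Polynomial.coeff p j) * cmod x ^ (d - 1))"
    using False by (intro order_trans[OF norm_sum] sum_mono)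
      (auto simp: norm_mult norm_power intro!: mult_left_mono power_increasing)
  also have "\<dots> = (\<Sum>j<d. cmod (Polynomial.coeff p j)) * cmod x ^ (d - 1)" by (simp add: sum_distrib_right)
  finally have "cmod x * cmod x ^ (d - 1) \<le> (\<Sum>j<d. cmod (Polynomial.coeff p j)) * cmod x ^ (d - 1)"
    using \<open>d \<noteq> 0\<close> by (metis power_eq_if)
  moreover have "cmod x ^ (d - 1) > 0" using False by (intro zero_less_power) linarith
  ultimately have "cmod x \<le> (\<Sum>j<d. cmod (Polynomial.coeff p j))" by (simp only: mult_le_cancel_right_pos)
  also have "\<dots> \<le> (\<Sum>j\<le>d. cmod (Polynomial.coeff p j))" by (intro sum_mono2) auto
  finally show ?thesis by (simp add: d_def)
qed

lemma cramer_2x2: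
  fixes a b :: "'a::field"
  assumes "D = a * b' - a' * b" "D \<noteq> 0"
  shows "(u * b' - v * a') / D * a + (a * v - b * u) / D * a' = u"
    and "(u * b' - v * a') / D * b + (a * v - b * u) / D * b' = v"
proof -
  have "(u * b' - v * a') * a + (a * v - b * u) * a' = u * D"
    "(u * b' - v * a') * b + (a * v - b * u) * b' = v * D"
    unfolding assms(1) by (simp_all add: algebra_simps)
  then show "(u * b' - v * a') / D * a + (a * v - b * u) / D * a' = u"
    "(u * b' - v * a') / D * b + (a * v - b * u) / D * b' = v"
    using assms(2) by (simp_all add: nonzero_divide_eq_eq flip: add_divide_distrib)
qed

context linear_action
begin

text \<open>The points of the representation as vectors of a normed space.  The dimension \<open>n\<close> is not a
  type, so they are placed in the space of bounded sequences.\<close>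

definition vectors :: "(nat, complex) bcontfun set"
  where "vectors = {x. apply_bcontfun x \<in> pts}"

definition vector :: "(nat \<Rightarrow> complex) \<Rightarrow> (nat, complex) bcontfun"
  where "vector x = Bcontfun x"

lemma apply_vector [simp]: assumes "x \<in> pts" shows "apply_bcontfun (vector x) = x"
proof -
  have "range x \<subseteq> insert 0 (x ` {..<n})" using assms by (auto simp: pts_def) (metis imageI lessThan_iff not_le)
  then have "finite (range x)" by (rule finite_subset) simp
  then have "bounded (range x)" by (rule finite_imp_bounded)
  then have "x \<in> bcontfun" by (simp add: bcontfun_def)
  then show ?thesis by (simp add: vector_def Bcontfun_inverse)
qed

lemma vector_vectors [simp]: "x \<in> pts \<Longrightarrow> vector x \<in> vectors"
  by (simp add: vectors_def)

lemma vector_apply [simp]: "x \<in> vectors \<Longrightarrow> vector (apply_bcontfun x) = x"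
  by (simp add: vector_def apply_bcontfun_inverse)

lemma continuous_coordinate: "continuous_on S (\<lambda>x :: (nat, complex) bcontfun. apply_bcontfun x i)"
  unfolding continuous_on_iff using dist_fun_lt_imp_dist_val_lt by blast

lemma continuous_apply_bcontfun: "continuous_on S (apply_bcontfun :: (nat, complex) bcontfun \<Rightarrow> _)"
  by (rule continuous_on_coordinatewise_then_product) (rule continuous_coordinate)

lemma continuous_into_vectors:
  fixes f :: "'s::topological_space \<Rightarrow> (nat, complex) bcontfun"
  assumes f: "\<And>s. s \<in> S \<Longrightarrow> f s \<in> vectors"
    and cont: "\<And>i. i < n \<Longrightarrow> continuous_on S (\<lambda>s. apply_bcontfun (f s) i)"
  shows "continuous_on S f"
  unfolding continuous_on_def
proof
  fix s assume s: "s \<in> S"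
  have le: "dist (f t) (f s) \<le> (\<Sum>i<n. dist (f t i) (f s i))" if "t \<in> S" for t
  proof (rule dist_bound)
    fix k
    show "dist (f t k) (f s k) \<le> (\<Sum>i<n. dist (f t i) (f s i))"
    proof (cases "k < n")
      case True
      then show ?thesis by (intro member_le_sum[of k "{..<n}" "\<lambda>i. dist (f t i) (f s i)"]) auto
    next
      case False
      then have "f t k = 0" "f s k = 0" using f[OF that] f[OF s] by (auto simp: vectors_def pts_def)
      then show ?thesis by (simp add: sum_nonneg)
    qed
  qed
  have "((\<lambda>t. \<Sum>i<n. dist (f t i) (f s i)) \<longlongrightarrow> (\<Sum>i<n. dist (f s i) (f s i))) (at s within S)"
    using cont s by (intro tendsto_intros) (auto simp: continuous_on_def)
  then have lim: "((\<lambda>t. \<Sum>i<n. dist (f t i) (f s i)) \<longlongrightarrow> 0) (at s within S)" by simp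
  have "((\<lambda>t. dist (f t) (f s)) \<longlongrightarrow> 0) (at s within S)"
  proof (rule tendsto_sandwich[OF _ _ tendsto_const lim])
    show "\<forall>\<^sub>F t in at s within S. dist (f t) (f s) \<le> (\<Sum>i<n. dist (f t i) (f s i))"
      using le by (auto simp: eventually_at_filter)
  qed auto
  then show "(f \<longlongrightarrow> f s) (at s within S)" by (subst tendsto_dist_iff)
qed

lemma compact_box: "compact {x \<in> vectors. \<forall>i<n. cmod (apply_bcontfun x i) \<le> C}"
proof -
  let ?B = "PiE UNIV (\<lambda>i. if i < n then cball 0 C else {0::complex})"
  have "compactin (product_topology (\<lambda>_. euclidean) UNIV) ?B"
    by (subst compactin_PiE) auto
  then have "compact ?B" by (simp add: euclidean_product_topology)
  have B: "x \<in> ?B \<longleftrightarrow> x \<in> pts \<and> (\<forall>i<n. cmod (x i) \<le> C)" for x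
  proof -
    have "x \<in> ?B \<longleftrightarrow> (\<forall>i. x i \<in> (if i < n then cball 0 C else {0}))" by (simp add: PiE_iff)
    also have "\<dots> \<longleftrightarrow> (\<forall>i. (i < n \<longrightarrow> cmod (x i) \<le> C) \<and> (n \<le> i \<longrightarrow> x i = 0))"
      by (intro iff_allI) simp
    finally show ?thesis by (auto simp: pts_def)
  qed
  have "continuous_on ?B vector"
  proof (rule continuous_into_vectors)
    fix i assume "i < n"
    have "continuous_on ?B (\<lambda>x. x i)"
      by (rule continuous_on_subset[OF continuous_on_product_coordinates]) simp
    then show "continuous_on ?B (\<lambda>x. apply_bcontfun (vector x) i)"
      by (rule continuous_on_eq) (use B in auto)
  qed (use B in auto)
  then have "compact (vector ` ?B)" using \<open>compact ?B\<close> by (rule compact_continuous_image)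
  moreover have "vector ` ?B = {x \<in> vectors. \<forall>i<n. cmod (apply_bcontfun x i) \<le> C}"
  proof (intro subset_antisym subsetI)
    fix x assume "x \<in> {x \<in> vectors. \<forall>i<n. cmod (apply_bcontfun x i) \<le> C}"
    then show "x \<in> vector ` ?B"
      using B by (intro image_eqI[of _ _ "apply_bcontfun x"]) (auto simp: vectors_def vector_def apply_bcontfun_inverse)
  qed (use B in auto)
  ultimately show ?thesis by simp
qed

definition vact :: "'g \<Rightarrow> (nat, complex) bcontfun \<Rightarrow> (nat, complex) bcontfun"
  where "vact g x = vector (act g (apply_bcontfun x))"

definition vpoint :: "(nat, complex) bcontfun \<Rightarrow> cpoly \<Rightarrow> complex"
  where "vpoint x = point (apply_bcontfun x)"

lemma apply_vact [simp]: "apply_bcontfun (vact g x) = act g (apply_bcontfun x)"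
  by (simp add: vact_def)

lemma vact_vectors [simp]: "vact g x \<in> vectors"
  by (simp add: vectors_def)

lemma continuous_act: "continuous_on S (\<lambda>x. act g (apply_bcontfun x) i)"
  by (cases "i < n") (auto simp: act_def intro!: continuous_intros continuous_coordinate)

lemma continuous_vact: "continuous_on S (vact g)"
  by (rule continuous_into_vectors) (auto intro: continuous_act)

lemma continuous_ev_apply: "continuous_on S (\<lambda>x. ev (apply_bcontfun x) f)"
  by (rule continuous_on_compose2[OF continuous_ev[of UNIV] continuous_apply_bcontfun]) auto

lemma continuous_vpoint: "continuous_on S vpoint"
proof (rule continuous_on_coordinatewise_then_product)
  fix f
  show "continuous_on S (\<lambda>x. vpoint x f)"
    by (cases "f \<in> A") (auto simp: vpoint_def point_def continuous_ev_apply)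
qed

lemma vpoint_vact: "g \<in> carrier G \<Longrightarrow> vpoint (vact g x) = vpoint x"
  by (simp add: vpoint_def point_act)

lemma continuous_eval: "continuous_on S (\<lambda>z :: cpoly \<Rightarrow> complex. z f)"
  by (rule continuous_on_subset[OF continuous_on_product_coordinates]) simp

text \<open>The quotient map is open.  The coordinates are integral over the invariants, so they are
  bounded where finitely many invariants are; hence only a compact set of points needs to be kept
  away from \<open>v\<close>, and finitely many invariants suffice to separate their orbits from that of \<open>v\<close>.\<close>

lemma vpoint_nhd:
  assumes v: "v \<in> vectors" and T: "open T" "v \<in> T"
  shows "\<exists>N. open N \<and> vpoint v \<in> N \<and> (\<forall>x\<in>vectors. vpoint x \<in> N \<longrightarrow> (\<exists>g\<in>carrier G. vact g x \<in> T))"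
proof -
  define P where "P i = orbit_poly (Var i)" for i
  have P: "Polynomial.coeff (P i) j \<in> A" "lead_coeff (P i) = 1" if "i < n" for i j
    using coeff_orbit_poly[of "Var i" j] that by (simp_all add: P_def orbit_poly_def lead_coeff_prod)
  have P0: "poly (P i) (Var i) = 0" if "i < n" for i
    using finite_G subst_one[of "Var i"] that
    by (auto simp: P_def orbit_poly_def poly_prod prod_zero_iff intro!: bexI[of _ "\<one>\<^bsub>G\<^esub>"])
  define \<beta> where "\<beta> z = (\<Sum>i<n. \<Sum>j\<le>Polynomial.degree (P i). cmod (z (Polynomial.coeff (P i) j)))" for z :: "cpoly \<Rightarrow> complex"
  have bound: "cmod (apply_bcontfun x i) \<le> 1 + \<beta> (vpoint x)" if i: "i < n" for x i
  proof -
    let ?e = "ev (apply_bcontfun x)"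
    interpret e: comm_ring_hom ?e by (rule ev_hom)
    let ?p = "map_poly ?e (P i)"
    have c: "Polynomial.coeff ?p j = vpoint x (Polynomial.coeff (P i) j)" for j
      using P(1)[OF i] by (simp add: coeff_map_poly vpoint_def point_def)
    have "Polynomial.coeff ?p (Polynomial.degree (P i)) = 1"
      using P(2)[OF i] by (simp add: coeff_map_poly)
    then have d: "Polynomial.degree ?p = Polynomial.degree (P i)"
      by (intro antisym degree_map_poly_le le_degree) auto
    have "poly ?p (?e (Var i)) = ?e (poly (P i) (Var i))"
      by (simp add: poly_altdef d coeff_map_poly)
    then have "poly ?p (apply_bcontfun x i) = 0" using P0[OF i] by simp
    moreover have "lead_coeff ?p = 1" using P(2)[OF i] by (simp add: d coeff_map_poly)
    ultimately have "cmod (apply_bcontfun x i) \<le> 1 + (\<Sum>j\<le>Polynomial.degree (P i). cmod (vpoint x (Polynomial.coeff (P i) j)))"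
      using monic_root_bound[of ?p "apply_bcontfun x i", unfolded d c] c d by metis
    also have "\<dots> \<le> 1 + \<beta> (vpoint x)"
      unfolding \<beta>_def using i
      by (intro add_left_mono member_le_sum[of i "{..<n}" "\<lambda>i. \<Sum>j\<le>Polynomial.degree (P i). cmod (vpoint x (Polynomial.coeff (P i) j))"])
        (auto intro: sum_nonneg)
    finally show ?thesis .
  qed
  define K where "K = {x \<in> vectors. \<forall>i<n. cmod (apply_bcontfun x i) \<le> 2 + \<beta> (vpoint v)}"
  have K: "compact K" unfolding K_def by (rule compact_box)
  define K0 where "K0 = K - (\<Union>g\<in>carrier G. K \<inter> vact g -` T)"
  have "openin (top_of_set K) (K \<inter> vact g -` T)" for g
    by (rule continuous_openin_preimage_gen[OF continuous_vact T(1)])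
  then have "openin (top_of_set K) (\<Union>g\<in>carrier G. K \<inter> vact g -` T)" by (intro openin_Union) blast
  then have "closedin (top_of_set K) K0"
    unfolding K0_def by (rule closedin_diff[rotated]) simp
  then have K0: "compact K0" using K closedin_compact by blast
  define ball where "ball = (\<lambda>(f, \<epsilon>). {x. \<epsilon> < cmod (ev (apply_bcontfun x) f - ev (apply_bcontfun v) f)})"
  have ball_open: "open (ball p)" for p
    unfolding ball_def case_prod_unfold
    by (intro open_Collect_less continuous_intros continuous_ev_apply)
  have cover: "K0 \<subseteq> (\<Union>p\<in>A \<times> {0<..}. ball p)"
  proof
    fix x assume x: "x \<in> K0"
    then have xv: "x \<in> vectors" by (simp add: K0_def K_def)
    have "vpoint x \<noteq> vpoint v"
    proof
      assume "vpoint x = vpoint v"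
      then obtain g where "g \<in> carrier G" "apply_bcontfun v = act g (apply_bcontfun x)"
        using point_eq_iff[of "apply_bcontfun x" "apply_bcontfun v"] xv v by (auto simp: vpoint_def vectors_def)
      then have "vact g x = v" "g \<in> carrier G" by (auto intro: bcontfun_eqI)
      then show False using x T(2) by (auto simp: K0_def)
    qed
    then obtain f where f: "f \<in> A" "ev (apply_bcontfun x) f \<noteq> ev (apply_bcontfun v) f"
      by (auto simp: vpoint_def point_def fun_eq_iff split: if_splits)
    let ?\<epsilon> = "cmod (ev (apply_bcontfun x) f - ev (apply_bcontfun v) f) / 2"
    have "x \<in> ball (f, ?\<epsilon>)" "(f, ?\<epsilon>) \<in> A \<times> {0<..}" using f by (auto simp: ball_def)
    then show "x \<in> (\<Union>p\<in>A \<times> {0<..}. ball p)" by blast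
  qed
  obtain C where C: "C \<subseteq> A \<times> {0<..}" "finite C" "K0 \<subseteq> (\<Union>p\<in>C. ball p)"
    using compactE_image[OF K0 _ cover] ball_open by metis
  define N where "N = {z. \<beta> z < \<beta> (vpoint v) + 1} \<inter> (\<Inter>(f, \<epsilon>)\<in>C. {z. cmod (z f - ev (apply_bcontfun v) f) < \<epsilon>})"
  have "open {z. \<beta> z < \<beta> (vpoint v) + 1}"
    unfolding \<beta>_def by (intro open_Collect_less continuous_intros continuous_eval)
  moreover have "open {z :: cpoly \<Rightarrow> complex. cmod (z f - c) < \<epsilon>}" for f c \<epsilon>
    by (intro open_Collect_less continuous_intros continuous_eval)
  ultimately have "open N"
    unfolding N_def using C(2) by (intro open_Int open_INT) auto
  moreover have "vpoint v \<in> N"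
    using C(1) by (auto simp: N_def vpoint_def point_def)
  moreover have "\<exists>g\<in>carrier G. vact g x \<in> T" if x: "x \<in> vectors" "vpoint x \<in> N" for x
  proof -
    have "cmod (apply_bcontfun x i) \<le> 2 + \<beta> (vpoint v)" if "i < n" for i
      using bound[OF that, of x] x(2) by (auto simp: N_def)
    then have "x \<in> K" using x(1) by (simp add: K_def)
    moreover have "x \<notin> ball p" if p: "p \<in> C" for p
    proof -
      obtain f \<epsilon> where f: "p = (f, \<epsilon>)" "f \<in> A" using C(1) p by auto
      have "\<forall>p\<in>C. vpoint x \<in> (case p of (f, \<epsilon>) \<Rightarrow> {z. cmod (z f - ev (apply_bcontfun v) f) < \<epsilon>})"
        using x(2) by (simp add: N_def)
      then have "cmod (vpoint x f - ev (apply_bcontfun v) f) < \<epsilon>" using p f(1) by fastforce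
      then show ?thesis using f by (simp add: ball_def vpoint_def point_def)
    qed
    ultimately show ?thesis using C(3) by (auto simp: K0_def)
  qed
  ultimately show ?thesis by blast
qed

lemma free_at_act:
  assumes x: "x \<in> pts" "free_at x" and g: "g \<in> carrier G" shows "free_at (act g x)"
  unfolding free_at_def
proof (intro ballI impI)
  fix h assume h: "h \<in> carrier G" "act h (act g x) = act g x"
  have "act (inv\<^bsub>G\<^esub> g \<otimes>\<^bsub>G\<^esub> (h \<otimes>\<^bsub>G\<^esub> g)) x = act (inv\<^bsub>G\<^esub> g) (act h (act g x))"
    using g h(1) by (simp add: act_act)
  also have "\<dots> = act (inv\<^bsub>G\<^esub> g) (act g x)" by (simp only: h(2))
  also have "\<dots> = x" using g x by (simp add: act_act act_one)
  finally have "act (inv\<^bsub>G\<^esub> g \<otimes>\<^bsub>G\<^esub> (h \<otimes>\<^bsub>G\<^esub> g)) x = x" .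
  then have "inv\<^bsub>G\<^esub> g \<otimes>\<^bsub>G\<^esub> (h \<otimes>\<^bsub>G\<^esub> g) = \<one>\<^bsub>G\<^esub>" using x(2) g h by (simp add: free_at_def)
  then have "h \<otimes>\<^bsub>G\<^esub> g = g" using g h by (metis inv_closed inv_equality inv_inv m_closed inv_solve_left r_one)
  then show "h = \<one>\<^bsub>G\<^esub>" using g h by (metis r_cancel_one')
qed

definition free_vectors :: "(nat, complex) bcontfun set"
  where "free_vectors = {x \<in> vectors. free_at (apply_bcontfun x)}"

lemma free_action: "free_action_quotient G free_vectors vpoint vact"
proof
  show "finite (carrier G)" by (rule finite_G)
  show "continuous_on free_vectors vpoint" by (rule continuous_vpoint)
  show "continuous_on free_vectors (vact g)" for g by (rule continuous_vact)
  show vX: "vact g x \<in> free_vectors" if "g \<in> carrier G" "x \<in> free_vectors" for g x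
    using that free_at_act by (auto simp: free_vectors_def vectors_def)
  show "vact g (vact h x) = vact (g \<otimes>\<^bsub>G\<^esub> h) x" if "g \<in> carrier G" "h \<in> carrier G" for g h x
    using that by (intro bcontfun_eqI) (simp add: act_act)
  show "vact \<one>\<^bsub>G\<^esub> x = x" if "x \<in> free_vectors" for x
    using that by (intro bcontfun_eqI) (simp add: act_one free_vectors_def vectors_def)
  show "g = \<one>\<^bsub>G\<^esub>" if "g \<in> carrier G" "x \<in> free_vectors" "vact g x = x" for g x
    using that apply_vact[of g x] by (auto simp: free_vectors_def free_at_def)
  show "vpoint x = vpoint y \<longleftrightarrow> (\<exists>g\<in>carrier G. y = vact g x)" if "x \<in> free_vectors" "y \<in> free_vectors" for x y
  proof -
    have "y = vact g x \<longleftrightarrow> apply_bcontfun y = act g (apply_bcontfun x)" for g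
      by (metis apply_vact apply_bcontfun_inject)
    then show ?thesis
      using point_eq_iff[of "apply_bcontfun x" "apply_bcontfun y"] that
      by (auto simp: vpoint_def free_vectors_def vectors_def)
  qed
  show "openin (top_of_set (vpoint ` free_vectors)) (vpoint ` U)" if U: "openin (top_of_set free_vectors) U" for U
  proof (subst openin_subopen, intro ballI)
    fix z assume "z \<in> vpoint ` U"
    then obtain v where v: "v \<in> U" "z = vpoint v" by blast
    obtain T where T: "open T" "U = free_vectors \<inter> T" using U by (auto simp: openin_open)
    have "v \<in> vectors" using v(1) T(2) by (simp add: free_vectors_def)
    then obtain N where N: "open N" "vpoint v \<in> N"
      "\<forall>x\<in>vectors. vpoint x \<in> N \<longrightarrow> (\<exists>g\<in>carrier G. vact g x \<in> T)"
      using vpoint_nhd[of v T] T v(1) by blast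
    have "vpoint ` free_vectors \<inter> N \<subseteq> vpoint ` U"
    proof
      fix z' assume "z' \<in> vpoint ` free_vectors \<inter> N"
      then obtain x where x: "x \<in> free_vectors" "z' = vpoint x" "vpoint x \<in> N" by blast
      then obtain g where g: "g \<in> carrier G" "vact g x \<in> T" using N(3) by (auto simp: free_vectors_def)
      then have "vact g x \<in> U" using vX x(1) T(2) by blast
      then show "z' \<in> vpoint ` U" using vpoint_vact[OF g(1), of x] x(2) by (metis imageI)
    qed
    then show "\<exists>T. openin (top_of_set (vpoint ` free_vectors)) T \<and> z \<in> T \<and> T \<subseteq> vpoint ` U"
      using N(1,2) v T(2) by (intro exI[of _ "vpoint ` free_vectors \<inter> N"]) (auto simp: openin_open)
  qed
qed

lemma kernel_point: "a_kernel (ring_on A) (ring_on UNIV) (point x) = vanishing x"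
  by (auto simp: a_kernel_def' vanishing_def point_def)

end

context small_linear_action
begin

lemma analytic_points_regular: "analytic_points A (regular_locus A) = vpoint ` free_vectors"
proof -
  have "vanishing x \<in> regular_locus A \<longleftrightarrow> free_at x" if "x \<in> pts" for x
    using regular_iff_free[OF that] prime_vanishing[of x]
    by (simp add: regular_locus_def Spec_def primeideal_ring_on[OF subring_A])
  then have "analytic_points A (regular_locus A) = point ` {x \<in> pts. free_at x}"
    by (auto simp: analytic_points_def complex_points_eq kernel_point)
  also have "\<dots> = vpoint ` free_vectors"
  proof (intro subset_antisym subsetI)
    fix z assume "z \<in> point ` {x \<in> pts. free_at x}"
    then obtain x where "x \<in> pts" "free_at x" "z = point x" by blast
    then show "z \<in> vpoint ` free_vectors"
      by (intro image_eqI[of _ _ "vector x"]) (auto simp: vpoint_def free_vectors_def)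
  qed (auto simp: vpoint_def free_vectors_def vectors_def)
  finally show ?thesis .
qed

lemma free_vectors_topology: "simply_connected free_vectors" "free_vectors \<noteq> {}"
proof -
  let ?H = "carrier G - {\<one>\<^bsub>G\<^esub>}"
  have "\<forall>g\<in>?H. \<exists>R. fst R < n \<and> snd R < n \<and> (\<exists>x\<in>pts. \<exists>y\<in>pts.
      (act g x (fst R) - x (fst R)) * (act g y (snd R) - y (snd R))
      \<noteq> (act g y (fst R) - y (fst R)) * (act g x (snd R) - x (snd R)))"
    using no_reflections by fastforce
  then obtain R where R: "\<forall>g\<in>?H. fst (R g) < n \<and> snd (R g) < n \<and> (\<exists>x\<in>pts. \<exists>y\<in>pts.
      (act g x (fst (R g)) - x (fst (R g))) * (act g y (snd (R g)) - y (snd (R g)))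
      \<noteq> (act g y (fst (R g)) - y (fst (R g))) * (act g x (snd (R g)) - x (snd (R g))))"
    by (rule bchoice[THEN exE])
  define disp where "disp g r x = act g x r - x r" for g r x
  define \<Lambda> where "\<Lambda> g x = (disp g (fst (R g)) (apply_bcontfun x), disp g (snd (R g)) (apply_bcontfun x))" for g and x :: "(nat, complex) bcontfun"
  define W where "W g = {x \<in> vectors. act g (apply_bcontfun x) = apply_bcontfun x}" for g
  have line: "disp g r (\<lambda>i. x i + s * y i) = disp g r x + s * disp g r y" for g r s x y
    by (simp add: disp_def act_line algebra_simps)
  have disp_add: "disp g r (apply_bcontfun (x + y)) = disp g r (apply_bcontfun x) + disp g r (apply_bcontfun y)"
    and disp_scale: "disp g r (apply_bcontfun (s *\<^sub>R x)) = s *\<^sub>R disp g r (apply_bcontfun x)" for g r x y s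
  proof -
    have "apply_bcontfun (x + y) = (\<lambda>i. apply_bcontfun x i + 1 * apply_bcontfun y i)"
      by (auto simp: plus_bcontfun.rep_eq)
    then show "disp g r (apply_bcontfun (x + y)) = disp g r (apply_bcontfun x) + disp g r (apply_bcontfun y)"
      using line[of g r "apply_bcontfun x" 1 "apply_bcontfun y"] by simp
    have "apply_bcontfun (s *\<^sub>R x) = (\<lambda>i. 0 + of_real s * apply_bcontfun x i)"
      by (auto simp: scaleR_bcontfun.rep_eq scaleR_conv_of_real)
    moreover have "disp g r (\<lambda>_. 0) = 0" by (simp add: disp_def act_def)
    ultimately show "disp g r (apply_bcontfun (s *\<^sub>R x)) = s *\<^sub>R disp g r (apply_bcontfun x)"
      using line[of g r "\<lambda>_. 0" "of_real s" "apply_bcontfun x"] by (simp add: scaleR_conv_of_real)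
  qed
  interpret C: codim_two_complement vectors ?H W \<Lambda>
  proof (rule codim_two_complement.intro)
    show "subspace vectors"
      by (auto simp: subspace_def vectors_def pts_def plus_bcontfun.rep_eq scaleR_bcontfun.rep_eq zero_bcontfun.rep_eq)
    show "finite ?H" using finite_G by simp
    fix g assume g: "g \<in> ?H"
    have "closed {x. \<forall>i. act g (apply_bcontfun x) i = apply_bcontfun x i}"
      by (intro closed_Collect_all closed_Collect_eq continuous_act continuous_coordinate)
    moreover have "W g = vectors \<inter> {x. \<forall>i. act g (apply_bcontfun x) i = apply_bcontfun x i}"
      by (auto simp: W_def fun_eq_iff)
    ultimately show "closedin (top_of_set vectors) (W g)" by (auto simp: closedin_closed)
    show "\<Lambda> g x = 0" if "x \<in> W g" for x
      using that by (simp add: W_def \<Lambda>_def disp_def zero_prod_def)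
    show "linear (\<Lambda> g)"
      by (rule linearI) (simp_all only: \<Lambda>_def disp_add disp_scale add_Pair scaleR_Pair)
    fix z :: "complex \<times> complex"
    obtain x y where xy: "x \<in> pts" "y \<in> pts"
      "disp g (fst (R g)) x * disp g (snd (R g)) y \<noteq> disp g (fst (R g)) y * disp g (snd (R g)) x"
      using R g unfolding disp_def by blast
    define D where "D = disp g (fst (R g)) x * disp g (snd (R g)) y - disp g (fst (R g)) y * disp g (snd (R g)) x"
    have D: "D \<noteq> 0" using xy(3) by (simp add: D_def)
    \<comment> \<open>By Cramer's rule, some combination of \<open>x\<close> and \<open>y\<close> is mapped to \<open>z\<close>.\<close>
    define s where "s = (fst z * disp g (snd (R g)) y - snd z * disp g (fst (R g)) y) / D"
    define t where "t = (disp g (fst (R g)) x * snd z - disp g (snd (R g)) x * fst z) / D"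
    let ?u = "\<lambda>i. (0 + s * x i) + t * y i"
    have u: "?u \<in> pts" using xy by (simp add: pts_def)
    have lin: "disp g r ?u = s * disp g r x + t * disp g r y" for r
    proof -
      have "disp g r (\<lambda>_. 0) = 0" by (simp add: disp_def act_def)
      then show ?thesis using line[of g r "\<lambda>i. 0 + s * x i" t y] line[of g r "\<lambda>_. 0" s x] by simp
    qed
    have "disp g (fst (R g)) ?u = fst z" "disp g (snd (R g)) ?u = snd z"
      unfolding lin using cramer_2x2[OF D_def D] by (simp_all add: s_def t_def)
    then have "\<Lambda> g (vector ?u) = z" using u by (simp add: \<Lambda>_def prod_eq_iff)
    then show "\<exists>x\<in>vectors. \<Lambda> g x = z" using u vector_vectors by blast
  qed
  have "C.V = free_vectors"
    by (auto simp: C.V_def free_vectors_def free_at_def W_def)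
  then show "simply_connected free_vectors" "free_vectors \<noteq> {}"
    using C.simply_connected_V C.V_nonempty by simp_all
qed

theorem fundamental_group_regular_locus:
  fixes Z defines "Z \<equiv> analytic_points A (regular_locus A)"
  shows "Z \<noteq> {}" and "path_connected Z" and "z \<in> Z \<Longrightarrow> fundamental_group Z z \<cong> G"
proof -
  interpret Q: free_action_quotient G free_vectors vpoint vact by (rule free_action)
  have Z: "Z = vpoint ` free_vectors" unfolding Z_def by (rule analytic_points_regular)
  show "Z \<noteq> {}" using free_vectors_topology(2) by (simp add: Z)
  show "path_connected Z"
    unfolding Z using free_vectors_topology(1)
    by (intro path_connected_continuous_image continuous_vpoint simply_connected_imp_path_connected)
  show "fundamental_group Z z \<cong> G" if "z \<in> Z"
    using that Q.fundamental_group_quotient[OF free_vectors_topology(1)] by (auto simp: Z)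
qed

end


section \<open>The product of two faithful representations\<close>

lemma product_rep_index:
  assumes "\<beta> g \<in> carrier_mat d d" "\<rho> g \<in> carrier_mat m m" "i < d + m" "j < d + m"
  shows "product_rep d m \<beta> \<rho> g $$ (i, j) =
    (if i < d then if j < d then \<beta> g $$ (i, j) else 0 else if j < d then 0 else \<rho> g $$ (i - d, j - d))"
  using assms by (auto simp: product_rep_def index_mat_four_block)

text \<open>Faithfulness enters here: \<open>g - 1\<close> has a nonzero entry in each of the two diagonal blocks.\<close>

lemma small_product_action:
  fixes G :: "('g, 'b) monoid_scheme"
  assumes G: "group G" "finite (carrier G)"
    and \<beta>: "faithful_representation G d \<beta>" and \<rho>: "faithful_representation G m \<rho>"
  shows "small_linear_action G (d + m) (product_rep d m \<beta> \<rho>)"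
proof -
  interpret b: linear_action G d \<beta> using G \<beta> by (simp add: linear_action_def faithful_representation_def)
  interpret r: linear_action G m \<rho> using G \<rho> by (simp add: linear_action_def faithful_representation_def)
  let ?\<tau> = "product_rep d m \<beta> \<rho>" and ?n = "d + m"
  let ?M = "ring_mat TYPE(complex) ?n ()"
  have carrier: "?\<tau> g \<in> carrier_mat ?n ?n" if "g \<in> carrier G" for g
    using b.tau_carrier[OF that] r.tau_carrier[OF that] by (simp add: product_rep_def)
  have mult: "?\<tau> (g \<otimes>\<^bsub>G\<^esub> h) = ?\<tau> g * ?\<tau> h" if "g \<in> carrier G" "h \<in> carrier G" for g h
  proof -
    note c = b.tau_carrier[OF that(1)] b.tau_carrier[OF that(2)] r.tau_carrier[OF that(1)] r.tau_carrier[OF that(2)]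
    have "?\<tau> g * ?\<tau> h = four_block_mat (\<beta> g * \<beta> h + 0\<^sub>m d m * 0\<^sub>m m d) (\<beta> g * 0\<^sub>m d m + 0\<^sub>m d m * \<rho> h)
        (0\<^sub>m m d * \<beta> h + \<rho> g * 0\<^sub>m m d) (0\<^sub>m m d * 0\<^sub>m d m + \<rho> g * \<rho> h)"
      unfolding product_rep_def using c by (intro mult_four_block_mat) auto
    then show ?thesis using c that by (simp add: product_rep_def b.tau_mult r.tau_mult)
  qed
  have one: "?\<tau> \<one>\<^bsub>G\<^esub> = 1\<^sub>m ?n"
    by (simp add: product_rep_def b.tau_one r.tau_one)
  have "?\<tau> g \<in> Units ?M" if g: "g \<in> carrier G" for g
    unfolding Units_def using carrier[OF g] carrier[of "inv\<^bsub>G\<^esub> g"] g mult[of "inv\<^bsub>G\<^esub> g" g] mult[of g "inv\<^bsub>G\<^esub> g"] one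
    by (auto simp: ring_mat_def intro!: bexI[of _ "?\<tau> (inv\<^bsub>G\<^esub> g)"])
  then have rep: "representation G ?n ?\<tau>"
    using mult by (auto simp: representation_def hom_def units_of_def ring_mat_def)
  interpret linear_action G ?n ?\<tau> using G rep by (simp add: linear_action_def)
  \<comment> \<open>An entry at which \<open>\<beta> g\<close> differs from the identity and one at which \<open>\<rho> g\<close> does so
    lie in different blocks; together they give a nonzero minor.\<close>
  have entry: "\<exists>i<k. \<exists>j<k. \<sigma> g $$ (i, j) \<noteq> (if i = j then 1 else 0)"
    if "faithful_representation G k \<sigma>" "linear_action G k \<sigma>" "g \<in> carrier G" "g \<noteq> \<one>\<^bsub>G\<^esub>" for k \<sigma> g
  proof (rule ccontr)
    interpret s: linear_action G k \<sigma> by (rule that(2))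
    assume "\<not> ?thesis"
    then have "\<sigma> g = 1\<^sub>m k" using s.tau_carrier[OF that(3)] by (intro eq_matI) auto
    then have "\<sigma> g = \<sigma> \<one>\<^bsub>G\<^esub>" by (simp add: s.tau_one)
    then show False using that(1,3,4) b.one_closed by (auto simp: faithful_representation_def inj_on_def)
  qed
  have unit: "act g (\<lambda>k. if k = j then 1 else 0) i = ?\<tau> g $$ (i, j)" if "i < ?n" "j < ?n" for g i j
    using that by (simp add: act_def if_distrib[of "\<lambda>a. _ * a"] sum.delta cong: if_cong)
  show ?thesis
  proof
    fix g assume g: "g \<in> carrier G" "g \<noteq> \<one>\<^bsub>G\<^esub>"
    note idx = product_rep_index[of \<beta> g d \<rho> m, OF b.tau_carrier[OF g(1)] r.tau_carrier[OF g(1)]]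
    obtain i j where ij: "i < d" "j < d" "\<beta> g $$ (i, j) \<noteq> (if i = j then 1 else 0)"
      using entry[OF \<beta> b.linear_action_axioms g] by blast
    obtain i' j' where ij': "i' < m" "j' < m" "\<rho> g $$ (i', j') \<noteq> (if i' = j' then 1 else 0)"
      using entry[OF \<rho> r.linear_action_axioms g] by blast
    let ?x = "\<lambda>k. if k = j then 1 else (0::complex)" and ?y = "\<lambda>k. if k = d + j' then 1 else (0::complex)"
    have "act g ?x i - ?x i \<noteq> 0" "act g ?y (d + i') - ?y (d + i') \<noteq> 0" "act g ?y i - ?y i = 0"
      using ij ij' by (auto simp: unit idx split: if_splits)
    then have "(act g ?x i - ?x i) * (act g ?y (d + i') - ?y (d + i'))
        \<noteq> (act g ?y i - ?y i) * (act g ?x (d + i') - ?x (d + i'))" by simp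
    moreover have "?x \<in> pts" "?y \<in> pts" using ij ij' by (auto simp: pts_def)
    moreover have "i < ?n" "d + i' < ?n" using ij ij' by auto
    ultimately show "\<exists>r<?n. \<exists>r'<?n. \<exists>x\<in>pts. \<exists>y\<in>pts.
        (act g x r - x r) * (act g y r' - y r') \<noteq> (act g y r - y r) * (act g x r' - x r')" by blast
  qed
qed

theorem corollary22p7:
  fixes G :: "('g, 'b) monoid_scheme"
    and d :: nat and \<beta> :: "'g \<Rightarrow> complex mat"
  assumes "group G" and "finite (carrier G)"
    and "faithful_representation G d \<beta>"
  shows "\<forall>m (\<rho> :: 'g \<Rightarrow> complex mat). faithful_representation G m \<rho> \<longrightarrow>
    Z_regular G d m \<beta> \<rho> \<noteq> {} \<and>
    path_connected (Z_regular G d m \<beta> \<rho>) \<and>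
    (\<forall>z \<in> Z_regular G d m \<beta> \<rho>. fundamental_group (Z_regular G d m \<beta> \<rho>) z \<cong> G)"
proof (intro allI impI)
  fix m and \<rho> :: "'g \<Rightarrow> complex mat"
  assume "faithful_representation G m \<rho>"
  then interpret small_linear_action G "d + m" "product_rep d m \<beta> \<rho>"
    using small_product_action assms by blast
  show "Z_regular G d m \<beta> \<rho> \<noteq> {} \<and> path_connected (Z_regular G d m \<beta> \<rho>) \<and>
    (\<forall>z \<in> Z_regular G d m \<beta> \<rho>. fundamental_group (Z_regular G d m \<beta> \<rho>) z \<cong> G)"
    unfolding Z_regular_def Z_ring_def using fundamental_group_regular_locus by blast
qed

end
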